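(* Suppose that one of the problems Check, Boole, or Witness can be solved in time $O(|\mathcal{D}|^{2-\epsilon}+|q|^{2})$ or in time $O(|\mathcal{D}|^{2}+|q|^{2-\epsilon})$ for some $\epsilon>0$. Then the OV-hypothesis fails. This remains true when the problems are restricted to sparse graph databases.
   Context: $\Sigma$ is a fixed finite alphabet of constant size. A graph database over $\Sigma$ is a pair $\mathcal{D}=(V_{\mathcal D},E_{\mathcal D})$ with a finite node set and arc set $E_{\mathcal D}\subseteq V_{\mathcal D}\times\Sigma\times V_{\mathcal D}$, of size $|\mathcal D|=\max\{|V_{\mathcal D}|,|E_{\mathcal D}|\}$, represented by adjacency lists (a list of nodes and, per node and letter, a list of successors). A path from $u$ to $v$ is a sequence $u=w_0,a_1,w_1,\dots,a_k,w_k=v$ ($k\ge0$) with $(w_{i-1},a_i,w_i)\in E_{\mathcal D}$, labelled by $a_1\cdots a_k$. An RPQ $q$ is a regular expression over $\Sigma$ (built from $\varepsilon$, letters, concatenation, alternation, Kleene plus), $|q|$ its length; $q(\mathcal D)$ is the set of pairs $(u,v)$ of nodes such that some path from $u$ to $v$ is labelled by a word in the language of $q$. Problems: Boole (given $\mathcal D,q$, decide $q(\mathcal D)\ne\emptyset$); Check (given $\mathcal D,q,u,v$, decide $(u,v)\in q(\mathcal D)$); Witness (given $\mathcal D,q$, output some element of $q(\mathcal D)$ or report there is none). A class of graph databases is sparse if there is a constant $c$ with $|E_{\mathcal D}|\le c|V_{\mathcal D}|$ for all its members. Model: RAM with logarithmic word size. OV problem: given sets $A,B$ each of $n$ Boolean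 vectors of dimension $d$, decide whether some $\vec a\in A$, $\vec b\in B$ are orthogonal. OV-hypothesis: for every $\epsilon>0$ there is no algorithm solving OV in time $O(n^{2-\epsilon}\mathrm{poly}(d))$. *)

theory Defs
  imports Complex_Main "HOL-Library.Log_Nat" "HOL-Computational_Algebra.Polynomial"
begin

section \<open>Graph databases and regular path queries\<close>

record ('v, 'a) graph_db =
  nodes :: "'v set"
  arcs :: "('v \<times> 'a \<times> 'v) set"

definition graph_db_over :: "'a set \<Rightarrow> ('v, 'a) graph_db \<Rightarrow> bool" where
  "graph_db_over \<Sigma> D \<longleftrightarrow> finite (nodes D) \<and> arcs D \<subseteq> nodes D \<times> \<Sigma> \<times> nodes D"

definition db_size :: "('v, 'a) graph_db \<Rightarrow> nat" where
  "db_size D = max (card (nodes D)) (card (arcs D))"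

text \<open>A class of graph databases is sparse iff it is contained in \<^term>\<open>sparse_graphs c\<close>
  for some constant \<open>c\<close>.\<close>

definition sparse_graphs :: "real \<Rightarrow> ('v, 'a) graph_db set" where
  "sparse_graphs c = {D. real (card (arcs D)) \<le> c * real (card (nodes D))}"

inductive labelled_path :: "('v, 'a) graph_db \<Rightarrow> 'v \<Rightarrow> 'a list \<Rightarrow> 'v \<Rightarrow> bool"
  for D :: "('v, 'a) graph_db" where
  empty: "u \<in> nodes D \<Longrightarrow> labelled_path D u [] u"
| arc: "(u, a, x) \<in> arcs D \<Longrightarrow> labelled_path D x w v \<Longrightarrow> labelled_path D u (a # w) v"

datatype (letters: 'a) regex =
    Eps
  | Letter 'a
  | Conc "'a regex" "'a regex"
  | Alt "'a regex" "'a regex"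
  | Plus "'a regex"

fun lang :: "'a regex \<Rightarrow> 'a list set" where
  "lang Eps = {[]}"
| "lang (Letter a) = {[a]}"
| "lang (Conc r s) = {v @ w | v w. v \<in> lang r \<and> w \<in> lang s}"
| "lang (Alt r s) = lang r \<union> lang s"
| "lang (Plus r) = {concat ws | ws. ws \<noteq> [] \<and> set ws \<subseteq> lang r}"

definition rpq_result :: "'a regex \<Rightarrow> ('v, 'a) graph_db \<Rightarrow> ('v \<times> 'v) set" where
  "rpq_result q D = {(u, v). \<exists>w \<in> lang q. labelled_path D u w v}"

text \<open>The expression written out as a fully parenthesised string; \<open>|q|\<close> is its length.\<close>

datatype 'a symbol = LPar | RPar | EpsSym | ConcSym | AltSym | PlusSym | LetterSym 'a

fun regex_string :: "'a regex \<Rightarrow> 'a symbol list" where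
  "regex_string Eps = [EpsSym]"
| "regex_string (Letter a) = [LetterSym a]"
| "regex_string (Conc r s) = [LPar] @ regex_string r @ [ConcSym] @ regex_string s @ [RPar]"
| "regex_string (Alt r s) = [LPar] @ regex_string r @ [AltSym] @ regex_string s @ [RPar]"
| "regex_string (Plus r) = [LPar] @ regex_string r @ [RPar, PlusSym]"

definition regex_size :: "'a regex \<Rightarrow> nat" where
  "regex_size q = length (regex_string q)"


section \<open>Random access machines with logarithmic word size\<close>

text \<open>Finitely many registers (those named in the program) and an array of memory cells, which is
  accessed indirectly. Every instruction takes unit time.\<close>

datatype binop = Add | Sub | Mul | Div | Mod | And | Or | Xor | Shl | Shr

fun eval_binop :: "binop \<Rightarrow> nat \<Rightarrow> nat \<Rightarrow> nat" where
  "eval_binop Add x y = x + y"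
| "eval_binop Sub x y = x - y"
| "eval_binop Mul x y = x * y"
| "eval_binop Div x y = x div y"
| "eval_binop Mod x y = x mod y"
| "eval_binop And x y = and x y"
| "eval_binop Or x y = or x y"
| "eval_binop Xor x y = xor x y"
| "eval_binop Shl x y = push_bit y x"
| "eval_binop Shr x y = drop_bit y x"

datatype instr =
    Const nat nat            \<comment> \<open>register := constant\<close>
  | Move nat nat             \<comment> \<open>register := register\<close>
  | Bin binop nat nat nat    \<comment> \<open>register := register op register\<close>
  | Load nat nat             \<comment> \<open>register := memory[register]\<close>
  | Store nat nat            \<comment> \<open>memory[register] := register\<close>
  | Jump nat
  | JumpZero nat nat         \<comment> \<open>if register = 0, jump\<close>

type_synonym program = "instr list"

record ram_state =
  pc :: nat
  reg :: "nat \<Rightarrow> nat"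
  mem :: "nat \<Rightarrow> nat"

text \<open>Words have \<open>w\<close> bits. A register assignment whose value does not fit into a word is an error,
  and the machine gets stuck.\<close>

definition set_reg :: "nat \<Rightarrow> nat \<Rightarrow> nat \<Rightarrow> ram_state \<Rightarrow> ram_state option" where
  "set_reg w r x s =
     (if x < 2 ^ w then Some (s\<lparr>pc := Suc (pc s), reg := (reg s)(r := x)\<rparr>) else None)"

fun exec_instr :: "nat \<Rightarrow> instr \<Rightarrow> ram_state \<Rightarrow> ram_state option" where
  "exec_instr w (Const r k) s = set_reg w r k s"
| "exec_instr w (Move r r1) s = set_reg w r (reg s r1) s"
| "exec_instr w (Bin f r r1 r2) s = set_reg w r (eval_binop f (reg s r1) (reg s r2)) s"
| "exec_instr w (Load r r1) s = set_reg w r (mem s (reg s r1)) s"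
| "exec_instr w (Store r1 r2) s =
     Some (s\<lparr>pc := Suc (pc s), mem := (mem s)(reg s r1 := reg s r2)\<rparr>)"
| "exec_instr w (Jump l) s = Some (s\<lparr>pc := l\<rparr>)"
| "exec_instr w (JumpZero r l) s =
     Some (s\<lparr>pc := (if reg s r = 0 then l else Suc (pc s))\<rparr>)"

inductive ram_steps :: "nat \<Rightarrow> program \<Rightarrow> nat \<Rightarrow> ram_state \<Rightarrow> ram_state \<Rightarrow> bool"
  for w :: nat and P :: program where
  refl: "ram_steps w P 0 s s"
| step: "pc s < length P \<Longrightarrow> exec_instr w (P ! pc s) s = Some s' \<Longrightarrow> ram_steps w P t s' s''
    \<Longrightarrow> ram_steps w P (Suc t) s s''"

definition initial_state :: "nat list \<Rightarrow> ram_state" where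
  "initial_state xs =
     \<lparr>pc = 0, reg = (\<lambda>_. 0), mem = (\<lambda>i. if i < length xs then xs ! i else 0)\<rparr>"

text \<open>The machine halts when the program counter leaves the program. The output is found in the
  registers.\<close>

definition ram_computes :: "nat \<Rightarrow> program \<Rightarrow> nat list \<Rightarrow> nat \<Rightarrow> (nat \<Rightarrow> nat) \<Rightarrow> bool" where
  "ram_computes w P xs t out \<longleftrightarrow>
     (\<exists>s. ram_steps w P t (initial_state xs) s \<and> length P \<le> pc s \<and> out = reg s)"

record 'i problem =
  instances :: "'i set"
  encoding :: "'i \<Rightarrow> nat list"
  correct_output :: "'i \<Rightarrow> (nat \<Rightarrow> nat) \<Rightarrow> bool"

text \<open>Running time at most \<open>T\<close>, with word size \<open>O(log N)\<close> for inputs occupying \<open>N\<close> cells. The word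
  size constant \<open>c\<close> may depend on the program, but not on the input.\<close>

definition solves_within :: "program \<Rightarrow> 'i problem \<Rightarrow> ('i \<Rightarrow> real) \<Rightarrow> bool" where
  "solves_within P \<Pi> T \<longleftrightarrow>
     (\<exists>c::nat. \<forall>x \<in> instances \<Pi>. \<exists>t out.
        ram_computes (c * ceillog2 (length (encoding \<Pi> x) + 2)) P (encoding \<Pi> x) t out
        \<and> real t \<le> T x \<and> correct_output \<Pi> x out)"

definition solvable_in_O :: "'i problem \<Rightarrow> ('i \<Rightarrow> real) \<Rightarrow> bool" where
  "solvable_in_O \<Pi> f \<longleftrightarrow> (\<exists>P C. solves_within P \<Pi> (\<lambda>x. C * f x))"


section \<open>The problems Check, Boole and Witness\<close>

text \<open>The alphabet is \<open>{..<\<sigma>}\<close> and the nodes are numbered \<open>0, \<dots>, n - 1\<close>. In an adjacency list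
  representation \<open>L\<close>, the list \<open>L ! u ! a\<close> contains the \<open>a\<close>-successors of the node \<open>u\<close>, in any order.\<close>

type_synonym adj_lists = "nat list list list"

definition adj_lists_over :: "nat \<Rightarrow> adj_lists \<Rightarrow> bool" where
  "adj_lists_over \<sigma> L \<longleftrightarrow>
     (\<forall>row \<in> set L. length row = \<sigma> \<and> (\<forall>vs \<in> set row. distinct vs \<and> set vs \<subseteq> {..<length L}))"

definition db_of :: "adj_lists \<Rightarrow> (nat, nat) graph_db" where
  "db_of L = \<lparr>nodes = {..<length L},
     arcs = {(u, a, v). u < length L \<and> a < length (L ! u) \<and> v \<in> set (L ! u ! a)}\<rparr>"

lemma graph_db_over_db_of:
  assumes "adj_lists_over \<sigma> L"
  shows "graph_db_over {..<\<sigma>} (db_of L)"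
proof -
  have "a < \<sigma> \<and> v < length L" if "u < length L" "a < length (L ! u)" "v \<in> set (L ! u ! a)"
    for u a v
  proof -
    have "L ! u \<in> set L" "L ! u ! a \<in> set (L ! u)"
      using that by simp_all
    then show ?thesis
      using assms that(2,3) unfolding adj_lists_over_def by (metis lessThan_iff subsetD)
  qed
  then show ?thesis
    by (auto simp: graph_db_over_def db_of_def)
qed

lemma ex_adj_lists:
  fixes D :: "(nat, nat) graph_db"
  assumes "graph_db_over {..<\<sigma>} D" "nodes D = {..<n}"
  shows "\<exists>L. adj_lists_over \<sigma> L \<and> db_of L = D"
proof -
  define succs where "succs u a = {v. (u, a, v) \<in> arcs D}" for u a
  define L where "L = map (\<lambda>u. map (\<lambda>a. sorted_list_of_set (succs u a)) [0..<\<sigma>]) [0..<n]"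
  have sub: "arcs D \<subseteq> {..<n} \<times> {..<\<sigma>} \<times> {..<n}"
    using assms by (simp add: graph_db_over_def)
  then have "succs u a \<subseteq> {..<n}" for u a
    by (auto simp: succs_def)
  moreover from this have "finite (succs u a)" for u a
    by (rule finite_subset) simp
  ultimately have "adj_lists_over \<sigma> L"
    and "arcs (db_of L) = {(u, a, v). u < n \<and> a < \<sigma> \<and> v \<in> succs u a}"
    by (auto simp: adj_lists_over_def db_of_def L_def)
  moreover have "{(u, a, v). u < n \<and> a < \<sigma> \<and> v \<in> succs u a} = arcs D"
    using sub by (auto simp: succs_def)
  moreover have "nodes (db_of L) = nodes D"
    using assms by (simp add: db_of_def L_def)
  ultimately show ?thesis
    by (intro exI[of _ L]) simp
qed

definition block :: "nat list \<Rightarrow> nat list" where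
  "block xs = length xs # xs"

text \<open>Memory layout of a graph database: the number of nodes, then for each node and each letter the
  position of the corresponding successor list, then these lists, each preceded by its length.\<close>

definition adj_code :: "adj_lists \<Rightarrow> nat list" where
  "adj_code L = (let vss = concat L in
     [length L]
     @ map (\<lambda>i. 1 + length vss + length (concat (map block (take i vss)))) [0..<length vss]
     @ concat (map block vss))"

fun symbol_code :: "nat symbol \<Rightarrow> nat" where
  "symbol_code LPar = 0"
| "symbol_code RPar = 1"
| "symbol_code EpsSym = 2"
| "symbol_code ConcSym = 3"
| "symbol_code AltSym = 4"
| "symbol_code PlusSym = 5"
| "symbol_code (LetterSym a) = 6 + a"

definition rpq_code :: "adj_lists \<Rightarrow> nat regex \<Rightarrow> nat list" where
  "rpq_code L q = block (adj_code L) @ block (map symbol_code (regex_string q))"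

definition rpq_inputs ::
  "nat \<Rightarrow> (nat, nat) graph_db set \<Rightarrow> (adj_lists \<times> nat regex) set" where
  "rpq_inputs \<sigma> \<G> = {(L, q). adj_lists_over \<sigma> L \<and> db_of L \<in> \<G> \<and> letters q \<subseteq> {..<\<sigma>}}"

text \<open>The parameter \<open>\<G>\<close> is the class of graph databases that are admitted as inputs.\<close>

definition Boole ::
  "nat \<Rightarrow> (nat, nat) graph_db set \<Rightarrow> (adj_lists \<times> nat regex) problem" where
  "Boole \<sigma> \<G> =
     \<lparr>instances = rpq_inputs \<sigma> \<G>,
      encoding = (\<lambda>(L, q). rpq_code L q),
      correct_output = (\<lambda>(L, q) out. out 0 = of_bool (rpq_result q (db_of L) \<noteq> {}))\<rparr>"

definition Check ::
  "nat \<Rightarrow> (nat, nat) graph_db set \<Rightarrow> (adj_lists \<times> nat regex \<times> nat \<times> nat) problem" where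
  "Check \<sigma> \<G> =
     \<lparr>instances = {(L, q, u, v). (L, q) \<in> rpq_inputs \<sigma> \<G>
                     \<and> u \<in> nodes (db_of L) \<and> v \<in> nodes (db_of L)},
      encoding = (\<lambda>(L, q, u, v). rpq_code L q @ [u, v]),
      correct_output = (\<lambda>(L, q, u, v) out. out 0 = of_bool ((u, v) \<in> rpq_result q (db_of L)))\<rparr>"

text \<open>The output is either \<open>1, u, v\<close> for some pair \<open>(u, v)\<close> in the result, or \<open>0\<close> if there is none.\<close>

definition Witness ::
  "nat \<Rightarrow> (nat, nat) graph_db set \<Rightarrow> (adj_lists \<times> nat regex) problem" where
  "Witness \<sigma> \<G> =
     \<lparr>instances = rpq_inputs \<sigma> \<G>,
      encoding = (\<lambda>(L, q). rpq_code L q),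
      correct_output = (\<lambda>(L, q) out.
        out 0 = 1 \<and> (out 1, out 2) \<in> rpq_result q (db_of L)
        \<or> out 0 = 0 \<and> rpq_result q (db_of L) = {})\<rparr>"


section \<open>Orthogonal vectors\<close>

definition orthogonal_vecs :: "bool list \<Rightarrow> bool list \<Rightarrow> bool" where
  "orthogonal_vecs a b \<longleftrightarrow> (\<Sum>i<length a. of_bool (a ! i) * of_bool (b ! i) :: nat) = 0"

text \<open>An instance consists of the dimension \<open>d\<close> and of two sets of \<open>n\<close> vectors, listed in any order.
  We require \<open>n \<ge> 1\<close>, as the time bound vanishes for \<open>n = 0\<close>.\<close>

definition OV :: "(nat \<times> bool list list \<times> bool list list) problem" where
  "OV =
     \<lparr>instances = {(d, A, B). A \<noteq> [] \<and> length A = length B \<and> distinct A \<and> distinct B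
                     \<and> (\<forall>a \<in> set A \<union> set B. length a = d)},
      encoding = (\<lambda>(d, A, B). [length A, d] @ map of_bool (concat A) @ map of_bool (concat B)),
      correct_output = (\<lambda>(d, A, B) out.
        out 0 = of_bool (\<exists>a \<in> set A. \<exists>b \<in> set B. orthogonal_vecs a b))\<rparr>"

definition OV_hypothesis :: bool where
  "OV_hypothesis \<longleftrightarrow>
     (\<forall>\<epsilon>>0. \<not> (\<exists>p :: real poly.
        solvable_in_O OV (\<lambda>(d, A, B). real (length A) powr (2 - \<epsilon>) * poly p (real d))))"

end

theory Submission
  imports Defs
begin

text \<open>A set \<open>A\<close> of vectors is spelled, vector by vector, along a graph database that is a single line,
  and a set \<open>B\<close> becomes a query whose alternatives describe the vectors orthogonal to some
  \<open>b \<in> B\<close>; separators \<open>11\<close> keep matches aligned with the vectors. Hence the query has a match iff there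
  is an orthogonal pair, and then the two ends of the line are one of the matches.

  As the time bound is subquadratic in only one of the two sizes, one of the two sets is cut
  into about \<open>n powr \<delta>\<close> parts, so that the term with exponent 2 stems from the smaller side:
  \<open>n powr \<delta>\<close> runs of cost \<open>n powr (2 - \<epsilon>) + (n powr (1 - \<delta>))\<^sup>2\<close>, up to factors polynomial in \<open>d\<close>,
  take time \<open>n powr (2 - \<delta>)\<close> if \<open>2 * \<delta> \<le> \<epsilon>\<close>.

  On the random access machine, every run of the given program uses a fresh memory region, whose
  length exceeds every address that the program can form. No memory has to be erased, and all
  addresses remain polynomial in the length of the input.\<close>

section \<open>A structured language for random access machines\<close>

text \<open>How the given program uses its address space is unknown; only its word size, a constant
  \<open>c\<close> times a logarithm, limits it. Hence \<open>c\<close> is built into the new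
  program: it determines the region length, essentially \<open>(2 * input_len) ^ c\<close>, and
  enters the new word size constant. Only successful runs have to be simulated, so wider words do no
  harm. The number of runs must be computed on the machine. With \<open>\<delta> = 1 / k\<close> and
  \<open>k \<ge> 2 / \<epsilon>\<close>, repeated division of \<open>n\<close> by the constant
  \<open>2 ^ k\<close> yields a power of two that agrees with \<open>n powr \<delta>\<close> up to a
  factor 2. Beforehand \<open>\<epsilon>\<close> is replaced by the minimum of
  \<open>\<epsilon>\<close> and 1, because the linear cost of writing the instances must be
  dominated by the assumed time bound as well. Sparse inputs arise from multiplying the number of
  nodes by a constant \<open>K\<close>. In dimension 0 the input length does not grow with
  \<open>n\<close>; there it matters that the vectors are distinct, which leaves only
  \<open>n = 1\<close>.\<close>

type_synonym store = "nat \<Rightarrow> nat"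

datatype com =
    Block "instr list"
  | Seq com com (infixr ";;" 60)
  | Loop nat com
  | Sim program

text \<open>A simulated program has its registers shifted by 30 and its memory shifted by the
  contents of register 14. The instruction \<open>Const 29 0\<close> is padding: with two cells for each
  simulated instruction, jump targets are merely doubled.\<close>

fun sim_instr :: "(nat \<Rightarrow> nat) \<Rightarrow> instr \<Rightarrow> instr list" where
  "sim_instr tgt (Const r k) = [Const (r + 30) k, Const 29 0]"
| "sim_instr tgt (Move r r1) = [Move (r + 30) (r1 + 30), Const 29 0]"
| "sim_instr tgt (Bin f r r1 r2) = [Bin f (r + 30) (r1 + 30) (r2 + 30), Const 29 0]"
| "sim_instr tgt (Load r r1) = [Bin Add 29 (r1 + 30) 14, Load (r + 30) 29]"
| "sim_instr tgt (Store r1 r2) = [Bin Add 29 (r1 + 30) 14, Store 29 (r2 + 30)]"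
| "sim_instr tgt (Jump l) = [Jump (tgt l), Const 29 0]"
| "sim_instr tgt (JumpZero r l) = [JumpZero (r + 30) (tgt l), Const 29 0]"

text \<open>The \<open>min\<close> sends every jump that leaves the simulated program to the first
  cell behind its code, so that halting becomes falling through to the continuation.\<close>

definition sim_pc :: "nat \<Rightarrow> program \<Rightarrow> nat \<Rightarrow> nat" where
  "sim_pc off P l = off + 2 * min l (length P)"

fun com_size :: "com \<Rightarrow> nat" where
  "com_size (Block is) = length is"
| "com_size (c ;; d) = com_size c + com_size d"
| "com_size (Loop x c) = com_size c + 2"
| "com_size (Sim P) = 2 * length P"

text \<open>Jump targets of the machine are absolute, so the start address is a parameter;
  \<open>com_size\<close> is separate because later addresses must be known before the code is
  placed.\<close>

fun compile :: "nat \<Rightarrow> com \<Rightarrow> program" where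
  "compile off (Block is) = is"
| "compile off (c ;; d) = compile off c @ compile (off + com_size c) d"
| "compile off (Loop x c) =
     JumpZero x (off + com_size c + 2) # compile (Suc off) c @ [Jump off]"
| "compile off (Sim P) = concat (map (sim_instr (sim_pc off P)) P)"

lemma length_sim_instr [simp]: "length (sim_instr tgt i) = 2"
  by (cases i) auto

lemma length_sim [simp]: "length (concat (map (sim_instr tgt) P)) = 2 * length P"
  by (induction P) auto

lemma nth_sim:
  "i < length P \<Longrightarrow> j < 2 \<Longrightarrow>
     concat (map (sim_instr tgt) P) ! (2 * i + j) = sim_instr tgt (P ! i) ! j"
proof (induction P arbitrary: i)
  case (Cons a P)
  then show ?case
    by (cases i) (auto simp: nth_append)
qed simp

lemma length_compile [simp]: "length (compile off c) = com_size c"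
  by (induction c arbitrary: off) auto

section \<open>Total correctness of code fragments with step bounds\<close>

definition code_at :: "program \<Rightarrow> nat \<Rightarrow> program \<Rightarrow> bool" where
  "code_at P off c \<longleftrightarrow> (\<forall>i < length c. off + i < length P \<and> P ! (off + i) = c ! i)"

lemma code_at_append [simp]:
  "code_at P off (c @ c') \<longleftrightarrow> code_at P off c \<and> code_at P (off + length c) c'"
proof
  assume *: "code_at P off (c @ c')"
  have "off + length c + i < length P \<and> P ! (off + length c + i) = c' ! i" if "i < length c'" for i
    using *[unfolded code_at_def, rule_format, of "length c + i"] that by (simp add: add.assoc)
  with * show "code_at P off c \<and> code_at P (off + length c) c'"
    by (auto simp: code_at_def nth_append)
next
  assume *: "code_at P off c \<and> code_at P (off + length c) c'"
  show "code_at P off (c @ c')"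
    unfolding code_at_def
  proof (intro allI impI)
    fix i assume "i < length (c @ c')"
    then show "off + i < length P \<and> P ! (off + i) = (c @ c') ! i"
      using * unfolding code_at_def
      by (cases "i < length c") (auto simp: nth_append dest: spec[of _ "i - length c"])
  qed
qed

lemma code_at_Cons [simp]:
  "code_at P off (i # c) \<longleftrightarrow> off < length P \<and> P ! off = i \<and> code_at P (Suc off) c"
  using code_at_append[of P off "[i]" c] by (simp add: code_at_def)

lemma code_at_Nil [simp]: "code_at P off []"
  by (simp add: code_at_def)

lemma ram_steps_trans:
  "ram_steps w P t s s' \<Longrightarrow> ram_steps w P t' s' s'' \<Longrightarrow> ram_steps w P (t + t') s s''"
  by (induction rule: ram_steps.induct) (auto intro: ram_steps.step)

lemma ram_steps_one:
  "pc s < length P \<Longrightarrow> exec_instr w (P ! pc s) s = Some s' \<Longrightarrow> ram_steps w P 1 s s'"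
  using ram_steps.step[OF _ _ ram_steps.refl] by fastforce

text \<open>Quantifying over the surrounding program and the position makes fragments composable.
  Errors are excluded implicitly, since a stuck run never reaches the end of the fragment.\<close>

definition wp :: "nat \<Rightarrow> com \<Rightarrow> nat \<Rightarrow> (store \<Rightarrow> store \<Rightarrow> bool) \<Rightarrow> store \<Rightarrow> store \<Rightarrow> bool" where
  "wp w c T Q r m \<longleftrightarrow>
     (\<forall>P off s. code_at P off (compile off c) \<longrightarrow> pc s = off \<longrightarrow> reg s = r \<longrightarrow> mem s = m \<longrightarrow>
       (\<exists>t s'. t \<le> T \<and> ram_steps w P t s s' \<and> pc s' = off + com_size c \<and> Q (reg s') (mem s')))"

lemma wpI:
  assumes "\<And>P off s. code_at P off (compile off c) \<Longrightarrow> pc s = off \<Longrightarrow> reg s = r \<Longrightarrow> mem s = m \<Longrightarrow>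
    \<exists>t s'. t \<le> T \<and> ram_steps w P t s s' \<and> pc s' = off + com_size c \<and> Q (reg s') (mem s')"
  shows "wp w c T Q r m"
  using assms unfolding wp_def by blast

lemma wpE:
  assumes "wp w c T Q (reg s) (mem s)" "code_at P (pc s) (compile (pc s) c)"
  obtains t s' where "t \<le> T" "ram_steps w P t s s'" "pc s' = pc s + com_size c" "Q (reg s') (mem s')"
  using assms unfolding wp_def by blast

lemma wp_mono:
  assumes "wp w c T Q r m" "T \<le> T'" "\<And>r m. Q r m \<Longrightarrow> Q' r m"
  shows "wp w c T' Q' r m"
proof (rule wpI)
  fix P off and s :: ram_state
  assume "code_at P off (compile off c)" "pc s = off" "reg s = r" "mem s = m"
  with assms(1) obtain t s' where "t \<le> T" "ram_steps w P t s s'" "pc s' = off + com_size c"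
      "Q (reg s') (mem s')"
    unfolding wp_def by blast
  with assms(2,3) show "\<exists>t s'. t \<le> T' \<and> ram_steps w P t s s' \<and> pc s' = off + com_size c
      \<and> Q' (reg s') (mem s')"
    by (meson le_trans)
qed

lemma wp_Seq:
  assumes "wp w c T (\<lambda>r m. wp w d T' Q r m) r m"
  shows "wp w (c ;; d) (T + T') Q r m"
proof (rule wpI)
  fix P off and s :: ram_state
  assume code: "code_at P off (compile off (c ;; d))" and s: "pc s = off" "reg s = r" "mem s = m"
  obtain t s' where s': "t \<le> T" "ram_steps w P t s s'" "pc s' = off + com_size c"
      "wp w d T' Q (reg s') (mem s')"
    using wpE[of w c T "\<lambda>r m. wp w d T' Q r m" s P] assms code s by auto
  obtain t' s'' where "t' \<le> T'" "ram_steps w P t' s' s''" "pc s'' = pc s' + com_size d"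
      "Q (reg s'') (mem s'')"
    using wpE[OF s'(4)] code s'(3) by auto
  with s' show "\<exists>t s'. t \<le> T + T' \<and> ram_steps w P t s s' \<and> pc s' = off + com_size (c ;; d)
      \<and> Q (reg s') (mem s')"
    by (intro exI[of _ "t + t'"] exI[of _ s'']) (auto intro: ram_steps_trans)
qed

lemma wp_SeqI:
  assumes "wp w c T R r m" "\<And>r m. R r m \<Longrightarrow> wp w d T' Q r m"
  shows "wp w (c ;; d) (T + T') Q r m"
  by (rule wp_Seq, rule wp_mono[OF assms(1)]) (use assms(2) in auto)

text \<open>The number of rounds is known beforehand, so the invariant is indexed by the rounds
  already made. A round pays 2 extra steps, the test and the jump back; the last test costs
  1.\<close>

lemma wp_Loop:
  assumes step: "\<And>k r m. k < N \<Longrightarrow> I k r m \<Longrightarrow> r x \<noteq> 0 \<and> wp w c T (I (Suc k)) r m"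
    and fin: "\<And>r m. I N r m \<Longrightarrow> r x = 0"
    and init: "I 0 r m"
  shows "wp w (Loop x c) (N * (T + 2) + 1) (I N) r m"
proof (rule wpI)
  fix P off and s :: ram_state
  assume code: "code_at P off (compile off (Loop x c))" and s: "pc s = off" "reg s = r" "mem s = m"
  have "\<exists>t s'. t \<le> (N - k) * (T + 2) + 1 \<and> ram_steps w P t s s'
      \<and> pc s' = off + com_size (Loop x c) \<and> I N (reg s') (mem s')"
    if "k \<le> N" "pc s = off" "I k (reg s) (mem s)" for k s
    using that
  proof (induction "N - k" arbitrary: k s)
    case 0
    then have "reg s x = 0" "I N (reg s) (mem s)"
      using fin by auto
    then have "ram_steps w P 1 s (s\<lparr>pc := off + com_size c + 2\<rparr>)"
      using code 0 by (intro ram_steps_one) auto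
    then show ?case
      using \<open>I N (reg s) (mem s)\<close>
      by (intro exI[of _ 1] exI[of _ "s\<lparr>pc := off + com_size c + 2\<rparr>"]) auto
  next
    case (Suc j)
    then have k: "k < N" by simp
    let ?s1 = "s\<lparr>pc := Suc off\<rparr>"
    from step[OF k Suc.prems(3)] have nz: "reg s x \<noteq> 0" and "wp w c T (I (Suc k)) (reg ?s1) (mem ?s1)"
      by auto
    then obtain t s2 where s2: "t \<le> T" "ram_steps w P t ?s1 s2" "pc s2 = Suc off + com_size c"
        "I (Suc k) (reg s2) (mem s2)"
      using wpE[of w c T "I (Suc k)" ?s1 P] code by auto
    let ?s3 = "s2\<lparr>pc := off\<rparr>"
    have j: "j = N - Suc k"
      using Suc.hyps(2) by simp
    obtain t' s4 where s4: "t' \<le> (N - Suc k) * (T + 2) + 1" "ram_steps w P t' ?s3 s4"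
        "pc s4 = off + com_size (Loop x c)" "I N (reg s4) (mem s4)"
      using Suc.hyps(1)[OF j, of ?s3] k s2(4) by (auto simp del: mult_Suc_right add_2_eq_Suc')
    have "ram_steps w P 1 s ?s1"
      using code Suc.prems nz by (intro ram_steps_one) auto
    moreover have "ram_steps w P 1 s2 ?s3"
      using code s2(3) by (intro ram_steps_one) auto
    ultimately have "ram_steps w P (1 + (t + (1 + t'))) s s4"
      using s2(2) s4(2) by (blast intro: ram_steps_trans)
    moreover have "N - k = Suc (N - Suc k)"
      using k by simp
    ultimately show ?case
      using s2(1) s4 by (intro exI[of _ "1 + (t + (1 + t'))"] exI[of _ s4]) (simp add: algebra_simps)
  qed
  from this[of 0 s] show "\<exists>t s'. t \<le> N * (T + 2) + 1 \<and> ram_steps w P t s s'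
      \<and> pc s' = off + com_size (Loop x c) \<and> I N (reg s') (mem s')"
    using s init by simp
qed

section \<open>Straight-line code and counted loops\<close>

text \<open>Symbolic execution by rewriting. The inequalities are exactly the success conditions of
  \<open>set_reg\<close>; a store succeeds always. Jumps are mapped to \<open>False\<close>, which
  makes the number of steps equal to the number of instructions.\<close>

fun block_wp :: "nat \<Rightarrow> instr list \<Rightarrow> (store \<Rightarrow> store \<Rightarrow> bool) \<Rightarrow> store \<Rightarrow> store \<Rightarrow> bool" where
  "block_wp w [] Q r m \<longleftrightarrow> Q r m"
| "block_wp w (Const x k # is) Q r m \<longleftrightarrow> k < 2 ^ w \<and> block_wp w is Q (r(x := k)) m"
| "block_wp w (Move x y # is) Q r m \<longleftrightarrow> r y < 2 ^ w \<and> block_wp w is Q (r(x := r y)) m"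
| "block_wp w (Bin f x y z # is) Q r m \<longleftrightarrow>
     eval_binop f (r y) (r z) < 2 ^ w \<and> block_wp w is Q (r(x := eval_binop f (r y) (r z))) m"
| "block_wp w (Load x y # is) Q r m \<longleftrightarrow> m (r y) < 2 ^ w \<and> block_wp w is Q (r(x := m (r y))) m"
| "block_wp w (Store x y # is) Q r m \<longleftrightarrow> block_wp w is Q r (m(r x := r y))"
| "block_wp w (Jump l # is) Q r m \<longleftrightarrow> False"
| "block_wp w (JumpZero x l # is) Q r m \<longleftrightarrow> False"

lemma block_wp_append:
  "block_wp w (is @ js) Q r m \<longleftrightarrow> block_wp w is (block_wp w js Q) r m"
proof (induction "is" arbitrary: r m)
  case (Cons i "is")
  then show ?case by (cases i) (simp_all del: fun_upd_apply)
qed simp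

lemma block_wp_mono:
  "block_wp w is Q r m \<Longrightarrow> (\<And>r m. Q r m \<Longrightarrow> Q' r m) \<Longrightarrow> block_wp w is Q' r m"
proof (induction "is" arbitrary: r m)
  case (Cons i "is")
  from Cons.prems show ?case by (cases i) (auto simp del: fun_upd_apply intro: Cons.IH)
qed simp

lemma wp_Block:
  assumes "block_wp w is Q r m" "length is \<le> T"
  shows "wp w (Block is) T Q r m"
proof (rule wpI)
  fix P off and s :: ram_state
  assume code: "code_at P off (compile off (Block is))" and s: "pc s = off" "reg s = r" "mem s = m"
  have "\<exists>s'. ram_steps w P (length is) s s' \<and> pc s' = off + length is \<and> Q (reg s') (mem s')"
    using assms(1) code s
  proof (induction "is" arbitrary: off s r m)
    case Nil
    then show ?case by (auto intro: ram_steps.refl)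
  next
    case (Cons i "is")
    obtain s1 where s1: "exec_instr w i s = Some s1" "pc s1 = Suc off"
        "block_wp w is Q (reg s1) (mem s1)"
      using Cons.prems by (cases i) (auto simp: set_reg_def)
    then obtain s' where "ram_steps w P (length is) s1 s'" "pc s' = Suc off + length is"
        "Q (reg s') (mem s')"
      using Cons.IH[of "reg s1" "mem s1" "Suc off" s1] Cons.prems(2) by auto
    moreover have "pc s < length P" "P ! pc s = i"
      using Cons.prems by auto
    ultimately show ?case
      using s1(1) by (intro exI[of _ s']) (auto intro: ram_steps.step)
  qed
  then show "\<exists>t s'. t \<le> T \<and> ram_steps w P t s s' \<and> pc s' = off + com_size (Block is)
      \<and> Q (reg s') (mem s')"
    using assms(2) by auto
qed

lemma ram_computes_compile:
  assumes "wp w c T Q (\<lambda>_. 0) (\<lambda>i. if i < length xs then xs ! i else 0)"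
  shows "\<exists>t out m. ram_computes w (compile 0 c) xs t out \<and> t \<le> T \<and> Q out m"
proof -
  have "code_at (compile 0 c) 0 (compile 0 c)"
    by (simp add: code_at_def)
  then obtain t s' where "t \<le> T" "ram_steps w (compile 0 c) t (initial_state xs) s'"
      "pc s' = com_size c" "Q (reg s') (mem s')"
    using wpE[of w c T Q "initial_state xs" "compile 0 c"] assms by (auto simp: initial_state_def)
  then show ?thesis
    unfolding ram_computes_def by (intro exI[of _ t] exI[of _ "reg s'"] exI[of _ "mem s'"]) auto
qed

text \<open>Register 1 is meant to contain the constant 1.\<close>

definition Rep :: "nat \<Rightarrow> com \<Rightarrow> com" where
  "Rep x c = Loop x (c ;; Block [Bin Sub x x 1])"

text \<open>The premise speaks about the body alone, before the counter is decremented; hence the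
  invariant is demanded for the register file with the counter already lowered. The 3 extra steps
  are decrement, test and jump back.\<close>

lemma wp_Rep:
  assumes step: "\<And>k r m. k < N \<Longrightarrow> I k r m \<Longrightarrow> r x = N - k \<Longrightarrow>
      wp w c T (\<lambda>r m. I (Suc k) (r(x := N - Suc k)) m \<and> r x = N - k \<and> r 1 = 1) r m"
    and "N < 2 ^ w" "I 0 r m" "r x = N"
  shows "wp w (Rep x c) (N * (T + 3) + 1) (\<lambda>r m. I N r m \<and> r x = 0) r m"
proof -
  have "wp w (Rep x c) (N * ((T + 1) + 2) + 1) (\<lambda>r m. I N r m \<and> r x = N - N) r m"
    unfolding Rep_def
  proof (rule wp_Loop[where I = "\<lambda>k r m. I k r m \<and> r x = N - k"])
    fix k r m
    assume k: "k < N" and I: "I k r m \<and> r x = N - k"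
    have "wp w (c ;; Block [Bin Sub x x 1]) (T + 1) (\<lambda>r m. I (Suc k) r m \<and> r x = N - Suc k) r m"
    proof (rule wp_SeqI, rule step)
      fix r m
      assume "I (Suc k) (r(x := N - Suc k)) m \<and> r x = N - k \<and> r 1 = 1"
      moreover from this have "N - k - Suc 0 = N - Suc k" by simp
      ultimately show "wp w (Block [Bin Sub x x 1]) 1 (\<lambda>r m. I (Suc k) r m \<and> r x = N - Suc k) r m"
        using assms(2) by (intro wp_Block) auto
    qed (use k I in auto)
    with k I show "r x \<noteq> 0 \<and>
        wp w (c ;; Block [Bin Sub x x 1]) (T + 1) (\<lambda>r m. I (Suc k) r m \<and> r x = N - Suc k) r m"
      by simp
  qed (use assms in auto)
  moreover have "T + 1 + 2 = T + 3" by simp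
  ultimately show ?thesis by (simp only: diff_self_eq_0)
qed


section \<open>Simulating a machine in a fresh memory region\<close>

fun instr_regs :: "instr \<Rightarrow> nat list" where
  "instr_regs (Const r k) = [r]"
| "instr_regs (Move r r1) = [r, r1]"
| "instr_regs (Bin f r r1 r2) = [r, r1, r2]"
| "instr_regs (Load r r1) = [r, r1]"
| "instr_regs (Store r1 r2) = [r1, r2]"
| "instr_regs (Jump l) = []"
| "instr_regs (JumpZero r l) = [r]"

text \<open>Inserting 0 makes the maximum well defined and ensures that the output register 0 is
  always among the simulated ones.\<close>

definition reg_bound :: "program \<Rightarrow> nat" where
  "reg_bound P = Suc (Max (insert 0 (\<Union>i \<in> set P. set (instr_regs i))))"

lemma instr_regs_less: "i \<in> set P \<Longrightarrow> x \<in> set (instr_regs i) \<Longrightarrow> x < reg_bound P"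
  unfolding reg_bound_def less_Suc_eq_le by (rule Max_ge) auto

text \<open>Every register assignment is checked by \<open>set_reg\<close>. As addresses come from
  registers, a machine with \<open>w\<close>-bit words touches only the first \<open>2 ^ w\<close>
  cells.\<close>

lemma ram_steps_reg_less:
  assumes "ram_steps w P t s s'" "\<forall>x. reg s x < 2 ^ w"
  shows "\<forall>x. reg s' x < 2 ^ w"
  using assms
proof (induction rule: ram_steps.induct)
  case (step s s' t s'')
  have "\<forall>x. reg s' x < 2 ^ w"
    using step.hyps(2) step.prems
    by (cases "P ! pc s") (auto simp: set_reg_def split: if_splits)
  then show ?case using step.IH by blast
qed

text \<open>\<open>r0\<close> and \<open>m0\<close> are the state when the simulation began: host
  registers and all memory outside the window of length \<open>2 ^ w\<close> at \<open>b\<close>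
  keep their contents. Register 29 is left out, being the scratch register for shifted
  addresses.\<close>

definition simulates ::
  "nat \<Rightarrow> nat \<Rightarrow> nat \<Rightarrow> program \<Rightarrow> store \<Rightarrow> store \<Rightarrow> ram_state \<Rightarrow> ram_state \<Rightarrow> bool" where
  "simulates w b off P r0 m0 s z \<longleftrightarrow>
     pc z = sim_pc off P (pc s) \<and>
     (\<forall>x < reg_bound P. reg z (x + 30) = reg s x) \<and>
     (\<forall>x < 29. reg z x = r0 x) \<and>
     (\<forall>i < 2 ^ w. mem z (b + i) = mem s i) \<and>
     (\<forall>i. i < b \<or> b + 2 ^ w \<le> i \<longrightarrow> mem z i = m0 i)"

text \<open>A value that fits into the simulated word fits into the host word as
  \<open>w \<le> w'\<close>, and \<open>b + 2 ^ w \<le> 2 ^ w'\<close> lets the address shift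
  succeed. A taken jump uses only the first of its two cells, hence
  \<open>t \<le> 2\<close>.\<close>

lemma sim_step:
  assumes code: "code_at Q off (compile off (Sim P))"
    and sim: "simulates w b off P r0 m0 s z" and b: "r0 14 = b"
    and less: "\<forall>x. reg s x < 2 ^ w" and w: "w \<le> w'" "b + 2 ^ w \<le> 2 ^ w'"
    and pc: "pc s < length P" and ex: "exec_instr w (P ! pc s) s = Some s'"
  shows "\<exists>t z'. t \<le> 2 \<and> ram_steps w' Q t z z' \<and> simulates w b off P r0 m0 s' z'"
proof -
  let ?i = "P ! pc s" and ?tgt = "sim_pc off P"
  have pcz: "pc z = off + 2 * pc s"
    using sim pc by (simp add: simulates_def sim_pc_def)
  have at: "pc z + j < length Q \<and> Q ! (pc z + j) = sim_instr ?tgt ?i ! j" if "j < 2" for j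
  proof -
    have "2 * pc s + j < length (compile off (Sim P))"
      using pc that by simp
    then have "off + (2 * pc s + j) < length Q
        \<and> Q ! (off + (2 * pc s + j)) = compile off (Sim P) ! (2 * pc s + j)"
      using code unfolding code_at_def by blast
    then show ?thesis
      using nth_sim[OF pc that, of ?tgt] pcz by (simp add: add.assoc)
  qed
  have at0: "pc z < length Q" "Q ! pc z = sim_instr ?tgt ?i ! 0"
    and at1: "Suc (pc z) < length Q" "Q ! Suc (pc z) = sim_instr ?tgt ?i ! 1"
    using at[of 0] at[of 1] by auto
  have regs: "reg z (x + 30) = reg s x" if "x \<in> set (instr_regs ?i)" for x
    using sim instr_regs_less[of ?i P x] pc that by (auto simp: simulates_def)
  have z14: "reg z 14 = b"
    using sim b by (simp add: simulates_def)
  have w2: "x < 2 ^ w'" if "x < 2 ^ w" for x :: nat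
    using that w(1) by (meson le_trans less_le_trans one_le_numeral power_increasing)
  have pc': "?tgt (Suc (pc s)) = Suc (Suc (pc z))"
    using pc pcz by (simp add: sim_pc_def)
  have two: "ram_steps w' Q 2 z z2"
    if "exec_instr w' (sim_instr ?tgt ?i ! 0) z = Some z1" "pc z1 = Suc (pc z)"
      "exec_instr w' (sim_instr ?tgt ?i ! 1) z1 = Some z2" for z1 z2
  proof -
    have "ram_steps w' Q 1 z z1"
      by (rule ram_steps_one) (simp_all only: that at0)
    moreover have "ram_steps w' Q 1 z1 z2"
      by (rule ram_steps_one) (simp_all only: that at1)
    ultimately have "ram_steps w' Q (1 + 1) z z2"
      by (rule ram_steps_trans)
    then show ?thesis by (simp add: numeral_2_eq_2)
  qed
  show ?thesis
  proof (cases ?i)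
    case (Const x k)
    let ?z2 = "z\<lparr>pc := Suc (Suc (pc z)), reg := (reg z)(x + 30 := k, 29 := 0)\<rparr>"
    have k: "k < 2 ^ w" and s': "s' = s\<lparr>pc := Suc (pc s), reg := (reg s)(x := k)\<rparr>"
      using ex Const by (auto simp: set_reg_def split: if_splits)
    have "ram_steps w' Q 2 z ?z2"
      using Const w2[OF k] by (intro two) (auto simp: set_reg_def)
    moreover have "simulates w b off P r0 m0 s' ?z2"
      using sim pc' unfolding simulates_def s' by auto
    ultimately show ?thesis by blast
  next
    case (Move x y)
    let ?z2 = "z\<lparr>pc := Suc (Suc (pc z)), reg := (reg z)(x + 30 := reg s y, 29 := 0)\<rparr>"
    have k: "reg s y < 2 ^ w" and s': "s' = s\<lparr>pc := Suc (pc s), reg := (reg s)(x := reg s y)\<rparr>"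
      using ex Move by (auto simp: set_reg_def split: if_splits)
    have "ram_steps w' Q 2 z ?z2"
      using Move w2[OF k] regs[of y] by (intro two) (auto simp: set_reg_def)
    moreover have "simulates w b off P r0 m0 s' ?z2"
      using sim pc' unfolding simulates_def s' by auto
    ultimately show ?thesis by blast
  next
    case (Bin f x y1 y2)
    let ?v = "eval_binop f (reg s y1) (reg s y2)"
    let ?z2 = "z\<lparr>pc := Suc (Suc (pc z)), reg := (reg z)(x + 30 := ?v, 29 := 0)\<rparr>"
    have k: "?v < 2 ^ w" and s': "s' = s\<lparr>pc := Suc (pc s), reg := (reg s)(x := ?v)\<rparr>"
      using ex Bin by (auto simp: set_reg_def split: if_splits)
    have "ram_steps w' Q 2 z ?z2"
      using Bin w2[OF k] regs[of y1] regs[of y2] by (intro two) (auto simp: set_reg_def)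
    moreover have "simulates w b off P r0 m0 s' ?z2"
      using sim pc' unfolding simulates_def s' by auto
    ultimately show ?thesis by blast
  next
    case (Load x y)
    let ?v = "mem s (reg s y)"
    let ?z2 = "z\<lparr>pc := Suc (Suc (pc z)), reg := (reg z)(29 := reg s y + b, x + 30 := ?v)\<rparr>"
    have k: "?v < 2 ^ w" and s': "s' = s\<lparr>pc := Suc (pc s), reg := (reg s)(x := ?v)\<rparr>"
      using ex Load by (auto simp: set_reg_def split: if_splits)
    have y: "reg s y < 2 ^ w" "reg s y + b < 2 ^ w'"
      using less[rule_format, of y] w(2) by linarith+
    have "mem z (reg s y + b) = ?v"
      using sim y(1) unfolding simulates_def by (metis add.commute)
    then have "ram_steps w' Q 2 z ?z2"
      using Load w2[OF k] regs[of y] y z14 by (intro two) (auto simp: set_reg_def)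
    moreover have "simulates w b off P r0 m0 s' ?z2"
      using sim pc' unfolding simulates_def s' by auto
    ultimately show ?thesis by blast
  next
    case (Store x y)
    let ?z2 = "z\<lparr>pc := Suc (Suc (pc z)), reg := (reg z)(29 := reg s x + b),
      mem := (mem z)(reg s x + b := reg s y)\<rparr>"
    have s': "s' = s\<lparr>pc := Suc (pc s), mem := (mem s)(reg s x := reg s y)\<rparr>"
      using ex Store by auto
    have y: "reg s x < 2 ^ w" "reg s x + b < 2 ^ w'"
      using less[rule_format, of x] w(2) by linarith+
    have "ram_steps w' Q 2 z ?z2"
      using Store regs[of x] regs[of y] y z14 by (intro two) (auto simp: set_reg_def)
    moreover have "simulates w b off P r0 m0 s' ?z2"
      using sim pc' y(1) unfolding simulates_def s' by auto
    ultimately show ?thesis by blast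
  next
    case (Jump l)
    have "ram_steps w' Q 1 z (z\<lparr>pc := ?tgt l\<rparr>)"
      using Jump at0 by (intro ram_steps_one) auto
    moreover have "simulates w b off P r0 m0 s' (z\<lparr>pc := ?tgt l\<rparr>)"
      using sim ex Jump unfolding simulates_def by auto
    ultimately show ?thesis by (intro exI[of _ 1]) auto
  next
    case (JumpZero x l)
    have x: "reg z (x + 30) = reg s x"
      using regs[of x] JumpZero by simp
    show ?thesis
    proof (cases "reg s x = 0")
      case True
      then have "ram_steps w' Q 1 z (z\<lparr>pc := ?tgt l\<rparr>)"
        using JumpZero at0 x by (intro ram_steps_one) auto
      moreover have "simulates w b off P r0 m0 s' (z\<lparr>pc := ?tgt l\<rparr>)"
        using sim ex JumpZero True unfolding simulates_def by auto
      ultimately show ?thesis by (intro exI[of _ 1]) auto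
    next
      case False
      let ?z2 = "z\<lparr>pc := Suc (Suc (pc z)), reg := (reg z)(29 := 0)\<rparr>"
      have "ram_steps w' Q 2 z ?z2"
        using JumpZero x False by (intro two) (auto simp: set_reg_def)
      moreover have "simulates w b off P r0 m0 s' ?z2"
        using sim ex JumpZero False pc' unfolding simulates_def by auto
      ultimately show ?thesis by blast
    qed
  qed
qed

lemma sim_steps:
  assumes "ram_steps w P t s s'" "code_at Q off (compile off (Sim P))"
    and "simulates w b off P r0 m0 s z" "r0 14 = b" "\<forall>x. reg s x < 2 ^ w"
    and "w \<le> w'" "b + 2 ^ w \<le> 2 ^ w'"
  shows "\<exists>t' z'. t' \<le> 2 * t \<and> ram_steps w' Q t' z z' \<and> simulates w b off P r0 m0 s' z'"
  using assms
proof (induction arbitrary: z rule: ram_steps.induct)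
  case (refl s)
  then show ?case by (auto intro: ram_steps.refl)
next
  case (step s s' t s'')
  obtain t1 z1 where z1: "t1 \<le> 2" "ram_steps w' Q t1 z z1" "simulates w b off P r0 m0 s' z1"
    using sim_step[OF step.prems(1-4) step.prems(5,6) step.hyps(1,2)] by blast
  have "\<forall>x. reg s' x < 2 ^ w"
    using ram_steps_reg_less[OF ram_steps_one] step.hyps step.prems by blast
  then obtain t2 z2 where "t2 \<le> 2 * t" "ram_steps w' Q t2 z1 z2" "simulates w b off P r0 m0 s'' z2"
    using step.IH z1 step.prems by blast
  with z1 show ?case
    by (intro exI[of _ "t1 + t2"] exI[of _ z2]) (auto intro: ram_steps_trans)
qed

text \<open>The memory from the base address on must look like \<open>initial_state\<close>: the
  input followed by zeros only. Since cells behind the window keep their contents, the next region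
  is still blank afterwards.\<close>

lemma wp_Sim:
  assumes comp: "ram_computes w P xs t out" and w: "w \<le> w'" "r 14 + 2 ^ w \<le> 2 ^ w'"
    and regs: "\<forall>x < reg_bound P. r (x + 30) = 0"
    and mem: "\<forall>i < length xs. m (r 14 + i) = xs ! i" "\<forall>i \<ge> r 14 + length xs. m i = 0"
  shows "wp w' (Sim P) (2 * t) (\<lambda>r' m'. r' 30 = out 0 \<and> (\<forall>x < 29. r' x = r x) \<and>
    (\<forall>i. i < r 14 \<or> r 14 + 2 ^ w \<le> i \<longrightarrow> m' i = m i)) r m"
proof (rule wpI)
  fix Q off and z :: ram_state
  assume code: "code_at Q off (compile off (Sim P))" and z: "pc z = off" "reg z = r" "mem z = m"
  obtain s where s: "ram_steps w P t (initial_state xs) s" "length P \<le> pc s" "out = reg s"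
    using comp unfolding ram_computes_def by blast
  have "simulates w (r 14) off P r m (initial_state xs) z"
    using z regs mem by (auto simp: simulates_def initial_state_def sim_pc_def)
  moreover have "\<forall>x. reg (initial_state xs) x < 2 ^ w"
    by (simp add: initial_state_def)
  ultimately obtain t' z' where z': "t' \<le> 2 * t" "ram_steps w' Q t' z z'"
      "simulates w (r 14) off P r m s z'"
    using sim_steps[OF s(1) code, where b = "r 14" and w' = w' and z = z] w by blast
  moreover have "reg z' 30 = out 0"
    using z'(3) s(3) unfolding simulates_def reg_bound_def by fastforce
  ultimately show "\<exists>t' s'. t' \<le> 2 * t \<and> ram_steps w' Q t' z s' \<and> pc s' = off + com_size (Sim P)
      \<and> reg s' 30 = out 0 \<and> (\<forall>x < 29. reg s' x = r x) \<and>
      (\<forall>i. i < r 14 \<or> r 14 + 2 ^ w \<le> i \<longrightarrow> mem s' i = m i)"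
    using s(2) by (intro exI[of _ t'] exI[of _ z']) (auto simp: simulates_def sim_pc_def)
qed


section \<open>Graph databases that spell a word\<close>

definition row :: "nat \<Rightarrow> nat \<Rightarrow> nat \<Rightarrow> nat list list" where
  "row \<sigma> v x = (replicate \<sigma> [])[x := [v]]"

text \<open>The nodes beyond \<open>length w\<close> are isolated; they make the graph database as sparse as needed.\<close>

definition line :: "nat \<Rightarrow> nat \<Rightarrow> nat list \<Rightarrow> adj_lists" where
  "line \<sigma> V w = map (\<lambda>j. row \<sigma> (Suc j) (w ! j)) [0..<length w] @ replicate (V - length w) (replicate \<sigma> [])"

context
  fixes \<sigma> V :: nat and w :: "nat list"
  assumes w: "set w \<subseteq> {..<\<sigma>}" and len: "length w < V"
begin

lemma length_line: "length (line \<sigma> V w) = V"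
  using len by (simp add: line_def)

lemma nth_less: "j < length w \<Longrightarrow> w ! j < \<sigma>"
  using w by (meson lessThan_iff nth_mem subsetD)

lemma adj_lists_over_line: "adj_lists_over \<sigma> (line \<sigma> V w)"
proof -
  have "distinct vs \<and> set vs \<subseteq> {..<V}" if "vs \<in> set (row \<sigma> v x)" "v < V" for vs v x
  proof -
    have "vs \<in> insert [v] (set (replicate \<sigma> []))"
      using that(1) set_update_subset_insert unfolding row_def by fast
    then show ?thesis using that(2) by auto
  qed
  then show ?thesis
    unfolding adj_lists_over_def length_line
    using len by (auto simp: line_def row_def)
qed

lemma arcs_line: "arcs (db_of (line \<sigma> V w)) = (\<lambda>j. (j, w ! j, Suc j)) ` {..<length w}"
  using len nth_less
  by (auto simp: db_of_def length_line line_def nth_append row_def nth_list_update image_iff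
      split: if_splits)

lemma card_arcs_line: "card (arcs (db_of (line \<sigma> V w))) = length w"
  unfolding arcs_line by (subst card_image) (auto simp: inj_on_def)

lemma nodes_line: "nodes (db_of (line \<sigma> V w)) = {..<V}"
  by (simp add: db_of_def length_line)

lemma db_size_line: "db_size (db_of (line \<sigma> V w)) = V"
  using len by (simp add: db_size_def card_arcs_line nodes_line)

lemma labelled_path_lineD:
  assumes "labelled_path (db_of (line \<sigma> V w)) u x v"
  shows "v = u + length x \<and> (\<forall>i < length x. u + i < length w \<and> w ! (u + i) = x ! i)"
  using assms
proof (induction rule: labelled_path.induct)
  case (arc u a u' x v)
  then have "u < length w" "w ! u = a" "u' = Suc u"
    unfolding arcs_line by auto
  with arc.IH show ?case
    by (auto simp: nth_Cons split: nat.split)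
qed simp

lemma labelled_path_lineI:
  assumes "\<forall>i < length x. u + i < length w \<and> w ! (u + i) = x ! i" "u \<le> length w"
  shows "labelled_path (db_of (line \<sigma> V w)) u x (u + length x)"
  using assms
proof (induction x arbitrary: u)
  case Nil
  then show ?case
    using len by (auto simp: nodes_line intro: labelled_path.empty)
next
  case (Cons a x)
  have "u < length w" "w ! u = a"
    using Cons.prems(1)[rule_format, of 0] by auto
  then have "(u, a, Suc u) \<in> arcs (db_of (line \<sigma> V w))"
    unfolding arcs_line by auto
  moreover have "labelled_path (db_of (line \<sigma> V w)) (Suc u) x (Suc u + length x)"
    using Cons.prems(1)[rule_format, of "Suc i" for i] \<open>u < length w\<close> by (intro Cons.IH) auto
  ultimately show ?case
    by (auto intro: labelled_path.arc)
qed

end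

text \<open>Node numbers double as positions in \<open>w\<close>, so a path that starts at
  \<open>u\<close> reads the factor of \<open>w\<close> beginning at index \<open>u\<close>.\<close>

lemma labelled_path_line_factor:
  assumes "set w \<subseteq> {..<\<sigma>}" "length w < V" "labelled_path (db_of (line \<sigma> V w)) u x v" "x \<noteq> []"
  shows "\<exists>y z. w = y @ x @ z"
proof -
  have *: "\<forall>i < length x. u + i < length w \<and> w ! (u + i) = x ! i"
    using labelled_path_lineD assms by blast
  have "u + (length x - 1) < length w"
    using * assms(4) by simp
  then have "take (length x) (drop u w) = x"
    using * by (intro nth_equalityI) auto
  then have "w = take u w @ x @ drop (length x) (drop u w)"
    by (metis append_take_drop_id)
  then show ?thesis by blast
qed


subsection \<open>Their encodings\<close>

text \<open>The pointers of one node whose only successor is reached by letter \<open>x\<close>,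
  with its lists starting at \<open>p\<close>: each list has a length cell, and the lists after the
  one for \<open>x\<close> are shifted by the single entry.\<close>

definition table_cells :: "nat \<Rightarrow> nat \<Rightarrow> nat \<Rightarrow> nat list" where
  "table_cells \<sigma> p x = map (\<lambda>a. p + a + of_bool (x < a)) [0..<\<sigma>]"

definition list_cells :: "nat \<Rightarrow> nat \<Rightarrow> nat \<Rightarrow> nat list" where
  "list_cells \<sigma> v x = concat (map block (row \<sigma> v x))"

text \<open>The stride \<open>Suc \<sigma>\<close> is the space of the lists of one node:
  \<open>\<sigma>\<close> length cells and one successor.\<close>

definition table_code :: "nat \<Rightarrow> nat \<Rightarrow> nat list \<Rightarrow> nat list" where
  "table_code \<sigma> p w =
     concat (map (\<lambda>j. table_cells \<sigma> (p + j * Suc \<sigma>) (w ! j)) [0..<length w])"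

definition list_code :: "nat \<Rightarrow> nat list \<Rightarrow> nat list" where
  "list_code \<sigma> w = concat (map (\<lambda>j. list_cells \<sigma> (Suc j) (w ! j)) [0..<length w])"

text \<open>The pointer table of \<open>adj_code\<close> with a free start address, so that it
  splits along appended lists.\<close>

definition positions :: "nat \<Rightarrow> nat list list \<Rightarrow> nat list" where
  "positions s vss = map (\<lambda>i. s + length (concat (map block (take i vss)))) [0..<length vss]"

lemma positions_append:
  "positions s (xs @ ys) = positions s xs @ positions (s + length (concat (map block xs))) ys"
  unfolding positions_def
  by (rule nth_equalityI) (auto simp: nth_append)

lemma positions_replicate: "positions s (replicate k []) = map (\<lambda>i. s + i) [0..<k]"
proof -
  have "length (concat (map block (replicate i []))) = i" for i
    by (induction i) (auto simp: block_def)
  then show ?thesis by (simp add: positions_def min_def)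
qed

lemma length_take_row:
  assumes "x < \<sigma>"
  shows "i \<le> \<sigma> \<Longrightarrow> length (concat (map block (take i (row \<sigma> v x)))) = i + of_bool (x < i)"
proof (induction i)
  case (Suc i)
  then show ?case
    using assms by (auto simp: take_Suc_conv_app_nth row_def nth_list_update block_def)
qed simp

lemma length_list_cells:
  assumes "x < \<sigma>"
  shows "length (list_cells \<sigma> v x) = Suc \<sigma>"
  using length_take_row[OF assms, of \<sigma> v] assms by (simp add: list_cells_def row_def)

lemma positions_row:
  assumes "x < \<sigma>"
  shows "positions s (row \<sigma> v x) = table_cells \<sigma> s x"
  using length_take_row[OF assms, of _ v] unfolding positions_def table_cells_def
  by (intro nth_equalityI) (auto simp: row_def)

text \<open>The code is brought into an order that can be written sequentially with one running
  pointer. An isolated node contributes only empty lists, each a single cell 0.\<close>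

lemma adj_code_line:
  assumes w: "set w \<subseteq> {..<\<sigma>}" and len: "length w < V"
  shows "adj_code (line \<sigma> V w) = V # table_code \<sigma> (1 + V * \<sigma>) w
    @ map (\<lambda>i. 1 + V * \<sigma> + length w * Suc \<sigma> + i) [0..<(V - length w) * \<sigma>]
    @ list_code \<sigma> w @ replicate ((V - length w) * \<sigma>) 0"
proof -
  define rows where "rows k = concat (map (\<lambda>j. row \<sigma> (Suc j) (w ! j)) [0..<k])" for k
  have rows_Suc: "rows (Suc k) = rows k @ row \<sigma> (Suc k) (w ! k)" for k
    by (simp add: rows_def)
  have less: "w ! k < \<sigma>" if "k < length w" for k
    using w that by (auto simp: subset_iff)
  have block_rows:
    "concat (map block (rows k)) = concat (map (\<lambda>j. list_cells \<sigma> (Suc j) (w ! j)) [0..<k])" for k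
    by (induction k) (auto simp: rows_Suc list_cells_def, simp add: rows_def)
  have length_rows: "length (rows k) = k * \<sigma>" for k
    by (induction k) (auto simp: rows_Suc row_def, simp add: rows_def)
  have length_block_rows: "k \<le> length w \<Longrightarrow> length (concat (map block (rows k))) = k * Suc \<sigma>" for k
    unfolding block_rows by (induction k) (auto simp: less length_list_cells)
  have positions_rows: "k \<le> length w \<Longrightarrow> positions s (rows k)
      = concat (map (\<lambda>j. table_cells \<sigma> (s + j * Suc \<sigma>) (w ! j)) [0..<k])" for k s
  proof (induction k)
    case (Suc k)
    then show ?case
      using length_block_rows[of k] less[of k] by (simp add: rows_Suc positions_append positions_row)
  qed (simp add: rows_def positions_def)
  have rep: "concat (replicate k (replicate \<sigma> [])) = replicate (k * \<sigma>) ([] :: nat list)" for k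
    by (induction k) (auto simp: replicate_add)
  have block: "concat (replicate k (block [])) = replicate k 0" for k
    by (induction k) (auto simp: block_def)
  have vss: "concat (line \<sigma> V w) = rows (length w) @ replicate ((V - length w) * \<sigma>) []"
    by (simp add: line_def rows_def rep)
  have "length (concat (line \<sigma> V w)) = V * \<sigma>"
    using len by (simp add: vss length_rows flip: add_mult_distrib)
  then have "adj_code (line \<sigma> V w) = V # positions (1 + V * \<sigma>) (concat (line \<sigma> V w))
      @ concat (map block (concat (line \<sigma> V w)))"
    using len by (simp add: adj_code_def Let_def positions_def length_line[OF w len])
  then show ?thesis
    by (simp add: vss positions_append positions_replicate positions_rows block_rows length_block_rows[unfolded block_rows] block table_code_def list_code_def
        del: mult_Suc_right)
qed

lemma table_code_append:
  "table_code \<sigma> p (w @ [x]) = table_code \<sigma> p w @ table_cells \<sigma> (p + length w * Suc \<sigma>) x"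
  by (auto simp: table_code_def nth_append intro!: arg_cong[where f = concat])

lemma list_code_append: "list_code \<sigma> (w @ [x]) = list_code \<sigma> w @ list_cells \<sigma> (Suc (length w)) x"
  by (auto simp: list_code_def nth_append intro!: arg_cong[where f = concat])

lemma length_table_code: "length (table_code \<sigma> p w) = length w * \<sigma>"
  by (induction w rule: rev_induct) (auto simp: table_code_append table_cells_def, simp add: table_code_def)

lemma length_list_code: "set w \<subseteq> {..<\<sigma>} \<Longrightarrow> length (list_code \<sigma> w) = length w * Suc \<sigma>"
  by (induction w rule: rev_induct) (auto simp: list_code_append length_list_cells, simp add: list_code_def)

text \<open>For the two letters that occur, the case distinction becomes arithmetic; this form is
  what branch-free code can write.\<close>

lemma table_cells_unfold:
  "2 \<le> \<sigma> \<Longrightarrow> x < 2 \<Longrightarrow>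
     table_cells \<sigma> p x = p # (p + 2 - x) # map (\<lambda>a. p + Suc a) [2..<\<sigma>]"
  by (auto simp: table_cells_def upt_conv_Cons less_2_cases_iff numeral_2_eq_2)

text \<open>The cells are \<open>1, v, 0\<close> for letter 0 and \<open>0, 1, v\<close> for letter
  1; the products select between them without a branch.\<close>

lemma list_cells_unfold:
  assumes "2 \<le> \<sigma>" "x < 2"
  shows "list_cells \<sigma> v x = [1 - x, (1 - x) * v + x, x * v] @ replicate (\<sigma> - 2) 0"
proof -
  obtain k where k: "\<sigma> = Suc (Suc k)"
    using assms(1) by (metis add_2_eq_Suc le_Suc_ex)
  have "concat (map block (replicate k [])) = replicate k 0"
    by (induction k) (auto simp: block_def)
  then show ?thesis
    using assms(2) by (auto simp: list_cells_def row_def k block_def less_2_cases_iff)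
qed


section \<open>Orthogonal vectors as a regular path query\<close>

text \<open>The interleaved zeros keep ones apart, and the final zero separates the last bit from
  the \<open>11\<close> of the next vector.\<close>

definition body :: "bool list \<Rightarrow> nat list" where
  "body a = concat (map (\<lambda>x. [0, of_bool x]) a) @ [0]"

text \<open>The factor \<open>11\<close> occurs in \<open>word as\<close> only at the beginning of a vector, so that a query can
  synchronise with the vectors although its match may begin at any node.\<close>

definition word :: "bool list list \<Rightarrow> nat list" where
  "word as = concat (map (\<lambda>a. 1 # 1 # body a) as)"

text \<open>The star over the letters 0 and 1, expressed by Kleene plus and the empty word.\<close>

definition any_word :: "nat regex" where
  "any_word = Alt Eps (Plus (Alt (Letter 0) (Letter 1)))"

text \<open>A bit 1 is translated to the expression \<open>(0|0)\<close>, so that the size of the query depends only on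
  the number of vectors.\<close>

definition vec_regex :: "bool list \<Rightarrow> nat regex" where
  "vec_regex b = foldr (\<lambda>y r. Conc (Letter 0) (Conc (Alt (Letter 0) (Letter (of_bool (\<not> y)))) r))
     b (Letter 0)"

text \<open>The final alternative never contributes a match, since \<open>111\<close> is not a factor of \<open>word as\<close>.\<close>

definition alts :: "bool list list \<Rightarrow> nat regex" where
  "alts bs = foldr (\<lambda>b. Alt (vec_regex b)) bs (Letter 1)"

definition query :: "bool list list \<Rightarrow> nat regex" where
  "query bs = Conc any_word (Conc (Letter 1) (Conc (Letter 1) (Conc (alts bs) any_word)))"

lemma lang_any_word: "lang any_word = {x. set x \<subseteq> {0, 1}}"
proof -
  have "x \<in> lang (Plus (Alt (Letter 0) (Letter 1)))" if "set x \<subseteq> {0, 1}" "x \<noteq> []" for x :: "nat list"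
  proof -
    have "concat (map (\<lambda>a. [a]) x) = x" by (induction x) auto
    with that show ?thesis by (auto intro!: exI[of _ "map (\<lambda>a. [a]) x"])
  qed
  moreover have "set x \<subseteq> {0, 1}" if "x \<in> lang (Plus (Alt (Letter 0) (Letter 1)))" for x :: "nat list"
    using that by fastforce
  ultimately show ?thesis
    unfolding any_word_def lang.simps(4) by auto
qed

lemma lang_vec_regex: "lang (vec_regex b) = body ` {a. list_all2 (\<lambda>x y. \<not> (x \<and> y)) a b}"
proof (induction b)
  case Nil
  then show ?case by (auto simp: vec_regex_def body_def)
next
  case (Cons y b)
  have lang_step: "lang (Conc (Letter c) (Conc (Alt (Letter x) (Letter x')) r))
      = (\<lambda>z. c # x # z) ` lang r \<union> (\<lambda>z. c # x' # z) ` lang r" for c x x' :: nat and r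
  proof -
    have letter: "lang (Conc (Letter a) s) = (#) a ` lang s" for a :: nat and s
      by (auto simp: image_def)
    have "lang (Conc (Alt t t') s) = lang (Conc t s) \<union> lang (Conc t' s)" for t t' s :: "nat regex"
      by (simp, blast)
    then show ?thesis
      unfolding letter by (simp only: letter image_Un image_image)
  qed
  have body_Cons: "body (x # a) = 0 # of_bool x # body a" for x a
    by (simp add: body_def)
  have "lang (vec_regex (y # b))
      = (\<lambda>z. 0 # 0 # z) ` lang (vec_regex b) \<union> (\<lambda>z. 0 # of_bool (\<not> y) # z) ` lang (vec_regex b)"
    unfolding vec_regex_def foldr.simps o_def lang_step ..
  \<comment> \<open>For \<open>y\<close> true the two images coincide, just as the two branches of
    \<open>(0|0)\<close> do.\<close>
  moreover have "{a. list_all2 (\<lambda>x y. \<not> (x \<and> y)) a (y # b)}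
      = (#) False ` {a. list_all2 (\<lambda>x y. \<not> (x \<and> y)) a b}
        \<union> (#) (\<not> y) ` {a. list_all2 (\<lambda>x y. \<not> (x \<and> y)) a b}"
    by (auto simp: list_all2_Cons2)
  ultimately show ?case
    by (simp add: Cons.IH image_Un image_image body_Cons)
qed

lemma lang_alts: "lang (alts bs) = insert [1] (\<Union>b \<in> set bs. lang (vec_regex b))"
  by (induction bs) (auto simp: alts_def)

lemma lang_query:
  "lang (query bs) = {x @ 1 # 1 # y @ z | x y z.
     set x \<subseteq> {0, 1} \<and> set z \<subseteq> {0, 1} \<and> (y = [1] \<or> (\<exists>b \<in> set bs. y \<in> lang (vec_regex b)))}"
  (is "_ = ?R")
proof (intro set_eqI iffI)
  fix q
  assume "q \<in> lang (query bs)"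
  then obtain x y z where "q = x @ [1] @ [1] @ y @ z" "x \<in> lang any_word" "y \<in> lang (alts bs)"
      "z \<in> lang any_word"
    unfolding query_def lang.simps by blast
  then show "q \<in> ?R"
    unfolding lang_any_word lang_alts by auto
next
  fix q
  assume "q \<in> ?R"
  then obtain x y z where "q = x @ [1] @ [1] @ y @ z" "x \<in> lang any_word" "y \<in> lang (alts bs)"
      "z \<in> lang any_word"
    unfolding lang_any_word lang_alts by auto
  then show "q \<in> lang (query bs)"
    unfolding query_def lang.simps by blast
qed

lemma orthogonal_vecs_iff:
  "length a = length b \<Longrightarrow> orthogonal_vecs a b \<longleftrightarrow> list_all2 (\<lambda>x y. \<not> (x \<and> y)) a b"
  by (auto simp: orthogonal_vecs_def list_all2_conv_all_nth)

text \<open>A body contains no two adjacent ones and ends with 0, so an occurrence of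
  \<open>11\<close> neither starts in it nor straddles its end.\<close>

lemma body_factor:
  "body a @ t = u @ 1 # 1 # z \<Longrightarrow> \<exists>u'. t = u' @ 1 # 1 # z"
proof (induction a arbitrary: u)
  case Nil
  then show ?case by (cases u) (auto simp: body_def)
next
  case (Cons x a)
  then have eq: "0 # of_bool x # body a @ t = u @ 1 # 1 # z"
    by (simp add: body_def)
  then obtain u1 where u1: "u = 0 # u1" "of_bool x # body a @ t = u1 @ 1 # 1 # z"
    by (cases u) auto
  moreover have "hd (body a @ t) = 0"
    by (cases a) (auto simp: body_def)
  ultimately obtain u2 where "body a @ t = u2 @ 1 # 1 # z"
    by (cases u1) auto
  then show ?case by (rule Cons.IH)
qed

text \<open>An occurrence of \<open>11\<close> can start at the separator only with its first
  letter, as the body that follows begins with 0; starts inside a body are excluded by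
  \<open>body_factor\<close>. This is the synchronisation of query and word.\<close>

lemma word_factor:
  "word as = u @ 1 # 1 # z \<Longrightarrow> \<exists>a \<in> set as. \<exists>t. z = body a @ t"
proof (induction as arbitrary: u)
  case (Cons a as)
  have eq: "1 # 1 # body a @ word as = u @ 1 # 1 # z"
    using Cons.prems by (simp add: word_def)
  have hd: "hd (body a @ word as) = 0"
    by (cases a) (auto simp: body_def)
  consider "u = []" | "u = [1]" | u' where "u = 1 # 1 # u'" "body a @ word as = u' @ 1 # 1 # z"
    using eq by (cases u; cases "tl u") auto
  then show ?case
  proof cases
    case 3
    then show ?thesis using Cons.IH body_factor by (metis list.set_intros(2))
  qed (use eq hd in auto)
qed (simp add: word_def)

lemma length_body: "length (body a) = 2 * length a + 1"
  by (induction a) (auto simp: body_def)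

lemma inj_body: "body a = body b \<Longrightarrow> a = b"
proof (induction a arbitrary: b)
  case Nil
  then show ?case by (cases b) (auto simp: body_def)
next
  case (Cons x a)
  then show ?case by (cases b) (auto simp: body_def of_bool_def split: if_splits)
qed

lemma set_word: "set (word as) \<subseteq> {0, 1}"
  by (auto simp: word_def body_def)

context
  fixes \<sigma> V d :: nat and as bs :: "bool list list"
  assumes \<sigma>: "2 \<le> \<sigma>" and V: "length (word as) < V"
    and d: "\<forall>a \<in> set as \<union> set bs. length a = d"
begin

lemma word_letters: "set (word as) \<subseteq> {..<\<sigma>}"
  using set_word[of as] \<sigma> by auto

lemma rpq_result_query_yes:
  assumes "a \<in> set as" "b \<in> set bs" "orthogonal_vecs a b"
  shows "(0, length (word as)) \<in> rpq_result (query bs) (db_of (line \<sigma> V (word as)))"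
proof -
  obtain as1 as2 where as: "as = as1 @ a # as2"
    using assms(1) by (meson split_list)
  have "body a \<in> lang (vec_regex b)"
    using assms d by (auto simp: lang_vec_regex orthogonal_vecs_iff)
  moreover have "word as = word as1 @ 1 # 1 # body a @ word as2"
    by (simp add: as word_def)
  ultimately have "word as \<in> lang (query bs)"
    using assms(2) set_word unfolding lang_query by blast
  moreover have "labelled_path (db_of (line \<sigma> V (word as))) 0 (word as) (0 + length (word as))"
    using word_letters V by (intro labelled_path_lineI) auto
  ultimately show ?thesis by (auto simp: rpq_result_def)
qed

lemma rpq_result_query_no:
  assumes "\<not> (\<exists>a \<in> set as. \<exists>b \<in> set bs. orthogonal_vecs a b)"
  shows "rpq_result (query bs) (db_of (line \<sigma> V (word as))) = {}"
proof (rule ccontr)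
  assume "rpq_result (query bs) (db_of (line \<sigma> V (word as))) \<noteq> {}"
  then obtain u v q where q: "q \<in> lang (query bs)" and
      path: "labelled_path (db_of (line \<sigma> V (word as))) u q v"
    by (auto simp: rpq_result_def)
  obtain x y z where xyz: "q = x @ 1 # 1 # y @ z"
      "y = [1] \<or> (\<exists>b \<in> set bs. y \<in> lang (vec_regex b))"
    using q unfolding lang_query by blast
  obtain s t where "word as = s @ q @ t"
    using labelled_path_line_factor[OF word_letters V path] xyz(1) by auto
  then have "word as = (s @ x) @ 1 # 1 # y @ z @ t"
    by (simp add: xyz(1))
  from word_factor[OF this] obtain a t' where a: "a \<in> set as" and eq: "y @ z @ t = body a @ t'"
    by blast
  \<comment> \<open>A body begins with 0, which rules out the dummy alternative
    \<open>[1]\<close>.\<close>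
  have "hd (body a @ t') = 0"
    by (cases a) (auto simp: body_def)
  with eq have "y \<noteq> [1]"
    by (metis append_Cons list.sel(1) zero_neq_one)
  then obtain b a' where b: "b \<in> set bs" "list_all2 (\<lambda>x y. \<not> (x \<and> y)) a' b" "y = body a'"
    using xyz(2) by (auto simp: lang_vec_regex)
  have "length a' = length a"
    using a b d list_all2_lengthD by force
  \<comment> \<open>Both bodies are prefixes of the same word, and the common dimension gives them
    equal lengths.\<close>
  then have "body a' = body a"
    using eq unfolding b(3) by (subst (asm) append_eq_append_conv) (auto simp: length_body)
  then have "orthogonal_vecs a b"
    using inj_body[of a' a] orthogonal_vecs_iff[of a b] b(1,2) a d by auto
  with assms a b show False by blast
qed

end

lemma letters_query: "2 \<le> \<sigma> \<Longrightarrow> letters (query bs) \<subseteq> {..<\<sigma>}"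
proof -
  have "letters (vec_regex b) \<subseteq> {0, 1}" for b
    by (induction b) (auto simp: vec_regex_def)
  then have "letters (alts bs) \<subseteq> {0, 1}"
    by (induction bs) (auto simp: alts_def)
  moreover assume "2 \<le> \<sigma>"
  ultimately show ?thesis
    by (auto simp: query_def any_word_def)
qed

section \<open>The query as a string of symbols\<close>

text \<open>The symbols that precede the remaining expression. The closing parentheses of the two
  concatenations come after it, so they pile up as \<open>2 * length b\<close> ones at the end of
  \<open>vec_code\<close>. The code \<open>7 - of_bool y\<close> is the letter 0 for
  \<open>y\<close> true and the letter 1 otherwise.\<close>

definition bit_code :: "bool \<Rightarrow> nat list" where
  "bit_code y = [0, 6, 3, 0, 0, 6, 4] @ [7 - of_bool y] @ [1, 3]"

definition vec_code :: "bool list \<Rightarrow> nat list" where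
  "vec_code b = concat (map bit_code b) @ [6] @ replicate (2 * length b) 1"

text \<open>Everything in the string of \<open>query\<close> to the left of \<open>alts\<close>;
  \<open>query_suffix\<close> is everything to the right of it.\<close>

definition query_prefix :: "nat list" where
  "query_prefix = [0, 0, 2, 4, 0, 0, 6, 4, 7, 1, 1, 5, 1, 3, 0, 7, 3, 0, 7, 3, 0]"

definition query_suffix :: "nat list" where
  "query_suffix = [3, 0, 2, 4, 0, 0, 6, 4, 7, 1, 1, 5, 1, 1, 1, 1, 1]"

definition query_code :: "bool list list \<Rightarrow> nat list" where
  "query_code bs = query_prefix @ concat (map (\<lambda>b. [0] @ vec_code b @ [4]) bs) @ [7]
     @ replicate (length bs) 1 @ query_suffix"

lemma regex_string_vec:
  "map symbol_code (regex_string (vec_regex b)) = vec_code b"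
proof -
  have "replicate k 1 @ [1, 1] = 1 # 1 # replicate k (1 :: nat)" for k
    by (simp add: replicate_app_Cons_same)
  then show ?thesis
    by (induction b) (auto simp: vec_regex_def vec_code_def bit_code_def)
qed

lemma regex_string_query: "map symbol_code (regex_string (query bs)) = query_code bs"
proof -
  have "map symbol_code (regex_string (alts bs))
      = concat (map (\<lambda>b. [0] @ vec_code b @ [4]) bs) @ [7] @ replicate (length bs) 1"
    by (induction bs) (auto simp: alts_def regex_string_vec replicate_append_same)
  then show ?thesis
    by (simp add: query_def query_code_def any_word_def query_prefix_def query_suffix_def)
qed

lemma length_vec_code: "length (vec_code b) = 12 * length b + 1"
  by (induction b) (auto simp: vec_code_def bit_code_def)

text \<open>The constant is 21 + 17 for prefix and suffix plus 1 for the dummy alternative. An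
  alternative adds 3 symbols to the \<open>12 * d + 1\<close> of its vector.\<close>

lemma length_query_code:
  "\<forall>b \<in> set bs. length b = d \<Longrightarrow> length (query_code bs) = length bs * (12 * d + 4) + 39"
proof -
  assume d: "\<forall>b \<in> set bs. length b = d"
  have "length (concat (map (\<lambda>b. [0] @ vec_code b @ [4]) bs)) = length bs * (12 * d + 3)"
    using d by (induction bs) (auto simp: length_vec_code)
  then show ?thesis
    by (simp add: query_code_def query_prefix_def query_suffix_def algebra_simps)
qed

lemma length_word: "\<forall>a \<in> set as. length a = d \<Longrightarrow> length (word as) = length as * (2 * d + 3)"
  by (induction as) (auto simp: word_def length_body)


section \<open>A program that writes the query instance\<close>

text \<open>Registers 0 to 17 hold values that are fixed while an instance is written: 0 the result, 1 the
  constant 1, 2 and 3 the numbers \<open>n\<close> and \<open>d\<close>, 4 and 5 the sizes of the two groups, 6 the number of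
  nodes, 7 the total number of lists of isolated nodes, 8 the first list position, 9 the length of a
  memory region, 10 and 12 the lengths of the codes of the database and of the query, 11 the address
  of the second set of vectors, 13 the length of the word, 14 the address of the current region, 15
  and 16 the indices at which the two groups begin (modulo \<open>n\<close>), 17 the number of remaining runs.
  Register 18 is the address at which the next cell is written.\<close>

definition emit :: "nat \<Rightarrow> instr list" where
  "emit x = [Store 18 x, Bin Add 18 18 1]"

definition emit_consts :: "nat list \<Rightarrow> instr list" where
  "emit_consts ks = concat (map (\<lambda>k. Const 25 k # emit 25) ks)"

text \<open>Register 24 holds the position of the first list of the node and register 23 its letter.
  The pointers for the letters from 2 on are unrolled, \<open>\<sigma>\<close> being a constant of
  the program.\<close>

definition edge_table :: "nat \<Rightarrow> instr list" where
  "edge_table \<sigma> = emit 24 @ [Const 26 2, Bin Add 25 24 26, Bin Sub 25 25 23] @ emit 25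
     @ concat (map (\<lambda>a. [Const 26 (Suc a), Bin Add 25 24 26] @ emit 25) [2..<\<sigma>])
     @ [Const 26 (Suc \<sigma>), Bin Add 24 24 26]"

definition edge_list :: "nat \<Rightarrow> instr list" where
  "edge_list \<sigma> = [Bin Sub 25 1 23] @ emit 25 @ [Bin Mul 25 25 24, Bin Add 25 25 23] @ emit 25
     @ [Bin Mul 25 23 24] @ emit 25 @ emit_consts (replicate (\<sigma> - 2) 0) @ [Bin Add 24 24 1]"

text \<open>All pointers precede all lists, so the word is traversed twice, with \<open>E\<close>
  writing the pointers or the lists of one edge; it is generated anew from the input rather than
  stored. Register 21 is the index of the vector before reduction modulo \<open>n\<close>, register
  22 the address of the current bit, offset by the two header cells.\<close>

definition word_pass :: "instr list \<Rightarrow> com" where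
  "word_pass E = Block [Move 21 15, Move 19 4] ;;
     Rep 19 (
       Block ([Bin Mod 22 21 2, Bin Mul 22 22 3, Const 25 2, Bin Add 22 22 25, Bin Add 21 21 1,
         Const 23 1] @ E @ [Const 23 1] @ E @ [Move 20 3]) ;;
       Rep 20 (Block ([Const 23 0] @ E @ [Load 23 22, Bin Add 22 22 1] @ E)) ;;
       Block ([Const 23 0] @ E))"

definition pad_table :: com where
  "pad_table = Block [Move 19 7] ;; Rep 19 (Block (emit 24 @ [Bin Add 24 24 1]))"

definition pad_list :: com where
  "pad_list = Block [Move 19 7] ;; Rep 19 (Block (emit_consts [0]))"

definition query_pass :: com where
  "query_pass = Block (emit_consts query_prefix @ [Move 21 16, Move 19 5]) ;;
     Rep 19 (
       Block ([Bin Mod 22 21 2, Bin Mul 22 22 3, Bin Add 22 22 11, Bin Add 21 21 1]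
         @ emit_consts [0] @ [Move 20 3]) ;;
       Rep 20 (Block (emit_consts [0, 6, 3, 0, 0, 6, 4]
         @ [Load 23 22, Bin Add 22 22 1, Const 25 7, Bin Sub 25 25 23] @ emit 25
         @ emit_consts [1, 3])) ;;
       Block (emit_consts [6] @ [Bin Add 20 3 3]) ;;
       Rep 20 (Block (emit_consts [1])) ;;
       Block (emit_consts [4])) ;;
     Block (emit_consts [7] @ [Move 19 5]) ;;
     Rep 19 (Block (emit_consts [1])) ;;
     Block (emit_consts query_suffix)"

text \<open>A block stores its length in front of its contents, so registers 10 and 12 must be known
  before anything is written. The appended pair consists of the two ends of the line.\<close>

definition write_instance :: "nat \<Rightarrow> bool \<Rightarrow> com" where
  "write_instance \<sigma> pair =
     Block ([Move 18 14] @ emit 10 @ emit 6 @ [Move 24 8]) ;;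
     word_pass (edge_table \<sigma>) ;; pad_table ;;
     Block [Move 24 1] ;;
     word_pass (edge_list \<sigma>) ;; pad_list ;;
     Block (emit 12) ;; query_pass ;;
     Block (if pair then emit_consts [0] @ emit 13 else [])"

section \<open>Invariants while an instance is written\<close>

text \<open>\<open>e\<close> freezes registers 0 to 17 for the duration of one run. By
  \<open>inp_base\<close>, writing from address \<open>e 14\<close> on cannot overwrite the input in
  low memory.\<close>

locale run =
  fixes w :: nat and e :: store and inp :: "nat list"
  assumes e1: "e 1 = 1" and inp_base: "length inp \<le> e 14" and inp_less: "\<forall>x \<in> set inp. x < 2 ^ w"
begin

definition fixed :: "store \<Rightarrow> store \<Rightarrow> bool" where
  "fixed r m \<longleftrightarrow> (\<forall>x < 18. r x = e x) \<and> (\<forall>i < length inp. m i = inp ! i)"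

text \<open>The last conjunct keeps the memory behind the written cells blank, as the simulation
  requires.\<close>

definition written :: "nat list \<Rightarrow> store \<Rightarrow> store \<Rightarrow> bool" where
  "written xs r m \<longleftrightarrow> fixed r m \<and> r 18 = e 14 + length xs \<and>
     (\<forall>i < length xs. m (e 14 + i) = xs ! i) \<and> (\<forall>i \<ge> e 14 + length xs. m i = 0)"

lemma fixed_upd [simp]: "18 \<le> x \<Longrightarrow> fixed (r(x := v)) m = fixed r m"
  by (auto simp: fixed_def)

lemma written_upd [simp]: "18 < x \<Longrightarrow> written xs (r(x := v)) m = written xs r m"
  by (auto simp: written_def)

lemma fixedD: "fixed r m \<Longrightarrow> x < 18 \<Longrightarrow> r x = e x"
  by (simp add: fixed_def)

lemma writtenD: "written xs r m \<Longrightarrow> x < 18 \<Longrightarrow> r x = e x"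
  by (auto simp: written_def fixed_def)

text \<open>Stated with the remaining instructions \<open>js\<close> as a continuation, so that a
  block is executed symbolically from left to right without intermediate postconditions.\<close>

lemma block_emit:
  assumes G: "written xs r m" and cap: "e 14 + length xs + 1 < 2 ^ w"
    and cont: "\<And>r' m'. written (xs @ [r x]) r' m' \<Longrightarrow> (\<And>y. y \<noteq> 18 \<Longrightarrow> r' y = r y) \<Longrightarrow>
      block_wp w js Q r' m'"
  shows "block_wp w (emit x @ js) Q r m"
proof -
  have r: "r 18 = e 14 + length xs" "r 1 = 1"
    using G e1 by (auto simp: written_def fixed_def)
  let ?r = "r(18 := Suc (e 14 + length xs))" and ?m = "m(e 14 + length xs := r x)"
  have "written (xs @ [r x]) ?r ?m"
    using G inp_base by (auto simp: written_def fixed_def nth_append)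
  from cont[OF this] have "block_wp w js Q ?r ?m" by simp
  with r cap show ?thesis
    by (simp add: emit_def del: fun_upd_apply)
qed

lemma block_emit_consts:
  assumes "written xs r m" "e 14 + length xs + length ks < 2 ^ w" "\<forall>k \<in> set ks. k < 2 ^ w"
    and "\<And>r' m'. written (xs @ ks) r' m' \<Longrightarrow> (\<And>y. y \<noteq> 18 \<Longrightarrow> y \<noteq> 25 \<Longrightarrow> r' y = r y) \<Longrightarrow>
      block_wp w js Q r' m'"
  shows "block_wp w (emit_consts ks @ js) Q r m"
  using assms
proof (induction ks arbitrary: xs r m)
  case Nil
  then show ?case by (simp add: emit_consts_def)
next
  case (Cons k ks)
  have "block_wp w (emit 25 @ emit_consts ks @ js) Q (r(25 := k)) m"
  proof (rule block_emit[where xs = xs])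
    fix r' m'
    assume G: "written (xs @ [(r(25 := k)) 25]) r' m'" and r': "\<And>y. y \<noteq> 18 \<Longrightarrow> r' y = (r(25 := k)) y"
    show "block_wp w (emit_consts ks @ js) Q r' m'"
    proof (rule Cons.IH[where xs = "xs @ [k]"])
      fix r'' m''
      assume "written ((xs @ [k]) @ ks) r'' m''" "\<And>y. y \<noteq> 18 \<Longrightarrow> y \<noteq> 25 \<Longrightarrow> r'' y = r' y"
      then show "block_wp w js Q r'' m''"
        using r' by (intro Cons.prems(4)) auto
    qed (use G Cons.prems in auto)
  qed (use Cons.prems in auto)
  then show ?case
    using Cons.prems(3) by (simp add: emit_consts_def del: fun_upd_apply)
qed

lemmas block_emit' = block_emit[where js = "[]", simplified]
lemmas block_emit_consts' = block_emit_consts[where js = "[]", simplified]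

lemma block_edge_table:
  assumes G: "written (xs @ table_code \<sigma> p ws) r m" and p: "r 24 = p + length ws * Suc \<sigma>"
    and x: "r 23 = x" "x < 2" and \<sigma>: "2 \<le> \<sigma>"
    and cap: "e 14 + length xs + Suc (length ws) * \<sigma> < 2 ^ w" "p + Suc (length ws) * Suc \<sigma> + 2 < 2 ^ w"
  shows "block_wp w (edge_table \<sigma>) (\<lambda>r' m'. written (xs @ table_code \<sigma> p (ws @ [x])) r' m' \<and>
    r' 24 = p + Suc (length ws) * Suc \<sigma> \<and> (\<forall>y \<in> {19..22}. r' y = r y)) r m"
proof -
  let ?p = "p + length ws * Suc \<sigma>"
  let ?ys = "xs @ table_code \<sigma> p ws"
  have cap': "e 14 + length ?ys + \<sigma> < 2 ^ w" "?p + \<sigma> + 3 < 2 ^ w"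
    using cap by (simp_all add: length_table_code)
  \<comment> \<open>The instructions for the letters from 2 on are unrolled in the program text,
    hence an induction over the list of letters instead of a machine loop.\<close>
  have loop: "block_wp w (concat (map (\<lambda>a. [Const 26 (Suc a), Bin Add 25 24 26] @ emit 25) as) @ is) Q r m"
    if "written zs r m" "r 24 = ?p" "\<forall>a \<in> set as. a < \<sigma>" "e 14 + length zs + length as < 2 ^ w"
      "\<And>r' m'. written (zs @ map (\<lambda>a. ?p + Suc a) as) r' m' \<Longrightarrow>
         (\<And>y. y \<noteq> 18 \<Longrightarrow> y \<noteq> 25 \<Longrightarrow> y \<noteq> 26 \<Longrightarrow> r' y = r y) \<Longrightarrow> block_wp w is Q r' m'"
    for as zs r m "is" Q
    using that
  proof (induction as arbitrary: zs r m)
    case Nil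
    then show ?case by simp
  next
    case (Cons a as)
    let ?r = "r(26 := Suc a, 25 := ?p + Suc a)"
    have "block_wp w (emit 25 @ concat (map (\<lambda>a. [Const 26 (Suc a), Bin Add 25 24 26] @ emit 25) as) @ is)
        Q ?r m"
    proof (rule block_emit[where xs = zs])
      fix r' m'
      assume G: "written (zs @ [?r 25]) r' m'" and r': "\<And>y. y \<noteq> 18 \<Longrightarrow> r' y = ?r y"
      show "block_wp w (concat (map (\<lambda>a. [Const 26 (Suc a), Bin Add 25 24 26] @ emit 25) as) @ is) Q r' m'"
      proof (rule Cons.IH[where zs = "zs @ [?p + Suc a]"])
        fix r'' m''
        assume "written ((zs @ [?p + Suc a]) @ map (\<lambda>a. ?p + Suc a) as) r'' m''"
          "\<And>y. y \<noteq> 18 \<Longrightarrow> y \<noteq> 25 \<Longrightarrow> y \<noteq> 26 \<Longrightarrow> r'' y = r' y"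
        then show "block_wp w is Q r'' m''"
          using r' by (intro Cons.prems(5)) auto
      qed (use G r' Cons.prems in auto)
    qed (use Cons.prems in auto)
    moreover have "?p + Suc a < 2 ^ w" "Suc a < 2 ^ w"
      using Cons.prems(3) cap' by auto
    ultimately show ?case
      using Cons.prems(2) by (simp del: fun_upd_apply) (simp add: fun_upd_twist)
  qed
  show ?thesis
    unfolding edge_table_def
  proof (rule block_emit[OF G])
    fix r1 m1
    assume G1: "written (?ys @ [r 24]) r1 m1" and r1: "\<And>y. y \<noteq> 18 \<Longrightarrow> r1 y = r y"
    let ?r1 = "r1(26 := 2, 25 := ?p + 2, 25 := ?p + 2 - x)"
    have "block_wp w (emit 25 @ concat (map (\<lambda>a. [Const 26 (Suc a), Bin Add 25 24 26] @ emit 25) [2..<\<sigma>])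
      @ [Const 26 (Suc \<sigma>), Bin Add 24 24 26]) (\<lambda>r' m'. written (xs @ table_code \<sigma> p (ws @ [x])) r' m' \<and>
        r' 24 = p + Suc (length ws) * Suc \<sigma> \<and> (\<forall>y \<in> {19..22}. r' y = r y)) ?r1 m1"
    proof (rule block_emit[where xs = "?ys @ [?p]"])
      fix r2 m2
      assume G2: "written ((?ys @ [?p]) @ [?r1 25]) r2 m2" and r2: "\<And>y. y \<noteq> 18 \<Longrightarrow> r2 y = ?r1 y"
      show "block_wp w (concat (map (\<lambda>a. [Const 26 (Suc a), Bin Add 25 24 26] @ emit 25) [2..<\<sigma>])
        @ [Const 26 (Suc \<sigma>), Bin Add 24 24 26]) (\<lambda>r' m'. written (xs @ table_code \<sigma> p (ws @ [x])) r' m' \<and>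
          r' 24 = p + Suc (length ws) * Suc \<sigma> \<and> (\<forall>y \<in> {19..22}. r' y = r y)) r2 m2"
      proof (rule loop[where zs = "?ys @ [?p, ?p + 2 - x]"])
        fix r3 m3
        assume G3: "written ((?ys @ [?p, ?p + 2 - x]) @ map (\<lambda>a. ?p + Suc a) [2..<\<sigma>]) r3 m3"
          and r3: "\<And>y. y \<noteq> 18 \<Longrightarrow> y \<noteq> 25 \<Longrightarrow> y \<noteq> 26 \<Longrightarrow> r3 y = r2 y"
        have "written (xs @ table_code \<sigma> p (ws @ [x])) r3 m3"
          using G3 by (simp add: table_code_append table_cells_unfold[OF \<sigma> x(2)])
        moreover have "r3 24 = ?p" "\<forall>y \<in> {19..22}. r3 y = r y"
          using r1 r2 r3 p by auto
        ultimately show "block_wp w [Const 26 (Suc \<sigma>), Bin Add 24 24 26]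
          (\<lambda>r' m'. written (xs @ table_code \<sigma> p (ws @ [x])) r' m' \<and>
            r' 24 = p + Suc (length ws) * Suc \<sigma> \<and> (\<forall>y \<in> {19..22}. r' y = r y)) r3 m3"
          using cap' by auto
      qed (use G2 r1 r2 p cap' \<sigma> in auto)
    qed (use G1 p cap' \<sigma> in auto)
    then show "block_wp w ([Const 26 2, Bin Add 25 24 26, Bin Sub 25 25 23] @ emit 25
      @ concat (map (\<lambda>a. [Const 26 (Suc a), Bin Add 25 24 26] @ emit 25) [2..<\<sigma>])
      @ [Const 26 (Suc \<sigma>), Bin Add 24 24 26]) (\<lambda>r' m'. written (xs @ table_code \<sigma> p (ws @ [x])) r' m' \<and>
        r' 24 = p + Suc (length ws) * Suc \<sigma> \<and> (\<forall>y \<in> {19..22}. r' y = r y)) r1 m1"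
      using r1 p x cap' by simp
  qed (use cap' \<sigma> in simp)
qed

lemma block_edge_list:
  assumes G: "written (xs @ list_code \<sigma> ws) r m" and u: "r 24 = Suc (length ws)"
    and x: "r 23 = x" "x < 2" and \<sigma>: "2 \<le> \<sigma>" and ws: "set ws \<subseteq> {..<\<sigma>}"
    and cap: "e 14 + length xs + Suc (length ws) * Suc \<sigma> < 2 ^ w" "length ws + 2 < 2 ^ w"
  shows "block_wp w (edge_list \<sigma>) (\<lambda>r' m'. written (xs @ list_code \<sigma> (ws @ [x])) r' m' \<and>
    r' 24 = Suc (Suc (length ws)) \<and> (\<forall>y \<in> {19..22}. r' y = r y)) r m"
proof -
  let ?v = "Suc (length ws)" and ?ys = "xs @ list_code \<sigma> ws"
  let ?Q = "\<lambda>r' m'. written (xs @ list_code \<sigma> (ws @ [x])) r' m' \<and>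
    r' 24 = Suc (Suc (length ws)) \<and> (\<forall>y \<in> {19..22}. r' y = r y)"
  have cap': "e 14 + length ?ys + Suc \<sigma> < 2 ^ w"
    using cap by (simp add: length_list_code[OF ws])
  have r1: "r 1 = 1"
    using writtenD[OF G, of 1] e1 by simp
  have small: "1 - x < 2 ^ w" "(1 - x) * ?v \<le> ?v" "x * ?v \<le> ?v"
    using x(2) cap(2) by (auto simp: less_2_cases_iff)
  have small': "(1 - x) * ?v + x < 2 ^ w"
    using x(2) cap(2) by (auto simp: less_2_cases_iff)
  \<comment> \<open>Suffixes of the instruction sequence; they are verified from the last one
    backwards.\<close>
  define I4 where "I4 = [Bin Add 24 24 1]"
  define I3 where "I3 = emit_consts (replicate (\<sigma> - 2) 0) @ I4"
  define I2 where "I2 = [Bin Mul 25 23 24] @ emit 25 @ I3"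
  define I1 where "I1 = [Bin Mul 25 25 24, Bin Add 25 25 23] @ emit 25 @ I2"
  have 3: "block_wp w I3 ?Q r' m'"
    if G': "written (?ys @ [1 - x, (1 - x) * ?v + x, x * ?v]) r' m'"
      and r': "\<And>y. y \<noteq> 18 \<Longrightarrow> y \<noteq> 25 \<Longrightarrow> r' y = r y" for r' m'
    unfolding I3_def
  proof (rule block_emit_consts[OF G'])
    fix r3 m3
    assume G3: "written ((?ys @ [1 - x, (1 - x) * ?v + x, x * ?v]) @ replicate (\<sigma> - 2) 0) r3 m3"
      and r3: "\<And>y. y \<noteq> 18 \<Longrightarrow> y \<noteq> 25 \<Longrightarrow> r3 y = r' y"
    have "written (xs @ list_code \<sigma> (ws @ [x])) r3 m3"
      using G3 by (simp only: list_code_append list_cells_unfold[OF \<sigma> x(2)] append_assoc)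
    then show "block_wp w I4 ?Q r3 m3"
      using r3 r' r1 u cap by (simp add: I4_def)
  qed (use cap' \<sigma> in auto)
  have 2: "block_wp w I2 ?Q r' m'"
    if G': "written (?ys @ [1 - x, (1 - x) * ?v + x]) r' m'"
      and r': "\<And>y. y \<noteq> 18 \<Longrightarrow> y \<noteq> 25 \<Longrightarrow> r' y = r y" for r' m'
  proof -
    have "block_wp w (emit 25 @ I3) ?Q (r'(25 := x * ?v)) m'"
    proof (rule block_emit[where xs = "?ys @ [1 - x, (1 - x) * ?v + x]"])
      fix r3 m3
      assume "written ((?ys @ [1 - x, (1 - x) * ?v + x]) @ [(r'(25 := x * ?v)) 25]) r3 m3"
        "\<And>y. y \<noteq> 18 \<Longrightarrow> r3 y = (r'(25 := x * ?v)) y"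
      then show "block_wp w I3 ?Q r3 m3"
        using r' by (intro 3) auto
    qed (use G' cap' \<sigma> in auto)
    moreover have "x * ?v < 2 ^ w"
      using small(3) cap(2) by linarith
    ultimately show ?thesis
      using r' x u by (simp add: I2_def del: fun_upd_apply mult_Suc_right)
  qed
  have 1: "block_wp w I1 ?Q r' m'"
    if G': "written (?ys @ [1 - x]) r' m'" and "r' 25 = 1 - x"
      and r': "\<And>y. y \<noteq> 18 \<Longrightarrow> y \<noteq> 25 \<Longrightarrow> r' y = r y" for r' m'
  proof -
    have "block_wp w (emit 25 @ I2) ?Q (r'(25 := (1 - x) * ?v + x)) m'"
    proof (rule block_emit[where xs = "?ys @ [1 - x]"])
      fix r3 m3
      assume "written ((?ys @ [1 - x]) @ [(r'(25 := (1 - x) * ?v + x)) 25]) r3 m3"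
        "\<And>y. y \<noteq> 18 \<Longrightarrow> r3 y = (r'(25 := (1 - x) * ?v + x)) y"
      then show "block_wp w I2 ?Q r3 m3"
        using r' by (intro 2) auto
    qed (use G' cap' \<sigma> in auto)
    moreover have "(1 - x) * ?v < 2 ^ w"
      using small(2) cap(2) by linarith
    ultimately show ?thesis
      using r' x u that(2) small' by (simp add: I1_def del: mult_Suc_right)
  qed
  have "block_wp w (emit 25 @ I1) ?Q (r(25 := 1 - x)) m"
  proof (rule block_emit[where xs = ?ys])
    fix r3 m3
    assume "written (?ys @ [(r(25 := 1 - x)) 25]) r3 m3" "\<And>y. y \<noteq> 18 \<Longrightarrow> r3 y = (r(25 := 1 - x)) y"
    then show "block_wp w I1 ?Q r3 m3"
      by (intro 1) auto
  qed (use G cap' \<sigma> in auto)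
  then show ?thesis
    using r1 x small by (simp add: edge_list_def I1_def I2_def I3_def I4_def del: fun_upd_apply)
qed

text \<open>\<open>J ws\<close> abstracts from what is written for a prefix \<open>ws\<close> of the
  word, so that \<open>word_pass\<close> is verified once for pointers and lists. The listed
  registers are those the pass itself may change; register 24 belongs to \<open>J\<close>.\<close>

definition edge_inv :: "(nat list \<Rightarrow> store \<Rightarrow> store \<Rightarrow> bool) \<Rightarrow> bool" where
  "edge_inv J \<longleftrightarrow>
     (\<forall>ws r m x v. x \<in> {19, 20, 21, 22, 23, 25} \<longrightarrow> J ws (r(x := v)) m = J ws r m) \<and>
     (\<forall>ws r m. J ws r m \<longrightarrow> fixed r m)"

text \<open>The bound \<open>L\<close> on the length of the word lets the word size conditions be
  checked once for the whole pass.\<close>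

definition writes_edge :: "(nat list \<Rightarrow> store \<Rightarrow> store \<Rightarrow> bool) \<Rightarrow> instr list \<Rightarrow> nat \<Rightarrow> bool" where
  "writes_edge J E L \<longleftrightarrow>
     (\<forall>ws x r m. J ws r m \<longrightarrow> r 23 = x \<longrightarrow> x < 2 \<longrightarrow> length ws < L \<longrightarrow> set ws \<subseteq> {0, 1} \<longrightarrow>
       block_wp w E (\<lambda>r' m'. J (ws @ [x]) r' m' \<and> (\<forall>y \<in> {19..22}. r' y = r y)) r m)"

lemma block_edge:
  assumes "writes_edge J E L" "J ws r m" "r 23 = x" "x < 2" "length ws < L" "set ws \<subseteq> {0, 1}"
    and "\<And>r' m'. J (ws @ [x]) r' m' \<Longrightarrow> (\<And>y. y \<in> {19..22} \<Longrightarrow> r' y = r y) \<Longrightarrow> block_wp w js Q r' m'"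
  shows "block_wp w (E @ js) Q r m"
proof -
  have "block_wp w E (\<lambda>r' m'. J (ws @ [x]) r' m' \<and> (\<forall>y \<in> {19..22}. r' y = r y)) r m"
    using assms(1-6) unfolding writes_edge_def by blast
  then have "block_wp w E (block_wp w js Q) r m"
  proof (rule block_wp_mono)
    fix r' m'
    assume *: "J (ws @ [x]) r' m' \<and> (\<forall>y \<in> {19..22}. r' y = r y)"
    show "block_wp w js Q r' m'"
      by (rule assms(7)) (use * in simp_all)
  qed
  then show ?thesis by (simp add: block_wp_append)
qed

lemma block_edge':
  assumes "writes_edge J E L" "J ws r m" "r 23 = x" "x < 2" "length ws < L" "set ws \<subseteq> {0, 1}"
    and "\<And>r' m'. J (ws @ [x]) r' m' \<Longrightarrow> (\<And>y. y \<in> {19..22} \<Longrightarrow> r' y = r y) \<Longrightarrow> Q r' m'"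
  shows "block_wp w E Q r m"
proof -
  have "block_wp w E (\<lambda>r' m'. J (ws @ [x]) r' m' \<and> (\<forall>y \<in> {19..22}. r' y = r y)) r m"
    using assms(1-6) unfolding writes_edge_def by blast
  then show ?thesis
  proof (rule block_wp_mono)
    fix r' m'
    assume *: "J (ws @ [x]) r' m' \<and> (\<forall>y \<in> {19..22}. r' y = r y)"
    show "Q r' m'"
      by (rule assms(7)) (use * in simp_all)
  qed
qed

lemma edge_inv_table:
  "edge_inv (\<lambda>ws r m. written (xs @ table_code \<sigma> p ws) r m \<and> r 24 = p + length ws * Suc \<sigma>)"
  unfolding edge_inv_def by (auto simp: written_def)

lemma edge_inv_list:
  "edge_inv (\<lambda>ws r m. written (xs @ list_code \<sigma> ws) r m \<and> r 24 = Suc (length ws))"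
  unfolding edge_inv_def by (auto simp: written_def)

lemma writes_edge_table:
  assumes "2 \<le> \<sigma>" "e 14 + length xs + L * \<sigma> < 2 ^ w" "p + L * Suc \<sigma> + 2 < 2 ^ w"
  shows "writes_edge (\<lambda>ws r m. written (xs @ table_code \<sigma> p ws) r m \<and> r 24 = p + length ws * Suc \<sigma>)
    (edge_table \<sigma>) L"
  unfolding writes_edge_def
proof (intro allI impI)
  fix ws x r m
  assume J: "written (xs @ table_code \<sigma> p ws) r m \<and> r 24 = p + length ws * Suc \<sigma>"
    and x: "r 23 = x" "x < 2" and ws: "length ws < L"
  have "Suc (length ws) * \<sigma> \<le> L * \<sigma>" "Suc (length ws) * Suc \<sigma> \<le> L * Suc \<sigma>"
    using ws by (simp_all only: Suc_leI mult_le_mono1)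
  then have "e 14 + length xs + Suc (length ws) * \<sigma> < 2 ^ w"
      "p + Suc (length ws) * Suc \<sigma> + 2 < 2 ^ w"
    using assms by linarith+
  from block_edge_table[OF conjunct1[OF J] conjunct2[OF J] x assms(1) this]
  show "block_wp w (edge_table \<sigma>) (\<lambda>r' m'. (written (xs @ table_code \<sigma> p (ws @ [x])) r' m' \<and>
      r' 24 = p + length (ws @ [x]) * Suc \<sigma>) \<and> (\<forall>y \<in> {19..22}. r' y = r y)) r m"
    by (simp add: conj_assoc)
qed

lemma writes_edge_list:
  assumes "2 \<le> \<sigma>" "e 14 + length xs + L * Suc \<sigma> < 2 ^ w" "L + 2 < 2 ^ w"
  shows "writes_edge (\<lambda>ws r m. written (xs @ list_code \<sigma> ws) r m \<and> r 24 = Suc (length ws))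
    (edge_list \<sigma>) L"
  unfolding writes_edge_def
proof (intro allI impI)
  fix ws x r m
  assume J: "written (xs @ list_code \<sigma> ws) r m \<and> r 24 = Suc (length ws)"
    and x: "r 23 = x" "x < 2" and ws: "length ws < L" and "set ws \<subseteq> {0, 1}"
  then have set: "set ws \<subseteq> {..<\<sigma>}"
    using assms(1) by fastforce
  have "Suc (length ws) * Suc \<sigma> \<le> L * Suc \<sigma>"
    using ws by (simp_all only: Suc_leI mult_le_mono1)
  then have "e 14 + length xs + Suc (length ws) * Suc \<sigma> < 2 ^ w" "length ws + 2 < 2 ^ w"
    using assms ws by linarith+
  from block_edge_list[OF conjunct1[OF J] conjunct2[OF J] x assms(1) set this]
  show "block_wp w (edge_list \<sigma>) (\<lambda>r' m'. (written (xs @ list_code \<sigma> (ws @ [x])) r' m' \<and>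
      r' 24 = Suc (length (ws @ [x]))) \<and> (\<forall>y \<in> {19..22}. r' y = r y)) r m"
    by (simp add: conj_assoc)
qed

lemma wp_pad_table:
  assumes G: "written xs r m" and p: "r 24 = p"
    and cap: "e 14 + length xs + e 7 < 2 ^ w" "p + e 7 < 2 ^ w"
  shows "wp w pad_table (e 7 * 6 + 2) (written (xs @ map (\<lambda>i. p + i) [0..<e 7])) r m"
proof -
  define I where "I i r m \<longleftrightarrow> written (xs @ map (\<lambda>i. p + i) [0..<i]) r m \<and> r 24 = p + i" for i r m
  have "wp w pad_table (1 + (e 7 * (3 + 3) + 1)) (written (xs @ map (\<lambda>i. p + i) [0..<e 7])) r m"
    unfolding pad_table_def
  proof (rule wp_SeqI[where R = "\<lambda>r m. I 0 r m \<and> r 19 = e 7"])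
    show "wp w (Block [Move 19 7]) 1 (\<lambda>r m. I 0 r m \<and> r 19 = e 7) r m"
      using G p cap writtenD[OF G, of 7] by (intro wp_Block) (auto simp: I_def)
    fix r m
    assume r: "I 0 r m \<and> r 19 = e 7"
    have "wp w (Rep 19 (Block (emit 24 @ [Bin Add 24 24 1]))) (e 7 * (3 + 3) + 1)
      (\<lambda>r m. I (e 7) r m \<and> r 19 = 0) r m"
    proof (rule wp_Rep)
      fix k r m
      assume k: "k < e 7" and I: "I k r m" and r19: "r 19 = e 7 - k"
      have G: "written (xs @ map (\<lambda>i. p + i) [0..<k]) r m" and r24: "r 24 = p + k"
        using I by (auto simp: I_def)
      have "block_wp w (emit 24 @ [Bin Add 24 24 1])
        (\<lambda>r m. I (Suc k) (r(19 := e 7 - Suc k)) m \<and> r 19 = e 7 - k \<and> r 1 = 1) r m"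
      proof (rule block_emit[OF G])
        fix r' m'
        assume G': "written ((xs @ map (\<lambda>i. p + i) [0..<k]) @ [r 24]) r' m'"
          and r': "\<And>y. y \<noteq> 18 \<Longrightarrow> r' y = r y"
        have "r' 1 = 1" using writtenD[OF G', of 1] e1 by simp
        then show "block_wp w [Bin Add 24 24 1]
          (\<lambda>r m. I (Suc k) (r(19 := e 7 - Suc k)) m \<and> r 19 = e 7 - k \<and> r 1 = 1) r' m'"
          using G' r' r24 r19 k cap by (simp add: I_def)
      qed (use k cap in auto)
      then show "wp w (Block (emit 24 @ [Bin Add 24 24 1])) 3
        (\<lambda>r m. I (Suc k) (r(19 := e 7 - Suc k)) m \<and> r 19 = e 7 - k \<and> r 1 = 1) r m"
        by (rule wp_Block) (simp add: emit_def)
    qed (use r cap in auto)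
    then show "wp w (Rep 19 (Block (emit 24 @ [Bin Add 24 24 1]))) (e 7 * (3 + 3) + 1)
        (written (xs @ map (\<lambda>i. p + i) [0..<e 7])) r m"
      by (rule wp_mono) (auto simp: I_def)
  qed
  then show ?thesis by (rule wp_mono) auto
qed

text \<open>The predicate \<open>F\<close> stands for the registers that a loop writing a constant leaves unchanged.\<close>

lemma wp_emit_replicate:
  assumes G: "written xs r m" and x: "r x = N" "x \<in> {19, 20}" and F: "F r"
    and F_upd: "\<And>r r'. F r \<Longrightarrow> (\<And>y. y \<noteq> 18 \<Longrightarrow> y \<noteq> 25 \<Longrightarrow> y \<noteq> x \<Longrightarrow> r' y = r y) \<Longrightarrow> F r'"
    and cap: "e 14 + length xs + N < 2 ^ w" "c < 2 ^ w"
  shows "wp w (Rep x (Block (emit_consts [c]))) (N * 6 + 1)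
    (\<lambda>r m. written (xs @ replicate N c) r m \<and> F r) r m"
proof -
  define I where "I i r m \<longleftrightarrow> written (xs @ replicate i c) r m \<and> F r" for i r m
  have "wp w (Rep x (Block (emit_consts [c]))) (N * (3 + 3) + 1) (\<lambda>r m. I N r m \<and> r x = 0) r m"
  proof (rule wp_Rep)
    fix k r m
    assume k: "k < N" and I: "I k r m" and rx: "r x = N - k"
    have G: "written (xs @ replicate k c) r m" and F: "F r"
      using I by (auto simp: I_def)
    have "block_wp w (emit_consts [c])
      (\<lambda>r m. I (Suc k) (r(x := N - Suc k)) m \<and> r x = N - k \<and> r 1 = 1) r m"
    proof (rule block_emit_consts'[OF G])
      fix r' m'
      assume G': "written ((xs @ replicate k c) @ [c]) r' m'"
        and r': "\<And>y. y \<noteq> 18 \<Longrightarrow> y \<noteq> 25 \<Longrightarrow> r' y = r y"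
      have "r' 1 = 1" using writtenD[OF G', of 1] e1 by simp
      moreover have "F (r'(x := N - Suc k))"
        by (rule F_upd[OF F]) (use r' in auto)
      moreover have "written (xs @ replicate (Suc k) c) (r'(x := N - Suc k)) m'"
        using G' x(2) by (auto simp: replicate_append_same simp flip: replicate_Suc)
      ultimately show "I (Suc k) (r'(x := N - Suc k)) m' \<and> r' x = N - k \<and> r' 1 = 1"
        using r' rx x(2) by (auto simp: I_def)
    qed (use k cap in auto)
    then show "wp w (Block (emit_consts [c])) 3
      (\<lambda>r m. I (Suc k) (r(x := N - Suc k)) m \<and> r x = N - k \<and> r 1 = 1) r m"
      by (rule wp_Block) (simp add: emit_consts_def emit_def)
  qed (use G F x cap in \<open>auto simp: I_def\<close>)
  then show ?thesis
    by (rule wp_mono) (auto simp: I_def)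
qed

lemma wp_pad_list:
  assumes G: "written xs r m" and cap: "e 14 + length xs + e 7 < 2 ^ w"
  shows "wp w pad_list (e 7 * 6 + 2) (written (xs @ replicate (e 7) 0)) r m"
proof -
  have "wp w pad_list (1 + (e 7 * 6 + 1)) (written (xs @ replicate (e 7) 0)) r m"
    unfolding pad_list_def
  proof (rule wp_SeqI[where R = "\<lambda>r m. written xs r m \<and> r 19 = e 7"])
    show "wp w (Block [Move 19 7]) 1 (\<lambda>r m. written xs r m \<and> r 19 = e 7) r m"
      using G cap writtenD[OF G, of 7] by (intro wp_Block) auto
    fix r m
    assume r: "written xs r m \<and> r 19 = e 7"
    show "wp w (Rep 19 (Block (emit_consts [0]))) (e 7 * 6 + 1) (written (xs @ replicate (e 7) 0)) r m"
      by (rule wp_mono, rule wp_emit_replicate[where F = "\<lambda>_. True"]) (use r cap in auto)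
  qed
  then show ?thesis by (rule wp_mono) auto
qed

end

section \<open>Writing the instance from the vectors in the input\<close>

locale ov_run = run +
  fixes A B :: "bool list list" and n d :: nat
  assumes inp: "inp = [n, d] @ map of_bool (concat A) @ map of_bool (concat B)"
    and A: "length A = n" "\<forall>a \<in> set A. length a = d"
    and B: "length B = n" "\<forall>b \<in> set B. length b = d"
    and n: "0 < n" and en: "e 2 = n" and ed: "e 3 = d" and e11: "e 11 = 2 + n * d"
    and inp_small: "length inp + d + 2 < 2 ^ w" "n + d + 9 < 2 ^ w"
begin

lemma nth_concat_uniform:
  "\<forall>x \<in> set xs. length x = d \<Longrightarrow> j < length xs \<Longrightarrow> k < d \<Longrightarrow> concat xs ! (j * d + k) = xs ! j ! k"
proof (induction xs arbitrary: j)
  case (Cons x xs)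
  then show ?case by (cases j) (auto simp: nth_append)
qed simp

lemma length_concat_uniform: "\<forall>x \<in> set xs. length x = d \<Longrightarrow> length (concat xs) = length xs * d"
  by (induction xs) auto

lemma length_inp: "length inp = 2 + n * d + n * d"
  using A B by (simp add: inp length_concat_uniform)

lemma index_less: "j < n \<Longrightarrow> k < d \<Longrightarrow> j * d + k < n * d"
  using mult_le_mono1[of "Suc j" n d] by simp

lemma inp_A: "j < n \<Longrightarrow> k < d \<Longrightarrow> inp ! (2 + j * d + k) = of_bool (A ! j ! k)"
  using A B index_less[of j k] nth_concat_uniform[of A j k]
  by (simp add: inp nth_append length_concat_uniform)

lemma inp_B: "j < n \<Longrightarrow> k < d \<Longrightarrow> inp ! (2 + n * d + j * d + k) = of_bool (B ! j ! k)"
  using A B index_less[of j k] nth_concat_uniform[of B j k]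
  by (simp add: inp nth_append length_concat_uniform add.assoc)

lemma fixed_A: "fixed r m \<Longrightarrow> j < n \<Longrightarrow> k < d \<Longrightarrow> m (2 + j * d + k) = of_bool (A ! j ! k)"
  using inp_A[of j k] index_less[of j k] length_inp by (simp add: fixed_def)

lemma fixed_B: "fixed r m \<Longrightarrow> j < n \<Longrightarrow> k < d \<Longrightarrow> m (2 + n * d + j * d + k) = of_bool (B ! j ! k)"
  using inp_B[of j k] index_less[of j k] length_inp by (simp add: fixed_def)

definition group_A :: "bool list list" where
  "group_A = map (\<lambda>i. A ! ((e 15 + i) mod n)) [0..<e 4]"

definition group_B :: "bool list list" where
  "group_B = map (\<lambda>i. B ! ((e 16 + i) mod n)) [0..<e 5]"

lemma length_group_A: "a \<in> set group_A \<Longrightarrow> length a = d"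
  and length_group_B: "b \<in> set group_B \<Longrightarrow> length b = d"
  using A B n by (auto simp: group_A_def group_B_def)

text \<open>\<open>J\<close> implies \<open>fixed\<close>, so the bits can still be read from the
  input while cells are being written. Five steps per letter, besides the \<open>length E\<close>
  steps that write it, pay for all loop overhead.\<close>

lemma wp_word_pass:
  assumes inv: "edge_inv J" and edge: "writes_edge J E (e 4 * (2 * d + 3))" and J0: "J [] r m"
    and cap: "e 15 + e 4 < 2 ^ w"
  shows "wp w (word_pass E) (3 + e 4 * ((2 * d + 3) * (length E + 5))) (J (word group_A)) r m"
proof -
  define vec where "vec i = A ! ((e 15 + i) mod n)" for i
  define W where "W i = word (map vec [0..<i])" for i
  \<comment> \<open>The part of the body of vector \<open>i\<close> that is present after
    \<open>k\<close> of its bits.\<close>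
  define X where "X i k = concat (map (\<lambda>k. [0, of_bool (vec i ! k) :: nat]) [0..<k])" for i k
  let ?a = "e 15" and ?g = "e 4" and ?l = "length E"
  have group: "group_A = map vec [0..<?g]"
    by (simp add: group_A_def vec_def)
  have vec_length: "length (vec i) = d" for i
    using A n by (simp add: vec_def)
  have X_Suc: "X i (Suc k) = X i k @ [0] @ [of_bool (vec i ! k)]" for i k
    by (simp add: X_def)
  have length_X: "length (X i k) = 2 * k" for i k
    by (induction k) (auto simp: X_Suc, simp add: X_def)
  have set_X: "set (X i k) \<subseteq> {0, 1}" for i k
    by (auto simp: X_def)
  have X_d: "X i d @ [0] = body (vec i)" for i
  proof -
    have "map (\<lambda>k. [0, of_bool (vec i ! k) :: nat]) [0..<d] = map (\<lambda>x. [0, of_bool x]) (vec i)"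
      by (rule nth_equalityI) (auto simp: vec_length)
    then show ?thesis by (simp add: X_def body_def)
  qed
  have W_Suc: "W (Suc i) = (W i @ [1] @ [1] @ X i d) @ [0]" for i
    using X_d[of i] by (simp add: W_def word_def)
  have length_W: "length (W i) = i * (2 * d + 3)" for i
    unfolding W_def by (subst length_word[of _ d]) (auto simp: vec_length)
  have set_W: "set (W i) \<subseteq> {0, 1}" for i
    unfolding W_def by (rule set_word)
  \<comment> \<open>A whole further vector fits below the bound on the number of letters.\<close>
  have cap_L: "i * (2 * d + 3) + (2 * d + 3) \<le> ?g * (2 * d + 3)" if "i < ?g" for i
    using mult_le_mono1[of "Suc i" ?g "2 * d + 3"] that by simp
  have J_upd [simp]: "J ws (r(x := v)) m = J ws r m" if "x \<in> {19, 20, 21, 22, 23, 25}" for ws r m x v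
    using inv that unfolding edge_inv_def by blast
  have J_fixed: "fixed r m" if "J ws r m" for ws r m
    using inv that unfolding edge_inv_def by blast
  have J_reg: "r x = e x" if "J ws r m" "x < 18" for ws r m x
    using J_fixed[OF that(1)] that(2) fixedD by blast
  have small: "(?a + i) mod n * d \<le> n * d" "n * d + 2 < 2 ^ w" "d < 2 ^ w" "(2 :: nat) < 2 ^ w" for i
    using inp_small length_inp n by (auto simp: mod_less_divisor less_imp_le)
  show ?thesis
  proof -
    let ?inner = "Block ([Const 23 0] @ E @ [Load 23 22, Bin Add 22 22 1] @ E)"
    let ?body = "Block ([Bin Mod 22 21 2, Bin Mul 22 22 3, Const 25 2, Bin Add 22 22 25,
        Bin Add 21 21 1, Const 23 1] @ E @ [Const 23 1] @ E @ [Move 20 3]) ;;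
      Rep 20 ?inner ;; Block ([Const 23 0] @ E)"
    define I where "I i r m \<longleftrightarrow> J (W i) r m \<and> r 21 = ?a + i" for i r m
    have body: "wp w ?body ((8 + 2 * ?l) + ((d * ((3 + 2 * ?l) + 3) + 1) + (1 + ?l)))
        (\<lambda>r m. I (Suc i) (r(19 := ?g - Suc i)) m \<and> r 19 = ?g - i \<and> r 1 = 1) r m"
      if i: "i < ?g" and I: "I i r m" and r19: "r 19 = ?g - i" for i r m
    proof -
      let ?row = "2 + (?a + i) mod n * d"
      define I' where "I' k r m \<longleftrightarrow> J (W i @ [1] @ [1] @ X i k) r m \<and> r 21 = ?a + Suc i \<and>
        r 22 = ?row + k \<and> r 19 = ?g - i" for k r m
      have J: "J (W i) r m" and r21: "r 21 = ?a + i"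
        using I by (auto simp: I_def)
      have regs: "r 1 = 1" "r 2 = n" "r 3 = d"
        using J_reg[OF J] e1 en ed by auto
      show ?thesis
      proof (rule wp_SeqI[where R = "\<lambda>r m. I' 0 r m \<and> r 20 = d"])
        let ?r = "r(22 := ?row, 21 := ?a + Suc i, 23 := 1, 25 := 2)"
        have "block_wp w (E @ [Const 23 1] @ E @ [Move 20 3]) (\<lambda>r m. I' 0 r m \<and> r 20 = d) ?r m"
        proof (rule block_edge[OF edge])
          show "J (W i) ?r m" using J by simp
          fix r1 m1
          assume J1: "J (W i @ [1]) r1 m1" and r1: "\<And>y. y \<in> {19..22} \<Longrightarrow> r1 y = ?r y"
          have "block_wp w (E @ [Move 20 3]) (\<lambda>r m. I' 0 r m \<and> r 20 = d) (r1(23 := 1)) m1"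
          proof (rule block_edge[OF edge])
            show "J (W i @ [1]) (r1(23 := 1)) m1" using J1 by simp
            fix r2 m2
            assume J2: "J ((W i @ [1]) @ [1]) r2 m2" and r2: "\<And>y. y \<in> {19..22} \<Longrightarrow> r2 y = (r1(23 := 1)) y"
            have "r2 3 = d" using J_reg[OF J2, of 3] ed by simp
            then show "block_wp w [Move 20 3] (\<lambda>r m. I' 0 r m \<and> r 20 = d) r2 m2"
              using J2 r1 r2 r19 small by (simp add: I'_def X_def)
          qed (use i cap_L[OF i] set_W in \<open>auto simp: length_W\<close>)
          then show "block_wp w ([Const 23 1] @ E @ [Move 20 3]) (\<lambda>r m. I' 0 r m \<and> r 20 = d) r1 m1"
            using small(4) by (simp del: fun_upd_apply)
        qed (use i cap_L[OF i] set_W in \<open>auto simp: length_W\<close>)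
        moreover have "(?a + i) mod n * d < 2 ^ w" "?row < 2 ^ w" "?a + Suc i < 2 ^ w"
          "(?a + i) mod n < 2 ^ w"
          using small(1)[of i] small(2) cap i inp_small n mod_less_divisor[of n "?a + i"] by linarith+
        ultimately show "wp w (Block ([Bin Mod 22 21 2, Bin Mul 22 22 3, Const 25 2, Bin Add 22 22 25,
            Bin Add 21 21 1, Const 23 1] @ E @ [Const 23 1] @ E @ [Move 20 3])) (8 + 2 * ?l)
            (\<lambda>r m. I' 0 r m \<and> r 20 = d) r m"
          using regs r21 small(4) by (intro wp_Block) (simp_all add: fun_upd_twist add.commute)
      next
        fix r m
        assume I'0: "I' 0 r m \<and> r 20 = d"
        show "wp w (Rep 20 ?inner ;; Block ([Const 23 0] @ E)) ((d * ((3 + 2 * ?l) + 3) + 1) + (1 + ?l))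
          (\<lambda>r m. I (Suc i) (r(19 := ?g - Suc i)) m \<and> r 19 = ?g - i \<and> r 1 = 1) r m"
        proof (rule wp_SeqI[where R = "\<lambda>r m. I' d r m \<and> r 20 = 0"], rule wp_Rep)
          fix k r m
          assume k: "k < d" and I': "I' k r m" and r20: "r 20 = d - k"
          let ?Q = "\<lambda>r m. I' (Suc k) (r(20 := d - Suc k)) m \<and> r 20 = d - k \<and> r 1 = 1"
          have J: "J (W i @ [1] @ [1] @ X i k) r m" and r: "r 21 = ?a + Suc i" "r 22 = ?row + k" "r 19 = ?g - i"
            using I' by (auto simp: I'_def)
          have "block_wp w (E @ [Load 23 22, Bin Add 22 22 1] @ E) ?Q (r(23 := 0)) m"
          proof (rule block_edge[OF edge])
            show "J (W i @ [1] @ [1] @ X i k) (r(23 := 0)) m" using J by simp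
            fix r1 m1
            assume J1: "J ((W i @ [1] @ [1] @ X i k) @ [0]) r1 m1"
              and r1: "\<And>y. y \<in> {19..22} \<Longrightarrow> r1 y = (r(23 := 0)) y"
            let ?x = "of_bool (vec i ! k)" and ?r1 = "r1(23 := of_bool (vec i ! k), 22 := ?row + k + 1)"
            have m1: "m1 (?row + k) = ?x"
              using fixed_A[OF J_fixed[OF J1] mod_less_divisor[OF n] k] by (simp add: vec_def)
            have "block_wp w E ?Q ?r1 m1"
            proof (rule block_edge'[OF edge])
              show "J ((W i @ [1] @ [1] @ X i k) @ [0]) ?r1 m1" using J1 by simp
              show "?r1 23 = ?x" by simp
              fix r2 m2
              assume J2: "J (((W i @ [1] @ [1] @ X i k) @ [0]) @ [?x]) r2 m2"
                and r2: "\<And>y. y \<in> {19..22} \<Longrightarrow> r2 y = ?r1 y"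
              have "r2 1 = 1" using J_reg[OF J2, of 1] e1 by simp
              then show "?Q r2 m2"
                using J2 r1 r2 r r20 by (simp add: I'_def X_Suc)
            qed (use i cap_L[OF i] set_W[of i] set_X[of i k] k in \<open>auto simp: length_W length_X\<close>)
            moreover have "r1 1 = 1" using J_reg[OF J1, of 1] e1 by simp
            moreover have "?row + k + 1 < 2 ^ w"
              using small(1)[of i] k inp_small length_inp by linarith
            ultimately show "block_wp w ([Load 23 22, Bin Add 22 22 1] @ E) ?Q r1 m1"
              using m1 r1 r small(4) by (simp add: of_bool_def)
          qed (use i cap_L[OF i] set_W[of i] set_X[of i k] k in \<open>auto simp: length_W length_X\<close>)
          then show "wp w ?inner (3 + 2 * ?l) ?Q r m"
            by (intro wp_Block) (simp_all del: fun_upd_apply)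
        next
          fix r m
          assume I'd: "I' d r m \<and> r 20 = 0"
          have "block_wp w E (\<lambda>r m. I (Suc i) (r(19 := ?g - Suc i)) m \<and> r 19 = ?g - i \<and> r 1 = 1) (r(23 := 0)) m"
          proof (rule block_edge'[OF edge])
            show "J (W i @ [1] @ [1] @ X i d) (r(23 := 0)) m" using I'd by (simp add: I'_def)
            fix r1 m1
            assume J1: "J ((W i @ [1] @ [1] @ X i d) @ [0]) r1 m1"
              and r1: "\<And>y. y \<in> {19..22} \<Longrightarrow> r1 y = (r(23 := 0)) y"
            have "r1 1 = 1" using J_reg[OF J1, of 1] e1 by simp
            then show "I (Suc i) (r1(19 := ?g - Suc i)) m1 \<and> r1 19 = ?g - i \<and> r1 1 = 1"
              using J1 r1 I'd by (simp add: I_def I'_def W_Suc)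
          qed (use i cap_L[OF i] set_W[of i] set_X[of i d] in \<open>auto simp: length_W length_X\<close>)
          then show "wp w (Block ([Const 23 0] @ E)) (1 + ?l)
              (\<lambda>r m. I (Suc i) (r(19 := ?g - Suc i)) m \<and> r 19 = ?g - i \<and> r 1 = 1) r m"
            by (intro wp_Block) (simp_all del: fun_upd_apply)
        qed (use I'0 small in auto)
      qed
    qed
    have "wp w (word_pass E)
        (2 + (?g * (((8 + 2 * ?l) + ((d * ((3 + 2 * ?l) + 3) + 1) + (1 + ?l))) + 3) + 1))
        (J (word group_A)) r m"
      unfolding word_pass_def
    proof (rule wp_SeqI[where R = "\<lambda>r m. I 0 r m \<and> r 19 = ?g"])
      have "r 15 = ?a" "r 4 = ?g"
        using J_reg[OF J0] by auto
      then show "wp w (Block [Move 21 15, Move 19 4]) 2 (\<lambda>r m. I 0 r m \<and> r 19 = ?g) r m"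
        using J0 cap by (intro wp_Block) (auto simp: I_def W_def word_def)
      fix r m
      assume r: "I 0 r m \<and> r 19 = ?g"
      have "wp w (Rep 19 ?body) (?g * (((8 + 2 * ?l) + ((d * ((3 + 2 * ?l) + 3) + 1) + (1 + ?l))) + 3) + 1)
        (\<lambda>r m. I ?g r m \<and> r 19 = 0) r m"
        by (rule wp_Rep, rule body) (use r cap in auto)
      then show "wp w (Rep 19 ?body) (?g * (((8 + 2 * ?l) + ((d * ((3 + 2 * ?l) + 3) + 1) + (1 + ?l))) + 3) + 1)
        (J (word group_A)) r m"
        by (rule wp_mono) (auto simp: I_def W_def group)
    qed
    then show ?thesis
      by (rule wp_mono) (auto simp: algebra_simps)
  qed
qed

text \<open>Emitting a constant takes 3 steps, so prefix and suffix account for most of the constant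
  122. One alternative costs \<open>48 * d + 26\<close> steps with its closing parenthesis; 7 steps
  per symbol cover this.\<close>

lemma wp_query_pass:
  assumes G: "written xs r m"
    and cap: "e 14 + length xs + length (query_code group_B) < 2 ^ w" "e 16 + e 5 < 2 ^ w"
  shows "wp w query_pass (122 + e 5 * (7 * (12 * d + 4))) (written (xs @ query_code group_B)) r m"
proof -
  define vec where "vec i = B ! ((e 16 + i) mod n)" for i
  let ?b = "e 16" and ?g = "e 5"
  define W where "W i = concat (map (\<lambda>b. [0] @ vec_code b @ [4]) (map vec [0..<i]))" for i
  define X where "X i k = concat (map (\<lambda>k. bit_code (vec i ! k)) [0..<k])" for i k
  have group: "group_B = map vec [0..<?g]"
    by (simp add: group_B_def vec_def)
  have vec_length: "length (vec i) = d" for i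
    using B n by (simp add: vec_def)
  have X_Suc: "X i (Suc k) = X i k @ [0, 6, 3, 0, 0, 6, 4] @ [7 - of_bool (vec i ! k)] @ [1, 3]" for i k
    by (simp add: X_def bit_code_def)
  have length_X: "length (X i k) = 10 * k" for i k
    by (induction k) (auto simp: X_Suc, simp add: X_def)
  have X_d: "vec_code (vec i) = X i d @ [6] @ replicate (2 * d) 1" for i
  proof -
    have "map (\<lambda>k. bit_code (vec i ! k)) [0..<d] = map bit_code (vec i)"
      by (rule nth_equalityI) (auto simp: vec_length)
    then show ?thesis by (simp add: X_def vec_code_def vec_length)
  qed
  have W_Suc: "W (Suc i) = ((W i @ [0]) @ X i d @ [6]) @ replicate (2 * d) 1 @ [4]" for i
    by (simp add: W_def X_d)
  have length_W: "length (W i) = i * (12 * d + 3)" for i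
    by (induction i) (auto simp: W_Suc length_X, simp add: W_def)
  have W_query: "query_code group_B
      = query_prefix @ W ?g @ [7] @ replicate ?g 1 @ query_suffix"
    by (simp add: query_code_def group W_def)
  have cap': "e 14 + length xs + ?g * (12 * d + 4) + 39 < 2 ^ w"
    using cap(1) length_query_code[of group_B d] length_group_B by (simp add: group_B_def)
  have cap_i: "i * (12 * d + 3) + (12 * d + 3) + ?g \<le> ?g * (12 * d + 4)" if "i < ?g" for i
    using mult_le_mono1[of "Suc i" ?g "12 * d + 3"] that by (simp add: algebra_simps)
  have small: "(?b + i) mod n * d \<le> n * d" "d < 2 ^ w" "\<forall>k < 10. k < (2 :: nat) ^ w" for i
    using inp_small n by (auto simp: mod_less_divisor less_imp_le)
  have prefix: "length query_prefix = 21" "\<forall>k \<in> set query_prefix. k < 2 ^ w"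
    and suffix: "length query_suffix = 17" "\<forall>k \<in> set query_suffix. k < 2 ^ w"
    using small(3) by (auto simp: query_prefix_def query_suffix_def)
  let ?inner = "Block (emit_consts [0, 6, 3, 0, 0, 6, 4]
    @ [Load 23 22, Bin Add 22 22 1, Const 25 7, Bin Sub 25 25 23] @ emit 25 @ emit_consts [1, 3])"
  let ?body = "Block ([Bin Mod 22 21 2, Bin Mul 22 22 3, Bin Add 22 22 11, Bin Add 21 21 1]
      @ emit_consts [0] @ [Move 20 3]) ;;
    Rep 20 ?inner ;; Block (emit_consts [6] @ [Bin Add 20 3 3]) ;;
    Rep 20 (Block (emit_consts [1])) ;; Block (emit_consts [4])"
  let ?T = "8 + ((d * (33 + 3) + 1) + (4 + (((2 * d) * 6 + 1) + 3)))"
  let ?xs = "xs @ query_prefix"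
  define I where "I i r m \<longleftrightarrow> written (?xs @ W i) r m \<and> r 21 = ?b + i" for i r m
  have body: "wp w ?body ?T (\<lambda>r m. I (Suc i) (r(19 := ?g - Suc i)) m \<and> r 19 = ?g - i \<and> r 1 = 1) r m"
    if i: "i < ?g" and I: "I i r m" and r19: "r 19 = ?g - i" for i r m
  proof -
    let ?Q = "\<lambda>r m. I (Suc i) (r(19 := ?g - Suc i)) m \<and> r 19 = ?g - i \<and> r 1 = 1"
    let ?row = "2 + n * d + (?b + i) mod n * d"
    \<comment> \<open>What the inner loops must preserve of the outer one: the vector index and the
      outer counter.\<close>
    define F where "F r \<longleftrightarrow> r 21 = ?b + Suc i \<and> r 19 = ?g - i" for r :: store
    have capi: "e 14 + length (?xs @ W i) + 12 * d + 3 + 18 < 2 ^ w"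
      using cap_i[OF i] cap' prefix by (simp add: length_W)
    have G: "written (?xs @ W i) r m" and r21: "r 21 = ?b + i"
      using I by (auto simp: I_def)
    have regs: "r 1 = 1" "r 2 = n" "r 3 = d" "r 11 = 2 + n * d"
      using writtenD[OF G] e1 en ed e11 by auto
    define I' where "I' k r m \<longleftrightarrow> written ((?xs @ W i @ [0]) @ X i k) r m \<and> F r \<and> r 22 = ?row + k" for k r m
    show ?thesis
    proof (rule wp_SeqI[where R = "\<lambda>r m. I' 0 r m \<and> r 20 = d"])
      let ?r = "r(22 := ?row, 21 := ?b + Suc i)"
      have "block_wp w (emit_consts [0] @ [Move 20 3]) (\<lambda>r m. I' 0 r m \<and> r 20 = d) ?r m"
      proof (rule block_emit_consts)
        show "written (?xs @ W i) ?r m" using G by simp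
        fix r1 m1
        assume G1: "written ((?xs @ W i) @ [0]) r1 m1" and r1: "\<And>y. y \<noteq> 18 \<Longrightarrow> y \<noteq> 25 \<Longrightarrow> r1 y = ?r y"
        have "r1 3 = d" using writtenD[OF G1, of 3] ed by simp
        then show "block_wp w [Move 20 3] (\<lambda>r m. I' 0 r m \<and> r 20 = d) r1 m1"
          using G1 r1 r19 small by (simp add: I'_def F_def X_def)
      qed (use capi in auto)
      moreover have "(?b + i) mod n * d < 2 ^ w" "?row < 2 ^ w" "?b + Suc i < 2 ^ w"
          "(?b + i) mod n < 2 ^ w"
        using small(1)[of i] cap(2) i inp_small n mod_less_divisor[of n "?b + i"] length_inp by linarith+
      ultimately show "wp w (Block ([Bin Mod 22 21 2, Bin Mul 22 22 3, Bin Add 22 22 11, Bin Add 21 21 1]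
          @ emit_consts [0] @ [Move 20 3])) 8 (\<lambda>r m. I' 0 r m \<and> r 20 = d) r m"
        using regs r21 by (intro wp_Block) (simp_all add: add.commute emit_consts_def emit_def)
    next
      fix r m
      assume I'0: "I' 0 r m \<and> r 20 = d"
      show "wp w (Rep 20 ?inner ;; Block (emit_consts [6] @ [Bin Add 20 3 3]) ;;
          Rep 20 (Block (emit_consts [1])) ;; Block (emit_consts [4]))
        ((d * (33 + 3) + 1) + (4 + (((2 * d) * 6 + 1) + 3))) ?Q r m"
      proof (rule wp_SeqI[where R = "\<lambda>r m. I' d r m \<and> r 20 = 0"], rule wp_Rep)
        fix k r m
        assume k: "k < d" and I': "I' k r m" and r20: "r 20 = d - k"
        let ?Q = "\<lambda>r m. I' (Suc k) (r(20 := d - Suc k)) m \<and> r 20 = d - k \<and> r 1 = 1"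
        have G: "written ((?xs @ W i @ [0]) @ X i k) r m" and F: "F r" and r22: "r 22 = ?row + k"
          using I' by (auto simp: I'_def)
        let ?ys = "((?xs @ W i @ [0]) @ X i k) @ [0, 6, 3, 0, 0, 6, 4]"
        have cap_ys: "e 14 + length ?ys + 5 < 2 ^ w"
          using capi k by (simp add: length_X)
        have "block_wp w (emit_consts [0, 6, 3, 0, 0, 6, 4]
          @ [Load 23 22, Bin Add 22 22 1, Const 25 7, Bin Sub 25 25 23] @ emit 25 @ emit_consts [1, 3]) ?Q r m"
        proof (rule block_emit_consts[OF G])
          fix r1 m1
          assume G1: "written ?ys r1 m1" and r1: "\<And>y. y \<noteq> 18 \<Longrightarrow> y \<noteq> 25 \<Longrightarrow> r1 y = r y"
          let ?x = "of_bool (vec i ! k) :: nat"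
          let ?r1 = "r1(23 := ?x, 22 := ?row + k + 1, 25 := 7, 25 := 7 - ?x)"
          have "fixed r1 m1" using G1 by (simp add: written_def)
          then have m1: "m1 (?row + k) = ?x"
            using fixed_B[OF _ mod_less_divisor[OF n] k] by (simp add: vec_def)
          have "block_wp w (emit 25 @ emit_consts [1, 3]) ?Q ?r1 m1"
          proof (rule block_emit)
            show "written ?ys ?r1 m1" using G1 by simp
            fix r2 m2
            assume G2: "written (?ys @ [?r1 25]) r2 m2" and r2: "\<And>y. y \<noteq> 18 \<Longrightarrow> r2 y = ?r1 y"
            show "block_wp w (emit_consts [1, 3]) ?Q r2 m2"
            proof (rule block_emit_consts'[OF G2])
              fix r3 m3
              assume G3: "written ((?ys @ [?r1 25]) @ [1, 3]) r3 m3"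
                and r3: "\<And>y. y \<noteq> 18 \<Longrightarrow> y \<noteq> 25 \<Longrightarrow> r3 y = r2 y"
              have "written ((?xs @ W i @ [0]) @ X i (Suc k)) r3 m3"
                using G3 by (simp add: X_Suc)
              moreover have "r3 1 = 1" using writtenD[OF G3, of 1] e1 by simp
              ultimately show "?Q r3 m3"
                using r3 r2 r1 r20 r22 F by (simp add: I'_def F_def)
            qed (use cap_ys small(3) in auto)
          qed (use cap_ys in auto)
          moreover have "r1 1 = 1" using writtenD[OF G1, of 1] e1 by simp
          moreover have "?row + k + 1 < 2 ^ w"
            using small(1)[of i] k inp_small length_inp by linarith
          moreover have "(7 :: nat) < 2 ^ w" "?x < 2 ^ w" "7 - ?x < 2 ^ w"
            using small(3)[rule_format, of 7] by (auto simp: of_bool_def)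
          ultimately show "block_wp w ([Load 23 22, Bin Add 22 22 1, Const 25 7, Bin Sub 25 25 23]
              @ emit 25 @ emit_consts [1, 3]) ?Q r1 m1"
            using m1 r1 r22 by (simp del: fun_upd_upd)
        qed (use cap_ys small(3) in auto)
        then show "wp w ?inner 33 ?Q r m"
          by (rule wp_Block) (simp add: emit_consts_def emit_def)
      next
        fix r m
        assume I'd: "I' d r m \<and> r 20 = 0"
        let ?zs = "((?xs @ W i @ [0]) @ X i d) @ [6]"
        have cap_zs: "e 14 + length ?zs + 2 * d + 2 < 2 ^ w"
          using capi by (simp add: length_X)
        show "wp w (Block (emit_consts [6] @ [Bin Add 20 3 3]) ;;
          Rep 20 (Block (emit_consts [1])) ;; Block (emit_consts [4])) (4 + (((2 * d) * 6 + 1) + 3)) ?Q r m"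
        proof (rule wp_SeqI[where R = "\<lambda>r m. written ?zs r m \<and> F r \<and> r 20 = 2 * d"])
          have G: "written ((?xs @ W i @ [0]) @ X i d) r m" and F: "F r"
            using I'd by (auto simp: I'_def)
          have "block_wp w (emit_consts [6] @ [Bin Add 20 3 3])
            (\<lambda>r m. written ?zs r m \<and> F r \<and> r 20 = 2 * d) r m"
          proof (rule block_emit_consts[OF G])
            fix r1 m1
            assume G1: "written ?zs r1 m1" and r1: "\<And>y. y \<noteq> 18 \<Longrightarrow> y \<noteq> 25 \<Longrightarrow> r1 y = r y"
            have "r1 3 = d" using writtenD[OF G1, of 3] ed by simp
            moreover have "d + d < 2 ^ w" using cap_zs by simp
            ultimately show "block_wp w [Bin Add 20 3 3] (\<lambda>r m. written ?zs r m \<and> F r \<and> r 20 = 2 * d) r1 m1"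
              using G1 F r1 by (simp add: F_def)
          qed (use cap_zs small(3) in auto)
          then show "wp w (Block (emit_consts [6] @ [Bin Add 20 3 3])) 4
            (\<lambda>r m. written ?zs r m \<and> F r \<and> r 20 = 2 * d) r m"
            by (rule wp_Block) (simp add: emit_consts_def emit_def)
        next
          fix r m
          assume r: "written ?zs r m \<and> F r \<and> r 20 = 2 * d"
          show "wp w (Rep 20 (Block (emit_consts [1])) ;; Block (emit_consts [4])) (((2 * d) * 6 + 1) + 3) ?Q r m"
          proof (rule wp_SeqI, rule wp_emit_replicate[where F = F])
            show "F r'" if "F r" "\<And>y. y \<noteq> 18 \<Longrightarrow> y \<noteq> 25 \<Longrightarrow> y \<noteq> 20 \<Longrightarrow> r' y = r y" for r r'
              using that by (simp add: F_def)
            fix r m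
            assume r: "written (?zs @ replicate (2 * d) 1) r m \<and> F r"
            then have G: "written (?zs @ replicate (2 * d) 1) r m" and F: "F r" by auto
            have "block_wp w (emit_consts [4]) ?Q r m"
            proof (rule block_emit_consts'[OF G])
              fix r1 m1
              assume G1: "written ((?zs @ replicate (2 * d) 1) @ [4]) r1 m1"
                and r1: "\<And>y. y \<noteq> 18 \<Longrightarrow> y \<noteq> 25 \<Longrightarrow> r1 y = r y"
              have "r1 1 = 1" using writtenD[OF G1, of 1] e1 by simp
              moreover have "written (?xs @ W (Suc i)) r1 m1"
                using G1 by (simp add: W_Suc)
              ultimately show "?Q r1 m1"
                using r1 F by (simp add: I_def F_def)
            qed (use cap_zs small(3) in auto)
            then show "wp w (Block (emit_consts [4])) 3 ?Q r m"
              by (rule wp_Block) (simp add: emit_consts_def emit_def)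
          qed (use r cap_zs small in auto)
        qed
      qed (use I'0 small in auto)
    qed
  qed
  have cap_W: "e 14 + length (?xs @ W ?g) + ?g + 18 < 2 ^ w"
    using cap' prefix by (simp add: length_W algebra_simps)
  have "wp w query_pass (65 + ((?g * (?T + 3) + 1) + (4 + ((?g * 6 + 1) + 51))))
    (written (xs @ query_code group_B)) r m"
    unfolding query_pass_def
  proof (rule wp_SeqI[where R = "\<lambda>r m. I 0 r m \<and> r 19 = ?g"])
    have "block_wp w (emit_consts query_prefix @ [Move 21 16, Move 19 5])
      (\<lambda>r m. I 0 r m \<and> r 19 = ?g) r m"
    proof (rule block_emit_consts[OF G])
      fix r1 m1
      assume G1: "written (xs @ query_prefix) r1 m1"
      have "r1 16 = ?b" "r1 5 = ?g" using writtenD[OF G1] by auto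
      then show "block_wp w [Move 21 16, Move 19 5] (\<lambda>r m. I 0 r m \<and> r 19 = ?g) r1 m1"
        using G1 cap by (simp add: I_def W_def)
    qed (use cap_W prefix in auto)
    then show "wp w (Block (emit_consts query_prefix @ [Move 21 16, Move 19 5])) 65
      (\<lambda>r m. I 0 r m \<and> r 19 = ?g) r m"
      by (rule wp_Block) (simp add: emit_consts_def emit_def query_prefix_def)
  next
    fix r m
    assume r: "I 0 r m \<and> r 19 = ?g"
    show "wp w (Rep 19 ?body ;; Block (emit_consts [7] @ [Move 19 5]) ;; Rep 19 (Block (emit_consts [1])) ;;
        Block (emit_consts query_suffix)) ((?g * (?T + 3) + 1) + (4 + ((?g * 6 + 1) + 51)))
      (written (xs @ query_code group_B)) r m"
    proof (rule wp_SeqI[where R = "\<lambda>r m. I ?g r m \<and> r 19 = 0"], rule wp_Rep, rule body)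
      fix r m
      assume "I ?g r m \<and> r 19 = 0"
      then have G: "written (?xs @ W ?g) r m" by (simp add: I_def)
      let ?zs = "(?xs @ W ?g) @ [7]"
      show "wp w (Block (emit_consts [7] @ [Move 19 5]) ;; Rep 19 (Block (emit_consts [1])) ;;
          Block (emit_consts query_suffix)) (4 + ((?g * 6 + 1) + 51))
        (written (xs @ query_code group_B)) r m"
      proof (rule wp_SeqI[where R = "\<lambda>r m. written ?zs r m \<and> r 19 = ?g"])
        have "block_wp w (emit_consts [7] @ [Move 19 5]) (\<lambda>r m. written ?zs r m \<and> r 19 = ?g) r m"
        proof (rule block_emit_consts[OF G])
          fix r1 m1
          assume G1: "written ?zs r1 m1"
          have "r1 5 = ?g" using writtenD[OF G1, of 5] by simp
          then show "block_wp w [Move 19 5] (\<lambda>r m. written ?zs r m \<and> r 19 = ?g) r1 m1"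
            using G1 cap by simp
        qed (use cap_W small in auto)
        then show "wp w (Block (emit_consts [7] @ [Move 19 5])) 4 (\<lambda>r m. written ?zs r m \<and> r 19 = ?g) r m"
          by (rule wp_Block) (simp add: emit_consts_def emit_def)
        fix r m
        assume r: "written ?zs r m \<and> r 19 = ?g"
        show "wp w (Rep 19 (Block (emit_consts [1])) ;; Block (emit_consts query_suffix))
          ((?g * 6 + 1) + 51) (written (xs @ query_code group_B)) r m"
        proof (rule wp_SeqI, rule wp_emit_replicate[where F = "\<lambda>_. True"])
          fix r m
          assume "written (?zs @ replicate ?g 1) r m \<and> True"
          then have G: "written (?zs @ replicate ?g 1) r m" by simp
          have "block_wp w (emit_consts query_suffix) (written (xs @ query_code group_B)) r m"
            by (rule block_emit_consts'[OF G]) (use cap_W suffix in \<open>auto simp: W_query\<close>)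
          then show "wp w (Block (emit_consts query_suffix)) 51 (written (xs @ query_code group_B)) r m"
            by (rule wp_Block) (simp add: emit_consts_def emit_def query_suffix_def)
        qed (use r cap_W small in auto)
      qed
    qed (use r cap in auto)
  qed
  then show ?thesis
    by (rule wp_mono) (auto simp: algebra_simps)
qed

text \<open>The factor \<open>4 * \<sigma> + 25\<close> comes from the length of the code for one edge, at most \<open>4 * \<sigma> + 20\<close>.\<close>

lemma wp_write_instance:
  fixes \<sigma> V :: nat and pair :: bool
  defines "ws \<equiv> word group_A"
  defines "D \<equiv> line \<sigma> V ws" and "q \<equiv> query group_B"
  defines "code \<equiv> rpq_code D q @ (if pair then [0, length ws] else [])"
  assumes \<sigma>: "2 \<le> \<sigma>" and V: "length ws < V"
    and e: "e 6 = V" "e 7 = (V - length ws) * \<sigma>" "e 8 = 1 + V * \<sigma>"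
      "e 10 = length (adj_code D)" "e 12 = regex_size q" "e 13 = length ws"
    and cap: "e 14 + e 10 + e 12 + 4 < 2 ^ w" "e 15 + e 4 < 2 ^ w" "e 16 + e 5 < 2 ^ w"
    and m: "\<forall>x < 18. r x = e x" "\<forall>i < length inp. m i = inp ! i" "\<forall>i \<ge> e 14. m i = 0"
  shows "length code \<le> e 10 + e 12 + 4"
    "wp w (write_instance \<sigma> pair)
      (200 + 2 * (e 4 * ((2 * d + 3) * (4 * \<sigma> + 25))) + e 7 * 12 + e 5 * (7 * (12 * d + 4)))
      (written code) r m"
proof -
  let ?L = "length ws"
  have L: "?L = e 4 * (2 * d + 3)"
    using length_word[of group_A d] length_group_A by (simp add: ws_def group_A_def)
  have set_ws: "set ws \<subseteq> {..<\<sigma>}"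
    using set_word[of group_A] \<sigma> by (auto simp: ws_def)
  have adj: "adj_code D = V # table_code \<sigma> (e 8) ws @ map (\<lambda>i. e 8 + ?L * Suc \<sigma> + i) [0..<e 7]
      @ list_code \<sigma> ws @ replicate (e 7) 0"
    unfolding D_def using adj_code_line[OF set_ws V] e by simp
  \<comment> \<open>The \<open>V * \<sigma>\<close> lists, split into those of the padding and those
    of the nodes with an outgoing arc.\<close>
  have VL: "V * \<sigma> = e 7 + ?L * \<sigma>"
    using V e by (simp add: diff_mult_distrib)
  have e10: "e 10 = 1 + 2 * (V * \<sigma>) + ?L"
    unfolding e(4) adj using VL by (simp add: length_table_code length_list_code[OF set_ws])
  have e12: "e 12 = length (query_code group_B)"
    by (metis e(5) length_map q_def regex_size_def regex_string_query)
  have code: "code = [e 10] @ adj_code D @ [e 12] @ query_code group_B @ (if pair then [0, ?L] else [])"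
    unfolding code_def rpq_code_def block_def e(4) e12 by (simp add: q_def regex_string_query)
  show "length code \<le> e 10 + e 12 + 4"
    unfolding code using e(4) e12 by simp
  have V\<sigma>: "V \<le> V * \<sigma>" "\<sigma> \<le> V * \<sigma>"
    using \<sigma> V by auto
  \<comment> \<open>The cells present after each phase of \<open>write_instance\<close>.\<close>
  define xs1 where "xs1 = [e 10, e 6]"
  define xs2 where "xs2 = xs1 @ table_code \<sigma> (e 8) ws"
  define xs3 where "xs3 = xs2 @ map (\<lambda>i. e 8 + ?L * Suc \<sigma> + i) [0..<e 7]"
  define xs4 where "xs4 = xs3 @ list_code \<sigma> ws"
  define xs5 where "xs5 = xs4 @ replicate (e 7) 0"
  define xs6 where "xs6 = xs5 @ [e 12]"
  define xs7 where "xs7 = xs6 @ query_code group_B"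
  have lens: "length xs1 = 2" "length xs2 = 2 + ?L * \<sigma>" "length xs3 = 2 + V * \<sigma>"
      "length xs4 = 2 + V * \<sigma> + ?L * Suc \<sigma>" "length xs5 = 1 + e 10" "length xs6 = 2 + e 10"
      "length xs7 = 2 + e 10 + e 12"
    using VL by (simp_all add: xs1_def xs2_def xs3_def xs4_def xs5_def xs6_def xs7_def e10 e12
      length_table_code length_list_code[OF set_ws])
  have code7: "code = xs7 @ (if pair then [0, ?L] else [])"
    by (simp add: code adj xs1_def xs2_def xs3_def xs4_def xs5_def xs6_def xs7_def e(1))
  have capL: "?L * Suc \<sigma> = ?L + ?L * \<sigma>"
    by simp
  have len_edge: "length (edge_table \<sigma>) \<le> 4 * \<sigma> + 20" "length (edge_list \<sigma>) \<le> 4 * \<sigma> + 20"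
  proof -
    have "length (concat (map (\<lambda>a. [Const 26 (Suc a), Bin Add 25 24 26] @ emit 25) as)) = 4 * length as"
      for as by (induction as) (auto simp: emit_def)
    moreover have "length (emit_consts ks) = 3 * length ks" for ks
      by (induction ks) (auto simp: emit_consts_def emit_def)
    ultimately show "length (edge_table \<sigma>) \<le> 4 * \<sigma> + 20" "length (edge_list \<sigma>) \<le> 4 * \<sigma> + 20"
      by (auto simp: edge_table_def edge_list_def emit_def)
  qed
  define TW where "TW = 3 + e 4 * ((2 * d + 3) * (4 * \<sigma> + 25))"
  have TW: "3 + e 4 * ((2 * d + 3) * (length E + 5)) \<le> TW" if "length E \<le> 4 * \<sigma> + 20" for E :: "instr list"
    unfolding TW_def using that by (intro add_left_mono mult_le_mono2) simp
  let ?J1 = "\<lambda>ws r m. written (xs1 @ table_code \<sigma> (e 8) ws) r m \<and> r 24 = e 8 + length ws * Suc \<sigma>"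
  let ?J2 = "\<lambda>ws r m. written (xs3 @ list_code \<sigma> ws) r m \<and> r 24 = Suc (length ws)"
  have inv1: "edge_inv ?J1" and inv2: "edge_inv ?J2"
    by (rule edge_inv_table[where xs = xs1 and p = "e 8" and \<sigma> = \<sigma>],
      rule edge_inv_list[where xs = xs3 and \<sigma> = \<sigma>])
  have "wp w (write_instance \<sigma> pair)
    (6 + (TW + ((e 7 * 6 + 2) + (1 + (TW + ((e 7 * 6 + 2) + (2 + ((122 + e 5 * (7 * (12 * d + 4))) + 5))))))))
    (written code) r m"
    unfolding write_instance_def
  proof (rule wp_SeqI[where R = "?J1 []"])
    have regs: "r 14 = e 14" "r 10 = e 10" "r 6 = e 6" "r 8 = e 8"
      using m by auto
    have "block_wp w (emit 10 @ emit 6 @ [Move 24 8]) (?J1 []) (r(18 := e 14)) m"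
    proof (rule block_emit[where xs = "[]"])
      show "written [] (r(18 := e 14)) m"
        using m by (auto simp: written_def fixed_def)
      fix r1 m1
      assume G1: "written ([] @ [(r(18 := e 14)) 10]) r1 m1"
      show "block_wp w (emit 6 @ [Move 24 8]) (?J1 []) r1 m1"
      proof (rule block_emit[OF G1])
        fix r2 m2
        assume G2: "written (([] @ [(r(18 := e 14)) 10]) @ [r1 6]) r2 m2"
        have "r1 6 = e 6" "r2 8 = e 8"
          using writtenD[OF G1, of 6] writtenD[OF G2, of 8] by auto
        moreover have "e 8 < 2 ^ w"
          using cap e10 e(3) by simp
        ultimately show "block_wp w [Move 24 8] (?J1 []) r2 m2"
          using G2 regs by (simp add: xs1_def table_code_def)
      qed (use cap in auto)
    qed (use cap in auto)
    then show "wp w (Block ([Move 18 14] @ emit 10 @ emit 6 @ [Move 24 8])) 6 (?J1 []) r m"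
      using regs cap by (intro wp_Block) (simp_all add: emit_def del: fun_upd_apply)
  next
    fix r m
    assume J1: "?J1 [] r m"
    show "wp w (word_pass (edge_table \<sigma>) ;; pad_table ;; Block [Move 24 1] ;; word_pass (edge_list \<sigma>) ;;
        pad_list ;; Block (emit 12) ;; query_pass ;; Block (if pair then emit_consts [0] @ emit 13 else []))
      (TW + ((e 7 * 6 + 2) + (1 + (TW + ((e 7 * 6 + 2) + (2 + ((122 + e 5 * (7 * (12 * d + 4))) + 5)))))))
      (written code) r m"
    proof (rule wp_SeqI)
      have W1: "writes_edge ?J1 (edge_table \<sigma>) (e 4 * (2 * d + 3))"
        unfolding L[symmetric] using cap e10 e(3) capL VL lens V V\<sigma> by (intro writes_edge_table \<sigma>) linarith+
      have wp1: "wp w (word_pass (edge_table \<sigma>)) (3 + e 4 * ((2 * d + 3) * (length (edge_table \<sigma>) + 5)))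
          (?J1 (word group_A)) r m"
        by (rule wp_word_pass[where J = ?J1, OF inv1 W1 J1 cap(2)])
      show "wp w (word_pass (edge_table \<sigma>)) TW (?J1 ws) r m"
        unfolding ws_def by (rule wp_mono[OF wp1 TW[OF len_edge(1)]])
    next
      fix r m
      assume J: "?J1 ws r m"
      then have G: "written xs2 r m" and r24: "r 24 = e 8 + ?L * Suc \<sigma>"
        by (auto simp: xs2_def)
      show "wp w (pad_table ;; Block [Move 24 1] ;; word_pass (edge_list \<sigma>) ;;
          pad_list ;; Block (emit 12) ;; query_pass ;; Block (if pair then emit_consts [0] @ emit 13 else []))
        ((e 7 * 6 + 2) + (1 + (TW + ((e 7 * 6 + 2) + (2 + ((122 + e 5 * (7 * (12 * d + 4))) + 5))))))
        (written code) r m"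
      proof (rule wp_SeqI)
        show "wp w pad_table (e 7 * 6 + 2) (written xs3) r m"
          unfolding xs3_def using cap e10 e(3) capL VL lens V V\<sigma>
          by (intro wp_pad_table[OF G r24]) linarith+
      next
        fix r m
        assume G: "written xs3 r m"
        show "wp w (Block [Move 24 1] ;; word_pass (edge_list \<sigma>) ;;
            pad_list ;; Block (emit 12) ;; query_pass ;; Block (if pair then emit_consts [0] @ emit 13 else []))
          (1 + (TW + ((e 7 * 6 + 2) + (2 + ((122 + e 5 * (7 * (12 * d + 4))) + 5)))))
          (written code) r m"
        proof (rule wp_SeqI[where R = "?J2 []"])
          show "wp w (Block [Move 24 1]) 1 (?J2 []) r m"
            using G writtenD[OF G, of 1] e1 cap by (intro wp_Block) (auto simp: list_code_def)
        next
          fix r m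
          assume J2: "?J2 [] r m"
          show "wp w (word_pass (edge_list \<sigma>) ;; pad_list ;; Block (emit 12) ;; query_pass ;;
              Block (if pair then emit_consts [0] @ emit 13 else []))
            (TW + ((e 7 * 6 + 2) + (2 + ((122 + e 5 * (7 * (12 * d + 4))) + 5))))
            (written code) r m"
          proof (rule wp_SeqI)
            have W2: "writes_edge ?J2 (edge_list \<sigma>) (e 4 * (2 * d + 3))"
              unfolding L[symmetric] using cap e10 e(3) capL VL lens V V\<sigma>
              by (intro writes_edge_list \<sigma>) linarith+
            have wp2: "wp w (word_pass (edge_list \<sigma>)) (3 + e 4 * ((2 * d + 3) * (length (edge_list \<sigma>) + 5)))
                (?J2 (word group_A)) r m"
              by (rule wp_word_pass[where J = ?J2, OF inv2 W2 J2 cap(2)])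
            show "wp w (word_pass (edge_list \<sigma>)) TW (?J2 ws) r m"
              unfolding ws_def by (rule wp_mono[OF wp2 TW[OF len_edge(2)]])
          next
            fix r m
            assume J: "?J2 ws r m"
            then have G: "written xs4 r m"
              by (auto simp: xs4_def)
            show "wp w (pad_list ;; Block (emit 12) ;; query_pass ;;
                Block (if pair then emit_consts [0] @ emit 13 else []))
              ((e 7 * 6 + 2) + (2 + ((122 + e 5 * (7 * (12 * d + 4))) + 5)))
              (written code) r m"
            proof (rule wp_SeqI)
              have "e 14 + length xs4 + e 7 < 2 ^ w"
                using cap lens e10 VL by simp
              from wp_pad_list[OF G this] show "wp w pad_list (e 7 * 6 + 2) (written xs5) r m"
                by (simp add: xs5_def)
            next
              fix r m
              assume G: "written xs5 r m"
              show "wp w (Block (emit 12) ;; query_pass ;;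
                  Block (if pair then emit_consts [0] @ emit 13 else []))
                (2 + ((122 + e 5 * (7 * (12 * d + 4))) + 5)) (written code) r m"
              proof (rule wp_SeqI)
                have "block_wp w (emit 12) (written xs6) r m"
                  by (rule block_emit'[OF G]) (use cap lens writtenD[OF G, of 12] in \<open>auto simp: xs6_def\<close>)
                then show "wp w (Block (emit 12)) 2 (written xs6) r m"
                  by (rule wp_Block) (simp add: emit_def)
              next
                fix r m
                assume G: "written xs6 r m"
                show "wp w (query_pass ;; Block (if pair then emit_consts [0] @ emit 13 else []))
                  ((122 + e 5 * (7 * (12 * d + 4))) + 5) (written code) r m"
                proof (rule wp_SeqI)
                  show "wp w query_pass (122 + e 5 * (7 * (12 * d + 4))) (written xs7) r m"
                    unfolding xs7_def by (rule wp_query_pass[OF G _ cap(3)]) (use cap lens e12 in auto)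
                next
                  fix r m
                  assume G: "written xs7 r m"
                  show "wp w (Block (if pair then emit_consts [0] @ emit 13 else [])) 5 (written code) r m"
                  proof (cases pair)
                    case True
                    have "block_wp w (emit_consts [0] @ emit 13) (written code) r m"
                    proof (rule block_emit_consts[OF G])
                      fix r1 m1
                      assume G1: "written (xs7 @ [0]) r1 m1"
                      show "block_wp w (emit 13) (written code) r1 m1"
                        by (rule block_emit'[OF G1])
                          (use cap lens True writtenD[OF G1, of 13] e(6) in \<open>auto simp: code7\<close>)
                    qed (use cap lens in auto)
                    then show ?thesis
                      using True by (intro wp_Block) (simp_all add: emit_def emit_consts_def)
                  next
                    case False
                    then show ?thesis
                      using G by (intro wp_Block) (simp_all add: code7)
                  qed
                qed
              qed
            qed
          qed
        qed
      qed
    qed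
  qed
  then show "wp w (write_instance \<sigma> pair)
      (200 + 2 * (e 4 * ((2 * d + 3) * (4 * \<sigma> + 25))) + e 7 * 12 + e 5 * (7 * (12 * d + 4)))
      (written code) r m"
    by (rule wp_mono) (auto simp: TW_def)
qed

end


section \<open>The reduction\<close>

text \<open>Only the registers need clearing before a run, as the region is blank. \<open>Or\<close>
  accumulates the answers. For the set used as a whole the start index advances by \<open>n\<close>,
  which has no effect modulo \<open>n\<close>.\<close>

definition simulate :: "program \<Rightarrow> com" where
  "simulate P = Block (map (\<lambda>x. Const (x + 30) 0) [0..<reg_bound P]) ;; Sim P ;;
     Block [Bin Or 0 0 30, Bin Add 14 14 9, Bin Add 15 15 4, Bin Add 16 16 5]"

text \<open>Register 17 is doubled as long as \<open>n\<close> can be shifted by another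
  \<open>k\<close> bits without vanishing; this computes a \<open>k\<close>-th root of
  \<open>n\<close> up to a factor 2 with plain integer operations.\<close>

definition setup_runs :: "nat \<Rightarrow> com" where
  "setup_runs k = Block [Const 1 1, Load 2 0, Load 3 1, Const 17 1, Const 25 (2 ^ k), Bin Div 26 2 25] ;;
     Loop 26 (Block [Bin Add 17 17 17, Bin Div 26 26 25])"

text \<open>All sizes come from closed formulas, since every run has the same shape. The power with
  exponent \<open>c\<close> needs no loop, \<open>c\<close> being a constant of the program.\<close>

definition setup_sizes :: "nat \<Rightarrow> nat \<Rightarrow> nat \<Rightarrow> bool \<Rightarrow> com" where
  "setup_sizes \<sigma> K c large_A = Block ([Bin Div 27 2 17, Bin Add 27 27 1,
       Move 4 (if large_A then 2 else 27), Move 5 (if large_A then 27 else 2),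
       Const 25 3, Bin Add 26 3 3, Bin Add 26 26 25, Bin Mul 13 4 26, Bin Add 6 13 1, Const 25 K,
       Bin Mul 6 6 25, Const 25 \<sigma>, Bin Mul 26 6 25, Bin Add 8 26 1, Bin Sub 7 6 13, Bin Mul 7 7 25,
       Bin Add 10 8 26, Bin Add 10 10 13, Bin Mul 25 2 3, Const 26 2, Bin Add 11 26 25,
       Bin Add 9 11 25, Const 26 12, Bin Mul 12 3 26, Const 26 4, Bin Add 12 12 26, Bin Mul 12 12 5,
       Const 26 39, Bin Add 12 12 26, Bin Add 24 10 12, Const 26 6, Bin Add 24 24 26, Bin Add 9 9 24,
       Bin Add 24 24 24, Const 25 1] @ replicate c (Bin Mul 25 25 24) @ [Bin Add 9 9 25, Move 14 9])"

definition ov_program :: "nat \<Rightarrow> nat \<Rightarrow> nat \<Rightarrow> nat \<Rightarrow> bool \<Rightarrow> bool \<Rightarrow> program \<Rightarrow> com" where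
  "ov_program \<sigma> K c k large_A pair P =
     setup_runs k ;; setup_sizes \<sigma> K c large_A ;; Rep 17 (write_instance \<sigma> pair ;; simulate P)"

definition cyclic :: "'a list \<Rightarrow> nat \<Rightarrow> nat \<Rightarrow> 'a list" where
  "cyclic xs s g = map (\<lambda>i. xs ! ((s + i) mod length xs)) [0..<g]"

lemma length_cyclic [simp]: "length (cyclic xs s g) = g"
  by (simp add: cyclic_def)

lemma set_cyclic_subset: "xs \<noteq> [] \<Longrightarrow> set (cyclic xs s g) \<subseteq> set xs"
  by (auto simp: cyclic_def)

text \<open>There are about \<open>n powr (1 / k)\<close> runs. In run \<open>t\<close>, one of the sets is used as a whole, and
  the vectors from index \<open>t * part_size\<close> on are taken from the other one; indices are reduced
  modulo \<open>n\<close>, so that all runs have the same size.\<close>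

locale reduction =
  fixes \<sigma> K c k :: nat and large_A :: bool and A B :: "bool list list" and n d :: nat
  assumes \<sigma>: "2 \<le> \<sigma>" and K: "1 \<le> K" and k: "1 \<le> k" and n: "0 < n"
    and A: "length A = n" "\<forall>a \<in> set A. length a = d"
    and B: "length B = n" "\<forall>b \<in> set B. length b = d"
begin

definition steps :: nat where "steps = (LEAST j. n div (2 ^ k) ^ Suc j = 0)"
definition runs :: nat where "runs = 2 ^ steps"
text \<open>Adding 1 to the rounded quotient makes \<open>runs\<close> parts cover all
  \<open>n\<close> indices.\<close>

definition part_size :: nat where "part_size = n div runs + 1"
definition size_A :: nat where "size_A = (if large_A then n else part_size)"
definition size_B :: nat where "size_B = (if large_A then part_size else n)"
definition len :: nat where "len = size_A * (2 * d + 3)"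
text \<open>\<open>K\<close> will be at least the inverse of the sparseness constant, so that
  \<open>len\<close> arcs are few enough for this number of nodes.\<close>

definition db :: nat where "db = (len + 1) * K"
definition db_len :: nat where "db_len = 1 + 2 * (db * \<sigma>) + len"
definition query_len :: nat where "query_len = (12 * d + 4) * size_B + 39"
text \<open>The 6 covers the two length cells of the blocks, the optional node pair, and the 2 that
  is added to the input length in the definition of the word size.\<close>

definition input_len :: nat where "input_len = db_len + query_len + 6"
text \<open>The power exceeds every address of the simulated program: for input length plus two
  equal to \<open>y\<close>, its \<open>c * ceillog2 y\<close> bits give fewer than
  \<open>(2 * y) ^ c\<close> or, for \<open>c = 0\<close>, exactly one address. The other summands
  make room for the original input, which occupies the region at address 0, and for the written
  instance.\<close>

definition region :: nat where "region = 2 + n * d + n * d + input_len + (2 * input_len) ^ c"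
definition inp :: "nat list" where "inp = [n, d] @ map of_bool (concat A) @ map of_bool (concat B)"
definition run_A :: "nat \<Rightarrow> bool list list" where "run_A t = cyclic A (t * size_A) size_A"
definition run_B :: "nat \<Rightarrow> bool list list" where "run_B t = cyclic B (t * size_B) size_B"
definition graph :: "nat \<Rightarrow> adj_lists" where "graph t = line \<sigma> db (word (run_A t))"
definition code :: "bool \<Rightarrow> nat \<Rightarrow> nat list" where
  "code pair t = rpq_code (graph t) (query (run_B t)) @ (if pair then [0, len] else [])"
definition found :: "nat \<Rightarrow> bool" where
  "found t \<longleftrightarrow> (\<exists>a \<in> set (run_A t). \<exists>b \<in> set (run_B t). orthogonal_vecs a b)"

lemma steps: "n div (2 ^ k) ^ Suc steps = 0" "i < steps \<Longrightarrow> n div (2 ^ k) ^ Suc i \<noteq> 0"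
proof -
  have "n < 2 ^ n" by (rule less_exp)
  also have "\<dots> \<le> (2 ^ k) ^ Suc n"
  proof -
    have "n \<le> k * Suc n"
      using k by (cases k) auto
    then show ?thesis
      by (simp only: power_mult[symmetric] power_increasing one_le_numeral)
  qed
  finally have "n div (2 ^ k) ^ Suc n = 0" by simp
  then show "n div (2 ^ k) ^ Suc steps = 0"
    unfolding steps_def by (rule LeastI)
  show "i < steps \<Longrightarrow> n div (2 ^ k) ^ Suc i \<noteq> 0"
    unfolding steps_def by (rule not_less_Least)
qed

lemma power_le: "i \<le> steps \<Longrightarrow> (2 ^ k) ^ i \<le> n"
proof (cases i)
  case (Suc j)
  assume "i \<le> steps"
  then show ?thesis
    using steps(2)[of j] Suc by (metis Suc_le_lessD div_less not_le)
qed (use n in simp)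

text \<open>With the next lemma: \<open>runs\<close> is the \<open>k\<close>-th root of
  \<open>n\<close> up to a factor 2.\<close>

lemma runs_power_le: "runs ^ k \<le> n"
  using power_le[of steps] by (simp add: runs_def mult.commute flip: power_mult)

lemma less_runs_power: "n < (2 * runs) ^ k"
proof -
  have "(2 ^ k) ^ Suc steps = (2 * runs) ^ k"
    by (simp add: runs_def mult.commute power_mult_distrib flip: power_mult)
  moreover have "n < (2 ^ k) ^ Suc steps"
    using steps(1) by (simp add: div_eq_0_iff del: power_Suc)
  ultimately show ?thesis by simp
qed

lemma power_less_n: "i \<le> steps \<Longrightarrow> 2 ^ i \<le> n"
  using power_le[of i] k by (metis dual_order.trans le_add_same_cancel1 one_le_numeral power_increasing
      power_mult mult.commute mult_le_mono2 mult_1_right zero_le)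

lemma runs: "1 \<le> runs" "runs \<le> n" "steps < runs"
  using power_less_n[of steps] by (auto simp: runs_def)

lemma n_less: "n < runs * part_size"
  using runs(1) by (simp add: part_size_def dividend_less_times_div)

lemma part_size_pos: "1 \<le> part_size" by (simp add: part_size_def)

text \<open>An orthogonal pair is found in the run whose part contains the vector from the divided
  set. The wrap-around only repeats vectors of the same set and so creates no false answers.\<close>

lemma found_iff: "(\<exists>t < runs. found t) \<longleftrightarrow> (\<exists>a \<in> set A. \<exists>b \<in> set B. orthogonal_vecs a b)"
proof
  assume "\<exists>t < runs. found t"
  then show "\<exists>a \<in> set A. \<exists>b \<in> set B. orthogonal_vecs a b"
    using set_cyclic_subset[of A] set_cyclic_subset[of B] A(1) B(1) n
    unfolding found_def run_A_def run_B_def by fastforce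
next
  assume "\<exists>a \<in> set A. \<exists>b \<in> set B. orthogonal_vecs a b"
  then obtain i j where ij: "i < n" "j < n" "orthogonal_vecs (A ! i) (B ! j)"
    using A(1) B(1) by (metis in_set_conv_nth)
  have all: "x \<in> set (cyclic xs (t * n) n)" if "x = xs ! i" "i < n" "length xs = n" for x i t and xs :: "bool list list"
    using that by (auto simp: cyclic_def)
  have part: "xs ! i \<in> set (cyclic xs (i div part_size * part_size) part_size)" if "i < n" "length xs = n"
    for i and xs :: "bool list list"
    unfolding cyclic_def set_map
  proof (rule image_eqI)
    have "i div part_size * part_size + i mod part_size = i"
      by (rule div_mult_mod_eq)
    then show "xs ! i = xs ! ((i div part_size * part_size + i mod part_size) mod length xs)"
      using that by (simp only: mod_less)
  qed (use part_size_pos in simp)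
  have less: "i div part_size < runs" if "i < n" for i
    using that n_less part_size_pos by (simp add: less_mult_imp_div_less)
  have "found (if large_A then j div part_size else i div part_size)"
    using ij all[OF HOL.refl, of i A] all[OF HOL.refl, of j B] part[of i A] part[of j B] A(1) B(1)
    unfolding found_def run_A_def run_B_def size_A_def size_B_def by (auto split: if_splits)
  then show "\<exists>t < runs. found t"
    using less ij by (metis (full_types))
qed

lemma run_lengths: "\<forall>a \<in> set (run_A t). length a = d" "\<forall>b \<in> set (run_B t). length b = d"
  using A B set_cyclic_subset[of A] set_cyclic_subset[of B] n
  unfolding run_A_def run_B_def by fastforce+

lemma length_word_run: "length (word (run_A t)) = len"
  using length_word[OF run_lengths(1), of t] by (simp add: run_A_def len_def)

lemma len_less: "len < db"
  using K mult_le_mono2[of 1 K "len + 1"] by (simp add: db_def)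

lemma graph_letters: "set (word (run_A t)) \<subseteq> {..<\<sigma>}"
  using set_word[of "run_A t"] \<sigma> by auto

lemma length_adj_code: "length (adj_code (graph t)) = db_len"
proof -
  have "db * \<sigma> = (db - len) * \<sigma> + len * \<sigma>"
    using len_less by (simp add: diff_mult_distrib)
  then show ?thesis
    using adj_code_line[OF graph_letters, of t db] len_less
    by (simp add: graph_def length_word_run length_table_code length_list_code[OF graph_letters] db_len_def)
qed

lemma regex_size_query: "regex_size (query (run_B t)) = query_len"
proof -
  have "regex_size (query (run_B t)) = length (query_code (run_B t))"
    by (simp add: regex_size_def flip: regex_string_query)
  then show ?thesis
    using length_query_code[OF run_lengths(2), of t] by (simp add: run_B_def query_len_def mult.commute)
qed

lemma length_code: "length (code pair t) + 2 \<le> input_len"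
  using regex_size_query[of t]
  by (simp add: code_def rpq_code_def block_def length_adj_code input_len_def regex_size_def)

text \<open>Collected so that word size conditions on intermediate values reduce to comparisons with
  \<open>input_len\<close> or \<open>region\<close>.\<close>

lemma bounds: "n \<le> input_len" "part_size \<le> input_len" "size_A \<le> input_len" "size_B \<le> input_len" "2 * d + 3 \<le> input_len"
  "len \<le> input_len" "K \<le> input_len" "db \<le> input_len" "\<sigma> \<le> input_len" "db * \<sigma> + 1 \<le> input_len" "(db - len) * \<sigma> \<le> input_len"
  "db_len \<le> input_len" "query_len \<le> input_len" "12 * d + 4 \<le> input_len" "39 \<le> input_len" "input_len \<le> region"
  "2 + n * d + n * d \<le> region" "2 * input_len \<le> region \<or> c = 0"
proof -
  have pos: "1 \<le> size_A" "1 \<le> size_B"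
    using n part_size_pos by (auto simp: size_A_def size_B_def)
  have "size_A * 1 \<le> len" "1 * (2 * d + 3) \<le> len"
    unfolding len_def using pos by (intro mult_le_mono; simp)+
  then have "size_A \<le> len" "2 * d + 3 \<le> len"
    by simp_all
  moreover have "4 * size_B \<le> query_len"
    by (simp add: query_len_def add_mult_distrib)
  moreover have "12 * d + 43 \<le> query_len"
    using pos(2) by (cases size_B) (auto simp: query_len_def)
  moreover have "db \<le> db * \<sigma>" "\<sigma> \<le> db * \<sigma>" "K \<le> db"
    using \<sigma> len_less by (auto simp: db_def)
  moreover have "(db - len) * \<sigma> \<le> db * \<sigma>"
    by (intro mult_le_mono1) simp
  moreover have "query_len + db_len + 6 = input_len"
    by (simp add: input_len_def)
  moreover have "db_len = 1 + 2 * (db * \<sigma>) + len"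
    by (simp add: db_len_def)
  moreover have "39 \<le> query_len"
    by (simp add: query_len_def)
  moreover have "n = size_A \<or> n = size_B" "part_size = size_A \<or> part_size = size_B"
    by (auto simp: size_A_def size_B_def)
  ultimately show "n \<le> input_len" "part_size \<le> input_len" "size_A \<le> input_len" "size_B \<le> input_len" "2 * d + 3 \<le> input_len"
    "len \<le> input_len" "K \<le> input_len" "db \<le> input_len" "\<sigma> \<le> input_len" "db * \<sigma> + 1 \<le> input_len" "(db - len) * \<sigma> \<le> input_len"
    "db_len \<le> input_len" "query_len \<le> input_len" "12 * d + 4 \<le> input_len" "39 \<le> input_len"
    by linarith+
  show "input_len \<le> region" "2 + n * d + n * d \<le> region" by (simp_all add: region_def)
  have "2 * input_len \<le> (2 * input_len) ^ c" if "c \<noteq> 0"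
    using that by (cases c) (auto simp: input_len_def)
  then show "2 * input_len \<le> region \<or> c = 0" by (auto simp: region_def)
qed

end

section \<open>Correctness of the complete program\<close>

text \<open>The last region ends at \<open>(runs + 1) * region\<close>; the factor 2 leaves room for
  intermediate sums. \<open>cap_k\<close> admits the constant \<open>2 ^ k\<close> that
  \<open>setup_runs\<close> loads.\<close>

locale reduction_run = reduction +
  fixes w :: nat
  assumes cap: "(runs + 2) * (2 * region) < 2 ^ w" and cap_k: "2 ^ k < (2 :: nat) ^ w"
begin

lemma region_less: "x \<le> 2 * region \<Longrightarrow> x < 2 ^ w"
  using cap mult_le_mono1[of 1 "runs + 2" "2 * region"] by simp

lemma inp_uniform: "length inp = 2 + n * d + n * d" "\<forall>x \<in> set inp. x < 2 ^ w"
proof -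
  have "length (concat xs) = length xs * d" if "\<forall>x \<in> set xs. length x = d" for xs :: "bool list list"
    using that by (induction xs) auto
  then show "length inp = 2 + n * d + n * d"
    using A B by (simp add: inp_def)
  have "n < 2 ^ w" "d < 2 ^ w" "1 < (2 :: nat) ^ w"
    using bounds by (intro region_less; linarith)+
  then show "\<forall>x \<in> set inp. x < 2 ^ w"
    by (auto simp: inp_def)
qed

lemma wp_setup_runs:
  assumes r: "r = (\<lambda>_. 0)" and m: "m 0 = n" "m 1 = d"
  shows "wp w (setup_runs k) (7 + 4 * n) (\<lambda>r' m'. m' = m \<and> r' 1 = 1 \<and> r' 2 = n \<and> r' 3 = d \<and>
    r' 17 = runs \<and> (\<forall>x \<in> {0, 15, 16}. r' x = 0)) r m"
proof -
  define I :: "nat \<Rightarrow> store \<Rightarrow> store \<Rightarrow> bool" where "I i r' m' \<longleftrightarrow> m' = m \<and> r' 1 = 1 \<and> r' 2 = n \<and> r' 3 = d \<and> r' 17 = 2 ^ i \<and>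
    (\<forall>x \<in> {0, 15, 16}. r' x = 0) \<and> r' 25 = 2 ^ k \<and> r' 26 = n div (2 ^ k) ^ Suc i" for i r' m'
  have small: "n < 2 ^ w" "d < 2 ^ w" "1 < (2 :: nat) ^ w" "x \<le> n \<Longrightarrow> x < 2 ^ w" for x
    using bounds by (auto intro!: region_less)
  have "wp w (setup_runs k) (6 + (steps * (2 + 2) + 1)) (I steps) r m"
    unfolding setup_runs_def
  proof (rule wp_SeqI[where R = "I 0"])
    have "n div 2 ^ k < 2 ^ w"
      by (intro small(4)) simp
    then show "wp w (Block [Const 1 1, Load 2 0, Load 3 1, Const 17 1, Const 25 (2 ^ k), Bin Div 26 2 25])
        6 (I 0) r m"
      using small cap_k m by (intro wp_Block) (auto simp: I_def r)
    fix r m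
    assume I0: "I 0 r m"
    show "wp w (Loop 26 (Block [Bin Add 17 17 17, Bin Div 26 26 25])) (steps * (2 + 2) + 1) (I steps) r m"
    proof (rule wp_Loop)
      fix i r m
      assume i: "i < steps" and I: "I i r m"
      have "2 ^ i + 2 ^ i < (2 :: nat) ^ w" "n div (2 ^ k) ^ Suc (Suc i) < 2 ^ w"
        using power_less_n[of "Suc i"] i by (auto intro!: small(4) simp: mult_2)
      moreover have "n div (2 ^ k) ^ Suc i div 2 ^ k = n div (2 ^ k) ^ Suc (Suc i)"
      proof -
        have "(2 ^ k) ^ Suc (Suc i) = (2 ^ k) ^ Suc i * (2 :: nat) ^ k"
          by simp
        then show ?thesis
          by (simp only: div_mult2_eq)
      qed
      ultimately have "wp w (Block [Bin Add 17 17 17, Bin Div 26 26 25]) 2 (I (Suc i)) r m"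
        using I by (intro wp_Block) (simp_all add: I_def mult_2 del: power_Suc, simp add: mult_2)
      then show "r 26 \<noteq> 0 \<and> wp w (Block [Bin Add 17 17 17, Bin Div 26 26 25]) 2 (I (Suc i)) r m"
        using I steps(2)[OF i] by (auto simp: I_def)
    next
      show "r 26 = 0" if "I steps r m" for r m
        using that steps(1) by (simp add: I_def)
    qed (rule I0)
  qed
  \<comment> \<open>The logarithmic number of rounds is charged generously as linear in
    \<open>n\<close>, which the cost of the runs absorbs later.\<close>
  moreover have "6 + (steps * (2 + 2) + 1) \<le> 7 + 4 * n"
    using runs by simp
  ultimately show ?thesis
    by (rule wp_mono) (auto simp: I_def runs_def)
qed

text \<open>As \<open>y\<close> is at least 1, the final product bounds all intermediate ones, so a
  single word size condition suffices.\<close>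

lemma block_power:
  assumes "r 24 = y" "r 25 = x" "x * y ^ c' < 2 ^ w" "1 \<le> y"
    and "block_wp w js Q (r(25 := x * y ^ c')) m"
  shows "block_wp w (replicate c' (Bin Mul 25 25 24) @ js) Q r m"
  using assms
proof (induction c' arbitrary: r x)
  case 0
  then have "r(25 := x) = r" by auto
  with 0 show ?case by simp
next
  case (Suc c')
  have "x * y * 1 \<le> x * y * y ^ c'"
    using Suc.prems(4) by (intro mult_le_mono2) simp
  also have "\<dots> = x * y ^ Suc c'"
    by simp
  finally have "x * y < 2 ^ w"
    using Suc.prems(3) by linarith
  moreover have "block_wp w (replicate c' (Bin Mul 25 25 24) @ js) Q (r(25 := x * y)) m"
  proof (rule Suc.IH[where x = "x * y"])
    have "r(25 := x * y, 25 := x * y * y ^ c') = r(25 := x * y ^ Suc c')"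
      by (simp add: mult.assoc)
    then show "block_wp w js Q (r(25 := x * y, 25 := x * y * y ^ c')) m"
      using Suc.prems(5) by (simp only:)
  qed (use Suc.prems in \<open>auto simp: mult.assoc\<close>)
  ultimately show ?case
    using Suc.prems by (simp del: fun_upd_apply)
qed


definition params :: "store \<Rightarrow> bool" where
  "params r \<longleftrightarrow> r 1 = 1 \<and> r 2 = n \<and> r 3 = d \<and> r 4 = size_A \<and> r 5 = size_B \<and> r 6 = db \<and>
     r 7 = (db - len) * \<sigma> \<and> r 8 = 1 + db * \<sigma> \<and> r 9 = region \<and> r 10 = db_len \<and> r 11 = 2 + n * d \<and>
     r 12 = query_len \<and> r 13 = len"

lemma wp_setup_sizes:
  assumes r: "r 1 = 1" "r 2 = n" "r 3 = d" "r 17 = runs" "\<forall>x \<in> {0, 15, 16}. r x = 0"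
  shows "wp w (setup_sizes \<sigma> K c large_A) (37 + c) (\<lambda>r' m'. m' = m \<and> params r' \<and> r' 14 = region \<and>
    r' 17 = runs \<and> (\<forall>x \<in> {0, 15, 16}. r' x = 0)) r m"
proof -
  let ?Q = "\<lambda>r' m'. m' = m \<and> params r' \<and> r' 14 = region \<and>
    r' 17 = runs \<and> (\<forall>x \<in> {0, 15, 16}. r' x = 0)"
  define js where "js = [Bin Add 9 9 25, Move 14 9]"
  define power_block where "power_block = replicate c (Bin Mul 25 25 24) @ js"
  have le: "x < 2 ^ w" if "x \<le> input_len \<or> x \<le> region \<or> x \<le> 2 * region" for x
    using that bounds(16) by (intro region_less) auto
  have eqs: "db_len = 1 + 2 * (db * \<sigma>) + len" "input_len = db_len + query_len + 6"
    "region = 2 + n * d + n * d + input_len + (2 * input_len) ^ c" "part_size = n div runs + 1"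
    by (simp_all add: db_len_def input_len_def region_def part_size_def)
  define pre :: "store \<Rightarrow> store \<Rightarrow> bool" where
    "pre r' m' \<longleftrightarrow> m' = m \<and> params (r'(9 := region)) \<and> r' 9 = n * d + 2 + n * d + input_len \<and>
      r' 24 = 2 * input_len \<and> r' 25 = 1 \<and> r' 17 = runs \<and> (\<forall>x \<in> {0, 15, 16}. r' x = 0)" for r' m'
  have power: "block_wp w power_block ?Q r' m'" if pre: "pre r' m'" for r' m'
    unfolding power_block_def
  proof (rule block_power)
    show "r' 24 = 2 * input_len" "r' 25 = 1"
      using pre by (simp_all add: pre_def)
    have "r' 9 + (2 * input_len) ^ c = region"
      using pre by (simp add: pre_def region_def)
    then show "block_wp w js ?Q (r'(25 := 1 * (2 * input_len) ^ c)) m'"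
      using pre le[of region] by (simp add: js_def params_def pre_def)
    show "1 * (2 * input_len) ^ c < 2 ^ w"
      by (rule le) (use eqs in linarith)
  qed (use eqs in simp)
  define pre1 :: "store \<Rightarrow> store \<Rightarrow> bool" where
    "pre1 r' m' \<longleftrightarrow> m' = m \<and> r' 1 = 1 \<and> r' 2 = n \<and> r' 3 = d \<and> r' 4 = size_A \<and> r' 5 = size_B \<and>
      r' 17 = runs \<and> (\<forall>x \<in> {0, 15, 16}. r' x = 0)" for r' m'
  define pre2 :: "store \<Rightarrow> store \<Rightarrow> bool" where
    "pre2 r' m' \<longleftrightarrow> pre1 r' m' \<and> r' 6 = db \<and> r' 7 = (db - len) * \<sigma> \<and> r' 8 = 1 + db * \<sigma> \<and>
      r' 10 = db_len \<and> r' 13 = len" for r' m'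
  define pre3 :: "store \<Rightarrow> store \<Rightarrow> bool" where
    "pre3 r' m' \<longleftrightarrow> pre2 r' m' \<and> r' 11 = 2 + n * d \<and> r' 9 = 2 + n * d + n * d \<and> r' 12 = query_len" for r' m'
  \<comment> \<open>The block is cut where few registers matter; \<open>pre1\<close> to
    \<open>pre3\<close> and \<open>pre\<close> are the assertions between the pieces.\<close>
  define is1 where "is1 = [Bin Div 27 2 17, Bin Add 27 27 1,
    Move 4 (if large_A then 2 else 27), Move 5 (if large_A then 27 else 2)]"
  define is2 where "is2 = [Const 25 3, Bin Add 26 3 3, Bin Add 26 26 25, Bin Mul 13 4 26, Bin Add 6 13 1,
    Const 25 K, Bin Mul 6 6 25, Const 25 \<sigma>, Bin Mul 26 6 25, Bin Add 8 26 1, Bin Sub 7 6 13, Bin Mul 7 7 25,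
    Bin Add 10 8 26, Bin Add 10 10 13]"
  define is3 where "is3 = [Bin Mul 25 2 3, Const 26 2, Bin Add 11 26 25,
    Bin Add 9 11 25, Const 26 12, Bin Mul 12 3 26, Const 26 4, Bin Add 12 12 26, Bin Mul 12 12 5,
    Const 26 39, Bin Add 12 12 26]"
  define is4 where "is4 = [Bin Add 24 10 12, Const 26 6, Bin Add 24 24 26, Bin Add 9 9 24,
    Bin Add 24 24 24, Const 25 1]"
  have 1: "n div runs < 2 ^ w" "n div runs + 1 < 2 ^ w" "n < 2 ^ w"
    by (rule le, use bounds eqs in linarith)+
  have is1: "block_wp w is1 pre1 r m"
    using r 1 unfolding is1_def pre1_def size_A_def size_B_def part_size_def
    by (cases large_A) simp_all
  have is2: "block_wp w is2 pre2 r' m'" if "pre1 r' m'" for r' m'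
  proof -
    have "size_A * (2 * d + 3) = len" "K + len * K = db" "Suc (2 * (db * \<sigma>)) + len = db_len"
      by (simp_all add: len_def db_def db_len_def)
    moreover have "2 * d < 2 ^ w" "2 * d + 3 < 2 ^ w" "len < 2 ^ w" "Suc len < 2 ^ w" "db < 2 ^ w"
      "K < 2 ^ w" "\<sigma> < 2 ^ w" "db * \<sigma> < 2 ^ w" "Suc (db * \<sigma>) < 2 ^ w" "db - len < 2 ^ w"
      "(db - len) * \<sigma> < 2 ^ w" "Suc (2 * (db * \<sigma>)) < 2 ^ w" "db_len < 2 ^ w" "3 < (2 :: nat) ^ w"
      by (rule le, use bounds eqs len_less in linarith)+
    ultimately show ?thesis
      using that by (simp add: is2_def pre2_def pre1_def flip: mult_2)
  qed
  have is3: "block_wp w is3 pre3 r' m'" if "pre2 r' m'" for r' m'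
  proof -
    have "(d * 12 + 4) * size_B + 39 = query_len"
      by (simp add: query_len_def)
    moreover from this have "(d * 12 + 4) * size_B < 2 ^ w"
      by (intro le) (use bounds in linarith)
    moreover have "n * d < 2 ^ w" "Suc (Suc (n * d)) < 2 ^ w" "Suc (Suc (n * d + n * d)) < 2 ^ w"
      "d * 12 < 2 ^ w" "d * 12 + 4 < 2 ^ w" "query_len < 2 ^ w" "2 < (2 :: nat) ^ w" "12 < (2 :: nat) ^ w"
      "4 < (2 :: nat) ^ w" "39 < (2 :: nat) ^ w"
      by (rule le, use bounds eqs in linarith)+
    ultimately show ?thesis
      using that by (simp add: is3_def pre3_def pre2_def pre1_def)
  qed
  have is4: "block_wp w is4 pre r' m'" if "pre3 r' m'" for r' m'
  proof -
    have "db_len + query_len + 6 = input_len"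
      by (simp add: input_len_def)
    moreover have "Suc (Suc (n * d + n * d + input_len)) < 2 ^ w" "db_len + query_len < 2 ^ w"
      "input_len < 2 ^ w" "2 * input_len < 2 ^ w" "6 < (2 :: nat) ^ w" "Suc 0 < 2 ^ w"
      by (rule le, use bounds eqs in linarith)+
    ultimately show ?thesis
      using that by (simp add: is4_def pre_def pre3_def pre2_def pre1_def params_def)
  qed
  have "block_wp w (is1 @ is2 @ is3 @ is4 @ power_block) ?Q r m"
    unfolding block_wp_append
    by (intro block_wp_mono[OF is1] block_wp_mono[OF is2] block_wp_mono[OF is3] block_wp_mono[OF is4] power)
  then show ?thesis
    unfolding setup_sizes_def
    by (intro wp_Block) (simp_all add: is1_def is2_def is3_def is4_def power_block_def js_def)
qed


text \<open>After \<open>t\<close> runs the regions already used may hold garbage and are not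
  mentioned; only the input and the blank memory from the current region on matter.\<close>

definition inv :: "nat \<Rightarrow> store \<Rightarrow> store \<Rightarrow> bool" where
  "inv t r m \<longleftrightarrow> params r \<and> r 0 = of_bool (\<exists>s < t. found s) \<and> r 14 = (t + 1) * region \<and>
     r 15 = t * size_A \<and> r 16 = t * size_B \<and> (\<forall>i < length inp. m i = inp ! i) \<and>
     (\<forall>i \<ge> (t + 1) * region. m i = 0)"

lemma wp_zero_regs:
  "wp w (Block (map (\<lambda>x. Const (x + 30) 0) [0..<N])) N
     (\<lambda>r' m'. m' = m \<and> (\<forall>x < N. r' (x + 30) = 0) \<and> (\<forall>x < 30. r' x = r x)) r m"
proof -
  have "block_wp w (map (\<lambda>x. Const (x + 30) 0) [0..<N])
      (\<lambda>r' m'. m' = m \<and> (\<forall>x < N. r' (x + 30) = 0) \<and> (\<forall>x < 30. r' x = r x)) r m"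
  proof (induction N)
    case (Suc N)
    have "block_wp w (map (\<lambda>x. Const (x + 30) 0) [0..<N]) (block_wp w [Const (N + 30) 0]
      (\<lambda>r' m'. m' = m \<and> (\<forall>x < Suc N. r' (x + 30) = 0) \<and> (\<forall>x < 30. r' x = r x))) r m"
      by (rule block_wp_mono[OF Suc.IH]) (auto simp: less_Suc_eq)
    then show ?case by (simp add: block_wp_append)
  qed simp
  then show ?thesis by (rule wp_Block) simp
qed

text \<open>\<open>v\<close> is the word size under which the simulated program runs on this
  instance. Because \<open>2 ^ v \<le> region\<close>, its whole footprint stays in region
  \<open>t\<close>, and the invariant holds again one region further.\<close>

lemma wp_run:
  assumes inv: "inv t r m" and t: "t < runs"
    and comp: "ram_computes v P (code pair t) \<tau> out" "out 0 = of_bool (found t)"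
    and v: "v \<le> w" "2 ^ v \<le> region"
  shows "wp w (write_instance \<sigma> pair ;; simulate P)
    ((200 + 2 * (size_A * ((2 * d + 3) * (4 * \<sigma> + 25))) + (db - len) * \<sigma> * 12 + size_B * (7 * (12 * d + 4)))
      + (reg_bound P + (2 * \<tau> + 4)))
    (\<lambda>r' m'. inv (Suc t) r' m' \<and> r' 17 = r 17) r m"
proof -
  have regs: "r 1 = 1" "r 2 = n" "r 3 = d" "r 4 = size_A" "r 5 = size_B" "r 6 = db" "r 7 = (db - len) * \<sigma>"
      "r 8 = 1 + db * \<sigma>" "r 9 = region" "r 10 = db_len" "r 11 = 2 + n * d" "r 12 = query_len" "r 13 = len"
      "r 0 = of_bool (\<exists>s < t. found s)" "r 14 = (t + 1) * region" "r 15 = t * size_A" "r 16 = t * size_B"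
    using inv by (auto simp: inv_def params_def)
  have cap_t: "x < 2 ^ w" if "x \<le> (t + 2) * (2 * region)" for x
  proof -
    have "(t + 2) * (2 * region) \<le> (runs + 2) * (2 * region)"
      using t by (intro mult_le_mono1) simp
    with that cap show ?thesis by linarith
  qed
  have region: "region \<le> (t + 1) * region" "(t + 2) * (2 * region) = (t + 1) * region + (t + 1) * region + 2 * region"
    "(t + 2) * region = (t + 1) * region + region"
    by (simp_all add: algebra_simps)
  have sizes: "t * size_A + size_A \<le> (t + 1) * region" "t * size_B + size_B \<le> (t + 1) * region"
    using bounds mult_le_mono2[of size_A region "t + 1"] mult_le_mono2[of size_B region "t + 1"]
    by simp_all
  interpret R: ov_run w r inp A B n d
  proof
    show "length inp \<le> r 14" "length inp + d + 2 < 2 ^ w" "n + d + 9 < 2 ^ w"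
      using bounds inp_uniform region regs by (simp, intro cap_t, linarith, intro cap_t, linarith)
  qed (use regs inp_uniform A B n in \<open>auto simp: inp_def\<close>)
  have groups: "R.group_A = run_A t" "R.group_B = run_B t"
    using regs A(1) B(1) by (simp_all add: R.group_A_def R.group_B_def run_A_def run_B_def cyclic_def)
  have code: "code pair t = rpq_code (line \<sigma> db (word R.group_A)) (query R.group_B) @
      (if pair then [0, length (word R.group_A)] else [])"
    by (simp add: code_def graph_def groups length_word_run)
  have writes: "wp w (write_instance \<sigma> pair)
      (200 + 2 * (size_A * ((2 * d + 3) * (4 * \<sigma> + 25))) + (db - len) * \<sigma> * 12 + size_B * (7 * (12 * d + 4)))
      (R.written (code pair t)) r m"
  proof -
    have "wp w (write_instance \<sigma> pair)
      (200 + 2 * (r 4 * ((2 * d + 3) * (4 * \<sigma> + 25))) + r 7 * 12 + r 5 * (7 * (12 * d + 4)))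
      (R.written (code pair t)) r m"
      unfolding code
    proof (rule R.wp_write_instance(2))
      show "r 10 = length (adj_code (line \<sigma> db (word R.group_A)))" "r 12 = regex_size (query R.group_B)"
        using regs length_adj_code[of t] regex_size_query[of t] by (simp_all add: groups graph_def)
      show "\<forall>i < length inp. m i = inp ! i" "\<forall>i \<ge> r 14. m i = 0"
        using inv regs by (auto simp: inv_def)
      show "r 14 + r 10 + r 12 + 4 < 2 ^ w"
        using regs bounds region by (intro cap_t) (simp add: input_len_def)
      show "r 15 + r 4 < 2 ^ w" "r 16 + r 5 < 2 ^ w"
        using regs sizes region by (intro cap_t; simp)+
    qed (use regs \<sigma> len_less in \<open>simp_all add: groups length_word_run\<close>)
    then show ?thesis by (simp add: regs)
  qed
  show ?thesis
  proof (rule wp_SeqI[OF writes])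
    fix r1 m1 :: store
    assume w1: "R.written (code pair t) r1 m1"
    have r1: "\<forall>x < 18. r1 x = r x" "\<forall>i < length inp. m1 i = inp ! i"
        "\<forall>i < length (code pair t). m1 (r 14 + i) = code pair t ! i"
        "\<forall>i \<ge> r 14 + length (code pair t). m1 i = 0"
      using w1 by (auto simp: R.written_def R.fixed_def)
    show "wp w (simulate P) (reg_bound P + (2 * \<tau> + 4)) (\<lambda>r' m'. inv (Suc t) r' m' \<and> r' 17 = r 17) r1 m1"
      unfolding simulate_def
    proof (rule wp_SeqI[OF wp_zero_regs])
      fix r2 m2 :: store
      assume 2: "m2 = m1 \<and> (\<forall>x < reg_bound P. r2 (x + 30) = 0) \<and> (\<forall>x < 30. r2 x = r1 x)"
      then have r2: "\<forall>x < 18. r2 x = r x" "r2 14 = (t + 1) * region"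
        using r1 regs by auto
      show "wp w (Sim P ;; Block [Bin Or 0 0 30, Bin Add 14 14 9, Bin Add 15 15 4, Bin Add 16 16 5])
          (2 * \<tau> + 4) (\<lambda>r' m'. inv (Suc t) r' m' \<and> r' 17 = r 17) r2 m2"
      proof (rule wp_SeqI)
        show "wp w (Sim P) (2 * \<tau>) (\<lambda>r' m'. r' 30 = out 0 \<and> (\<forall>x < 29. r' x = r2 x) \<and>
            (\<forall>i. i < r2 14 \<or> r2 14 + 2 ^ v \<le> i \<longrightarrow> m' i = m2 i)) r2 m2"
        proof (rule wp_Sim[OF comp(1) v(1)])
          have "r2 14 + 2 ^ v < 2 ^ w"
            using r2 region v by (intro cap_t) simp
          then show "r2 14 + 2 ^ v \<le> 2 ^ w" by simp
        qed (use 2 r1 r2 regs in auto)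
      next
        fix r3 m3 :: store
        assume 3: "r3 30 = out 0 \<and> (\<forall>x < 29. r3 x = r2 x) \<and>
            (\<forall>i. i < r2 14 \<or> r2 14 + 2 ^ v \<le> i \<longrightarrow> m3 i = m2 i)"
        have r3: "\<forall>x < 18. r3 x = r x" "r3 30 = of_bool (found t)"
          using 3 r2 comp(2) by auto
        have m3: "\<forall>i < length inp. m3 i = inp ! i"
        proof (intro allI impI)
          fix i assume "i < length inp"
          moreover from this have "i < r2 14"
            using R.inp_base regs r2 by simp
          ultimately show "m3 i = inp ! i"
            using 3 2 r1(2) by simp
        qed
        \<comment> \<open>The next region lies behind both the written code and the window of the
          simulation.\<close>
        have z3: "m3 i = 0" if "(t + 2) * region \<le> i" for i
        proof -
          have "m3 i = m1 i"
            using 3 2 r2 that region v by auto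
          moreover have "r 14 + length (code pair t) \<le> i"
            using that region regs bounds(16) length_code[of pair t] by simp
          ultimately show ?thesis using r1(4) by simp
        qed
        have or_bool: "or (of_bool p) (of_bool q) = (of_bool (p \<or> q) :: nat)" for p q
          by (cases p; cases q) simp_all
        have ex: "(\<exists>s < Suc t. found s) \<longleftrightarrow> (\<exists>s < t. found s) \<or> found t"
          by (auto simp: less_Suc_eq)
        let ?r = "r3(0 := of_bool (\<exists>s < Suc t. found s), 14 := (t + 2) * region,
          15 := Suc t * size_A, 16 := Suc t * size_B)"
        have inv': "inv (Suc t) ?r m3"
          using inv r3(1) m3 z3 by (auto simp: inv_def params_def)
        have "block_wp w [Bin Or 0 0 30, Bin Add 14 14 9, Bin Add 15 15 4, Bin Add 16 16 5]
          (\<lambda>r' m'. r' = ?r \<and> m' = m3) r3 m3"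
        proof -
          have vals: "r3 0 = of_bool (\<exists>s < t. found s)" "r3 14 = (t + 1) * region" "r3 9 = region"
            "r3 15 = t * size_A" "r3 4 = size_A" "r3 16 = t * size_B" "r3 5 = size_B"
            using r3(1) regs by auto
          have small: "of_bool p < (2 :: nat) ^ w" "(t + 1) * region + region < 2 ^ w"
            "t * size_A + size_A < 2 ^ w" "t * size_B + size_B < 2 ^ w" for p
            using sizes region bounds by (intro cap_t; auto simp: of_bool_def)+
          have eqs: "(t + 1) * region + region = (t + 2) * region" "t * size_A + size_A = Suc t * size_A"
            "t * size_B + size_B = Suc t * size_B"
            by simp_all
          have "block_wp w [Bin Or 0 0 30, Bin Add 14 14 9, Bin Add 15 15 4, Bin Add 16 16 5]
            (\<lambda>r' m'. r' = r3(0 := or (r3 0) (r3 30), 14 := r3 14 + r3 9, 15 := r3 15 + r3 4,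
              16 := r3 16 + r3 5) \<and> m' = m3) r3 m3"
            using small by (simp add: vals r3(2) or_bool del: fun_upd_apply add: fun_upd_def)
          then show ?thesis
            by (simp only: vals r3(2) or_bool ex eqs)
        qed
        then have "block_wp w [Bin Or 0 0 30, Bin Add 14 14 9, Bin Add 15 15 4, Bin Add 16 16 5]
          (\<lambda>r' m'. inv (Suc t) r' m' \<and> r' 17 = r 17) r3 m3"
          by (rule block_wp_mono) (use inv' r3 in auto)
        then show "wp w (Block [Bin Or 0 0 30, Bin Add 14 14 9, Bin Add 15 15 4, Bin Add 16 16 5]) 4
            (\<lambda>r' m'. inv (Suc t) r' m' \<and> r' 17 = r 17) r3 m3"
          by (rule wp_Block) simp
      qed
    qed
  qed
qed

definition run_time :: "program \<Rightarrow> nat \<Rightarrow> nat" where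
  "run_time P T = 200 + 2 * (size_A * ((2 * d + 3) * (4 * \<sigma> + 25))) + (db - len) * \<sigma> * 12
     + size_B * (7 * (12 * d + 4)) + reg_bound P + 2 * T + 7"

lemma wp_ov_program:
  assumes answer: "\<And>t. t < runs \<Longrightarrow> \<exists>v \<tau> out. ram_computes v P (code pair t) \<tau> out \<and> \<tau> \<le> T \<and>
      out 0 = of_bool (found t) \<and> v \<le> w \<and> 2 ^ v \<le> region"
    and r: "r = (\<lambda>_. 0)" and m: "m = (\<lambda>i. if i < length inp then inp ! i else 0)"
  shows "wp w (ov_program \<sigma> K c k large_A pair P) (45 + c + 4 * n + runs * run_time P T)
    (\<lambda>r' m'. r' 0 = of_bool (\<exists>a \<in> set A. \<exists>b \<in> set B. orthogonal_vecs a b)) r m"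
proof -
  let ?T = "(200 + 2 * (size_A * ((2 * d + 3) * (4 * \<sigma> + 25))) + (db - len) * \<sigma> * 12 + size_B * (7 * (12 * d + 4)))
      + (reg_bound P + (2 * T + 4))"
  have "wp w (ov_program \<sigma> K c k large_A pair P) ((7 + 4 * n) + ((37 + c) + (runs * (?T + 3) + 1)))
    (\<lambda>r' m'. r' 0 = of_bool (\<exists>a \<in> set A. \<exists>b \<in> set B. orthogonal_vecs a b)) r m"
    unfolding ov_program_def
  proof (rule wp_SeqI[OF wp_setup_runs[OF r]])
    show "m 0 = n" "m 1 = d"
      unfolding m by (simp_all add: inp_def)
    fix r1 m1 :: store
    assume 1: "m1 = m \<and> r1 1 = 1 \<and> r1 2 = n \<and> r1 3 = d \<and> r1 17 = runs \<and> (\<forall>x \<in> {0, 15, 16}. r1 x = 0)"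
    show "wp w (setup_sizes \<sigma> K c large_A ;; Rep 17 (write_instance \<sigma> pair ;; simulate P))
      ((37 + c) + (runs * (?T + 3) + 1))
      (\<lambda>r' m'. r' 0 = of_bool (\<exists>a \<in> set A. \<exists>b \<in> set B. orthogonal_vecs a b)) r1 m1"
    proof (rule wp_SeqI[OF wp_setup_sizes])
      fix r2 m2 :: store
      assume 2: "m2 = m1 \<and> params r2 \<and> r2 14 = region \<and> r2 17 = runs \<and> (\<forall>x \<in> {0, 15, 16}. r2 x = 0)"
      have len_inp: "length inp \<le> region"
        using inp_uniform bounds by simp
      have "wp w (Rep 17 (write_instance \<sigma> pair ;; simulate P)) (runs * (?T + 3) + 1)
        (\<lambda>r m. inv runs r m \<and> r 17 = 0) r2 m2"
      proof (rule wp_Rep)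
        show "inv 0 r2 m2"
          using 1 2 len_inp by (simp add: inv_def m)
        show "r2 17 = runs" using 2 by simp
        show "runs < 2 ^ w"
          using runs bounds by (intro region_less) linarith
        fix t r m
        assume t: "t < runs" and inv: "inv t r m" and r17: "r 17 = runs - t"
        obtain v \<tau> out where o: "ram_computes v P (code pair t) \<tau> out" "\<tau> \<le> T"
            "out 0 = of_bool (found t)" "v \<le> w" "2 ^ v \<le> region"
          using answer[OF t] by blast
        from wp_run[OF inv t o(1,3,4,5)]
        show "wp w (write_instance \<sigma> pair ;; simulate P) ?T
          (\<lambda>r m. inv (Suc t) (r(17 := runs - Suc t)) m \<and> r 17 = runs - t \<and> r 1 = 1) r m"
        proof (rule wp_mono)
          fix r' m'
          assume "inv (Suc t) r' m' \<and> r' 17 = r 17"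
          then show "inv (Suc t) (r'(17 := runs - Suc t)) m' \<and> r' 17 = runs - t \<and> r' 1 = 1"
            using r17 by (auto simp: inv_def params_def)
        qed (use o(2) in simp)
      qed
      then show "wp w (Rep 17 (write_instance \<sigma> pair ;; simulate P)) (runs * (?T + 3) + 1)
        (\<lambda>r' m'. r' 0 = of_bool (\<exists>a \<in> set A. \<exists>b \<in> set B. orthogonal_vecs a b)) r2 m2"
        by (rule wp_mono) (auto simp: inv_def found_iff)
    qed (use 1 in auto)
  qed
  then show ?thesis
    by (rule wp_mono) (simp_all add: run_time_def algebra_simps)
qed

end


section \<open>Word size and running time\<close>

text \<open>With \<open>\<kappa> = 66 * (K * \<sigma>)\<close> and \<open>s\<close> the power of two
  above \<open>M\<close>, the input length plus 2, all addresses are at most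
  \<open>(18 * \<kappa> * M) ^ (c + 2)\<close>. Since
  \<open>18 * \<kappa> \<le> s ^ (18 * \<kappa>)\<close> and \<open>M \<le> s\<close>, this is a
  power of \<open>s\<close> with constant exponent. The 1 gives strictness and \<open>k\<close>
  accommodates \<open>2 ^ k\<close>.\<close>

definition word_factor_const :: "nat \<Rightarrow> nat \<Rightarrow> nat \<Rightarrow> nat \<Rightarrow> nat" where
  "word_factor_const \<sigma> K c k = (18 * (66 * (K * \<sigma>)) + 1) * (c + 2) + 1 + k"

context reduction
begin

text \<open>The hypothesis \<open>nd\<close> bounds \<open>n\<close> linearly in the input length;
  without it the case \<open>d = 0\<close> would break the estimate, as the input then consists of
  two cells.\<close>

lemma cap_word_size:
  assumes nd: "n \<le> 2 + n * d"
  defines "w \<equiv> word_factor_const \<sigma> K c k * ceillog2 (length inp + 2)"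
  shows "(runs + 2) * (2 * region) < 2 ^ w" "2 ^ k < (2 :: nat) ^ w"
proof -
  let ?M = "length inp + 2" and ?\<kappa> = "66 * (K * \<sigma>)"
  let ?s = "(2 :: nat) ^ ceillog2 ?M"
  have "length (concat xs) = length xs * d" if "\<forall>x \<in> set xs. length x = d" for xs :: "bool list list"
    using that by (induction xs) auto
  then have M: "?M = 4 + 2 * (n * d)"
    using A B by (simp add: inp_def)
  have Ms: "?M \<le> ?s" by (rule le_two_power_ceillog2)
  then have s: "2 \<le> ?s" using M by linarith
  have w: "2 ^ w = ?s ^ word_factor_const \<sigma> K c k"
    by (simp add: w_def mult.commute flip: power_mult)
  have d: "d \<le> n * d" using n by simp
  have K\<sigma>: "1 \<le> K * \<sigma>" "K \<le> K * \<sigma>" using K \<sigma> by auto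
  have "part_size \<le> n + 1" by (simp add: part_size_def)
  then have "size_A \<le> n + 1" "size_B \<le> n + 1" by (auto simp: size_A_def size_B_def)
  then have "len \<le> (n + 1) * (2 * d + 3)" "query_len \<le> (12 * d + 4) * (n + 1) + 39"
    unfolding len_def query_len_def by (intro mult_le_mono1 add_right_mono mult_le_mono2; simp)+
  then have len: "len + 1 \<le> 8 * ?M" "query_len \<le> 33 * ?M"
  proof -
    define x where "x = n * d"
    have "(n + 1) * (2 * d + 3) = 2 * x + 3 * n + 2 * d + 3"
      "(12 * d + 4) * (n + 1) = 12 * x + 4 * n + 12 * d + 4"
      by (simp_all add: algebra_simps x_def)
    then have "len \<le> 2 * x + 3 * n + 2 * d + 3" "query_len \<le> 12 * x + 4 * n + 12 * d + 43"
      using \<open>len \<le> _\<close> \<open>query_len \<le> _\<close> by simp_all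
    moreover have "n \<le> 2 + x" "d \<le> x" "?M = 4 + 2 * x"
      using nd d M by (simp_all add: x_def)
    ultimately show "len + 1 \<le> 8 * ?M" "query_len \<le> 33 * ?M"
      by simp_all
  qed
  have "input_len = 1 + 2 * ((len + 1) * (K * \<sigma>)) + len + query_len + 6"
    by (simp add: input_len_def db_len_def db_def algebra_simps)
  also have "\<dots> \<le> 2 * (8 * ?M * (K * \<sigma>)) + 43 * ?M"
  proof -
    have "4 \<le> ?M" using M by simp
    moreover have "(len + 1) * (K * \<sigma>) \<le> 8 * ?M * (K * \<sigma>)"
      using len(1) by (rule mult_le_mono1)
    moreover have "1 + 2 * x + len + query_len + 6 \<le> 2 * y + 43 * ?M" if "4 \<le> ?M" "x \<le> y" for x y
      using that len by simp
    ultimately show ?thesis by blast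
  qed
  also have "\<dots> \<le> 2 * (8 * ?M * (K * \<sigma>)) + 43 * ?M * (K * \<sigma>)"
    using mult_le_mono2[OF K\<sigma>(1), of "43 * ?M"] by simp
  finally have input: "input_len \<le> ?\<kappa> * ?M"
    by (simp add: algebra_simps)
  \<comment> \<open>The 18 is the product of the factors 3 and 6 in the bounds on
    \<open>runs + 2\<close> and \<open>2 * region\<close> below.\<close>
  let ?z = "18 * ?\<kappa> * ?M"
  have \<kappa>: "1 \<le> ?\<kappa>" using K\<sigma> by simp
  have M\<kappa>: "?M \<le> ?\<kappa> * ?M" using mult_le_mono1[OF \<kappa>, of ?M] by simp
  have z: "1 \<le> ?z" using M\<kappa> M by linarith
  have "(2 * input_len) ^ c \<le> (2 * (?\<kappa> * ?M)) ^ c"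
    using input by (intro power_mono) auto
  also have "\<dots> \<le> ?z ^ c"
    by (intro power_mono) simp_all
  finally have 1: "region \<le> 2 * (?\<kappa> * ?M) + ?z ^ c"
    unfolding region_def using M input M\<kappa> by linarith
  also have "\<dots> \<le> 3 * (?\<kappa> * ?M) * ?z ^ c"
  proof -
    have "1 * 1 \<le> (?\<kappa> * ?M) * ?z ^ c" "2 * (?\<kappa> * ?M) * 1 \<le> 2 * (?\<kappa> * ?M) * ?z ^ c" "1 * ?z ^ c \<le> (?\<kappa> * ?M) * ?z ^ c"
      using z M\<kappa> M by (intro mult_le_mono; simp)+
    then show ?thesis by linarith
  qed
  finally have region: "2 * region \<le> 6 * (?\<kappa> * ?M) * ?z ^ c" by linarith
  have "runs + 2 \<le> 3 * ?M"
    using runs(2) nd M by simp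
  then have "(runs + 2) * (2 * region) \<le> (3 * ?M) * (6 * (?\<kappa> * ?M) * ?z ^ c)"
    using region by (rule mult_le_mono)
  also have "\<dots> = ?M * (?z * ?z ^ c)"
    by (simp add: algebra_simps)
  also have "\<dots> \<le> ?z * (?z * ?z ^ c)"
    using M\<kappa> by (intro mult_le_mono1) linarith
  also have "\<dots> = ?z ^ (c + 2)" by simp
  also have "\<dots> \<le> (?s ^ (18 * ?\<kappa> + 1)) ^ (c + 2)"
  proof (intro power_mono)
    have "18 * ?\<kappa> \<le> 2 ^ (18 * ?\<kappa>)" by (rule less_imp_le) (rule less_exp)
    also have "\<dots> \<le> ?s ^ (18 * ?\<kappa>)" using s by (rule power_mono) simp
    finally have "18 * ?\<kappa> * ?M \<le> ?s ^ (18 * ?\<kappa>) * ?s" using Ms by (rule mult_le_mono)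
    then show "?z \<le> ?s ^ (18 * ?\<kappa> + 1)" by (simp only: power_add power_one_right)
  qed simp
  also have "\<dots> = ?s ^ ((18 * ?\<kappa> + 1) * (c + 2))" by (simp only: power_mult)
  also have "\<dots> < ?s ^ word_factor_const \<sigma> K c k"
    using s by (intro power_strict_increasing) (auto simp: word_factor_const_def)
  finally show "(runs + 2) * (2 * region) < 2 ^ w" by (simp only: w)
  have "2 ^ k \<le> ?s ^ k" using s by (rule power_mono) simp
  also have "\<dots> < ?s ^ word_factor_const \<sigma> K c k"
    using s by (intro power_strict_increasing) (auto simp: word_factor_const_def)
  finally show "2 ^ k < (2 :: nat) ^ w" by (simp only: w)
qed

lemma run_word_size:
  "2 ^ (c * ceillog2 (length (code pair t) + 2)) \<le> region"
proof -
  let ?y = "length (code pair t) + 2"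
  have "2 ^ ceillog2 ?y < 2 * ?y"
    by (rule two_power_ceillog2_gt) simp
  also have "2 * ?y \<le> 2 * input_len"
    using length_code[of pair t] by (rule mult_le_mono2)
  finally have "2 ^ ceillog2 ?y \<le> 2 * input_len"
    by (rule less_imp_le)
  then have "(2 ^ ceillog2 ?y) ^ c \<le> (2 * input_len) ^ c"
    by (rule power_mono) simp
  also have "\<dots> \<le> region" by (simp add: region_def)
  finally show ?thesis by (simp add: mult.commute flip: power_mult)
qed

text \<open>The 43 is 4 + 39 from the query length; the graph needs less, but a common constant lets
  both sides enter \<open>balanced_cost\<close> with the same \<open>\<kappa>\<close>.\<close>

lemma size_bounds:
  "real db \<le> 43 * K * real size_A * (d + 1)" "real query_len \<le> 43 * K * real size_B * (d + 1)"
proof -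
  have pos: "1 \<le> size_A" "1 \<le> size_B"
    using n part_size_pos by (auto simp: size_A_def size_B_def)
  have "len + 1 \<le> size_A * (2 * d + 3) + size_A * 1"
    unfolding len_def using pos by simp
  also have "\<dots> \<le> 43 * (size_A * (d + 1))"
    by (simp add: algebra_simps)
  finally have "db \<le> 43 * (size_A * (d + 1)) * K"
    unfolding db_def by (rule mult_le_mono1)
  then have "real db \<le> real (43 * (size_A * (d + 1)) * K)"
    by (simp only: of_nat_le_iff)
  then show "real db \<le> 43 * K * real size_A * (d + 1)"
    by (simp add: algebra_simps)
  have "query_len \<le> (12 * d + 4) * size_B + 39 * size_B"
    unfolding query_len_def using pos by simp
  also have "\<dots> \<le> 43 * (size_B * (d + 1)) * 1"
    by (simp add: algebra_simps)
  also have "\<dots> \<le> 43 * (size_B * (d + 1)) * K"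
    using K by (rule mult_le_mono2)
  finally have "real query_len \<le> real (43 * (size_B * (d + 1)) * K)"
    by (simp only: of_nat_le_iff)
  then show "real query_len \<le> 43 * K * real size_B * (d + 1)"
    by (simp add: algebra_simps)
qed

lemma part_size_le: "real runs * real part_size \<le> 2 * real n"
proof -
  have "runs * part_size \<le> n + runs"
    by (simp add: part_size_def)
  also have "\<dots> \<le> 2 * n" using runs by simp
  finally have "real (runs * part_size) \<le> real (2 * n)"
    by (simp only: of_nat_le_iff)
  then show ?thesis by simp
qed

lemma runs_root:
  "real runs \<le> real n powr (1 / k)" "real n powr (1 / k) < 2 * real runs"
proof -
  have k0: "0 < k" using k by simp
  have root: "real n powr (1 / k) = root k (real n)"
    using n k0 by (simp add: root_powr_inverse inverse_eq_divide)
  have "real (runs ^ k) \<le> real n" using runs_power_le by (simp only: of_nat_le_iff)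
  then show "real runs \<le> real n powr (1 / k)"
    unfolding root using k0 real_root_pos2[of k "real runs"]
    by (metis of_nat_0_le_iff of_nat_power real_root_le_mono)
  have "real n < real ((2 * runs) ^ k)" using less_runs_power by (simp only: of_nat_less_iff)
  then have "root k (real n) < root k ((2 * real runs) ^ k)"
    using k0 by (intro real_root_less_mono) simp_all
  then show "real n powr (1 / k) < 2 * real runs"
    unfolding root using real_root_power_cancel[OF k0, of "2 * real runs"] by simp
qed

end

text \<open>\<open>x\<close> is the size on the side of the undivided set, \<open>y\<close> that on
  the side of a part. The first term gives \<open>n powr (\<delta> + 2 - \<epsilon>)\<close>, and
  \<open>2 * \<delta> \<le> \<epsilon>\<close>. In the second,
  \<open>m * p ^ 2 = (m * p) ^ 2 / m\<close> with \<open>m * p \<le> 2 * n\<close> and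
  \<open>1 / m \<le> 2 / n powr \<delta>\<close> contributes the factor 8.\<close>

lemma balanced_cost:
  fixes m p n x y \<kappa> \<delta> \<epsilon> :: real
  assumes n: "1 \<le> n" and m: "1 \<le> m" "m \<le> n powr \<delta>" "n powr \<delta> < 2 * m" and p: "0 \<le> p" "m * p \<le> 2 * n"
    and \<epsilon>: "0 < \<epsilon>" "\<epsilon> \<le> 1" "2 * \<delta> \<le> \<epsilon>" and \<kappa>: "1 \<le> \<kappa>"
    and x: "1 \<le> x" "x \<le> \<kappa> * n" and y: "0 \<le> y" "y \<le> \<kappa> * p"
  shows "m * (x powr (2 - \<epsilon>) + y ^ 2) \<le> 9 * \<kappa> ^ 2 * n powr (2 - \<delta>)"
proof -
  have "x powr (2 - \<epsilon>) \<le> (\<kappa> * n) powr (2 - \<epsilon>)"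
    using x \<epsilon> by (intro powr_mono2) auto
  also have "\<dots> = \<kappa> powr (2 - \<epsilon>) * n powr (2 - \<epsilon>)"
    using n \<kappa> by (simp add: powr_mult)
  also have "\<dots> \<le> \<kappa> ^ 2 * n powr (2 - \<epsilon>)"
  proof (intro mult_right_mono)
    have "\<kappa> powr (2 - \<epsilon>) \<le> \<kappa> powr 2" using \<kappa> \<epsilon> by (intro powr_mono) auto
    then show "\<kappa> powr (2 - \<epsilon>) \<le> \<kappa> ^ 2" using \<kappa> by (simp add: powr_numeral)
  qed simp
  finally have "m * x powr (2 - \<epsilon>) \<le> n powr \<delta> * (\<kappa> ^ 2 * n powr (2 - \<epsilon>))"
    using m by (intro mult_mono) auto
  also have "\<dots> = \<kappa> ^ 2 * n powr (\<delta> + (2 - \<epsilon>))"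
    by (simp add: powr_add)
  also have "\<dots> \<le> \<kappa> ^ 2 * n powr (2 - \<delta>)"
    using n \<epsilon> by (intro mult_left_mono powr_mono) auto
  finally have 1: "m * x powr (2 - \<epsilon>) \<le> \<kappa> ^ 2 * n powr (2 - \<delta>)" .
  have "y ^ 2 \<le> (\<kappa> * p) ^ 2"
    using y by (intro power_mono) auto
  then have "m * y ^ 2 \<le> m * (\<kappa> * p) ^ 2"
    using m by (intro mult_left_mono) auto
  also have "\<dots> = \<kappa> ^ 2 * (m * p) ^ 2 / m"
    using m by (simp add: power2_eq_square)
  also have "\<dots> \<le> \<kappa> ^ 2 * (2 * n) ^ 2 / m"
    using m p by (intro divide_right_mono mult_left_mono power_mono) auto
  also have "\<dots> \<le> \<kappa> ^ 2 * (2 * n) ^ 2 * (2 / n powr \<delta>)"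
  proof -
    have "1 / m \<le> 2 / n powr \<delta>"
      using m n by (simp add: field_simps)
    then have "\<kappa> ^ 2 * (2 * n) ^ 2 * (1 / m) \<le> \<kappa> ^ 2 * (2 * n) ^ 2 * (2 / n powr \<delta>)"
      by (intro mult_left_mono) auto
    then show ?thesis by simp
  qed
  also have "\<dots> = 8 * \<kappa> ^ 2 * (n powr 2 / n powr \<delta>)"
    using n by (simp add: powr_numeral power2_eq_square)
  also have "n powr 2 / n powr \<delta> = n powr (2 - \<delta>)"
    by (simp add: powr_diff)
  finally have 2: "m * y ^ 2 \<le> 8 * \<kappa> ^ 2 * n powr (2 - \<delta>)" .
  from 1 2 show ?thesis by (simp add: distrib_left)
qed


section \<open>From orthogonal vectors to the three problems\<close>

text \<open>A common weakening of the three problems: a promise restricts the instances on which an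
  answer is demanded, and \<open>pair\<close> only records whether the two nodes belong to the
  input.\<close>

definition decides_pairs ::
  "nat \<Rightarrow> (nat, nat) graph_db set \<Rightarrow> (real \<Rightarrow> real \<Rightarrow> real) \<Rightarrow> bool \<Rightarrow> program \<Rightarrow> nat \<Rightarrow> real \<Rightarrow> bool" where
  "decides_pairs \<sigma> \<G> f pair P c C \<longleftrightarrow>
     (\<forall>L q u v. (L, q) \<in> rpq_inputs \<sigma> \<G> \<longrightarrow> u < length L \<longrightarrow> v < length L \<longrightarrow>
       (u, v) \<in> rpq_result q (db_of L) \<or> rpq_result q (db_of L) = {} \<longrightarrow>
       (let xs = rpq_code L q @ (if pair then [u, v] else []) in
        \<exists>\<tau> out. ram_computes (c * ceillog2 (length xs + 2)) P xs \<tau> out \<and>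
          real \<tau> \<le> C * f (db_size (db_of L)) (regex_size q) \<and>
          out 0 = of_bool ((u, v) \<in> rpq_result q (db_of L))))"

text \<open>On instances where the given pair is in the result or the result is empty, the three problems
  have the same answer.\<close>

lemma solvable_decides_pairs:
  assumes f: "\<And>x y. 0 \<le> f x y"
    and "solvable_in_O (Check \<sigma> \<G>) (\<lambda>(L, q, u, v). f (db_size (db_of L)) (regex_size q))
       \<or> solvable_in_O (Boole \<sigma> \<G>) (\<lambda>(L, q). f (db_size (db_of L)) (regex_size q))
       \<or> solvable_in_O (Witness \<sigma> \<G>) (\<lambda>(L, q). f (db_size (db_of L)) (regex_size q))"
  shows "\<exists>pair P c C. 0 \<le> C \<and> decides_pairs \<sigma> \<G> f pair P c C"
proof -
  \<comment> \<open>The constant hidden in the O-notation might be negative; its absolute value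
    serves as well and permits monotonicity arguments later.\<close>
  have abs: "C * f x y \<le> \<bar>C\<bar> * f x y" for C x y
    using f by (intro mult_right_mono) auto
  have emptiness: "\<exists>pair P c C. 0 \<le> C \<and> decides_pairs \<sigma> \<G> f pair P c C"
    if solvable: "solvable_in_O \<Pi> (\<lambda>(L, q). f (db_size (db_of L)) (regex_size q))"
      and \<Pi>: "instances \<Pi> = rpq_inputs \<sigma> \<G>" "encoding \<Pi> = (\<lambda>(L, q). rpq_code L q)"
        "\<And>L q out. correct_output \<Pi> (L, q) out \<Longrightarrow> out 0 = of_bool (rpq_result q (db_of L) \<noteq> {})"
    for \<Pi>
  proof -
    obtain P C c where "\<And>x. x \<in> instances \<Pi> \<Longrightarrow> \<exists>t out.
        ram_computes (c * ceillog2 (length (encoding \<Pi> x) + 2)) P (encoding \<Pi> x) t out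
        \<and> real t \<le> C * (\<lambda>(L, q). f (db_size (db_of L)) (regex_size q)) x \<and> correct_output \<Pi> x out"
      using solvable unfolding solvable_in_O_def solves_within_def by blast
    note * = this[of "(L, q)" for L q]
    have "decides_pairs \<sigma> \<G> f False P c \<bar>C\<bar>"
      unfolding decides_pairs_def Let_def
    proof (intro allI impI)
      fix L q u v
      assume "(L, q) \<in> rpq_inputs \<sigma> \<G>"
        and res: "(u, v) \<in> rpq_result q (db_of L) \<or> rpq_result q (db_of L) = {}"
      then obtain t out where
        "ram_computes (c * ceillog2 (length (rpq_code L q) + 2)) P (rpq_code L q) t out"
          "real t \<le> C * f (db_size (db_of L)) (regex_size q)"
          "out 0 = of_bool (rpq_result q (db_of L) \<noteq> {})"
        using *[of L q] \<Pi>(3)[of L q] by (auto simp: \<Pi>(1,2))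
      then show "\<exists>\<tau> out. ram_computes
            (c * ceillog2 (length (rpq_code L q @ (if False then [u, v] else [])) + 2)) P
            (rpq_code L q @ (if False then [u, v] else [])) \<tau> out \<and>
          real \<tau> \<le> \<bar>C\<bar> * f (db_size (db_of L)) (regex_size q) \<and>
          out 0 = of_bool ((u, v) \<in> rpq_result q (db_of L))"
        using res order_trans[OF _ abs] by (intro exI[of _ t] exI[of _ out]) auto
    qed
    then show ?thesis by (intro exI[of _ False] exI[of _ P] exI[of _ c] exI[of _ "\<bar>C\<bar>"]) simp
  qed
  from assms(2) show ?thesis
  proof (elim disjE)
    assume "solvable_in_O (Check \<sigma> \<G>) (\<lambda>(L, q, u, v). f (db_size (db_of L)) (regex_size q))"
    then obtain P C c where "\<And>x. x \<in> instances (Check \<sigma> \<G>) \<Longrightarrow> \<exists>t out.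
        ram_computes (c * ceillog2 (length (encoding (Check \<sigma> \<G>) x) + 2)) P (encoding (Check \<sigma> \<G>) x) t out
        \<and> real t \<le> C * (\<lambda>(L, q, u, v). f (db_size (db_of L)) (regex_size q)) x
        \<and> correct_output (Check \<sigma> \<G>) x out"
      unfolding solvable_in_O_def solves_within_def by blast
    from this[of "(L, q, u, v)" for L q u v]
    have "decides_pairs \<sigma> \<G> f True P c \<bar>C\<bar>"
      unfolding decides_pairs_def Let_def
      by (fastforce simp: Check_def db_of_def intro: order_trans[OF _ abs])
    then show ?thesis by (intro exI[of _ True] exI[of _ P] exI[of _ c] exI[of _ "\<bar>C\<bar>"]) simp
  next
    assume "solvable_in_O (Boole \<sigma> \<G>) (\<lambda>(L, q). f (db_size (db_of L)) (regex_size q))"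
    then show ?thesis by (rule emptiness) (auto simp: Boole_def)
  next
    assume "solvable_in_O (Witness \<sigma> \<G>) (\<lambda>(L, q). f (db_size (db_of L)) (regex_size q))"
    then show ?thesis by (rule emptiness) (auto simp: Witness_def)
  qed
qed

section \<open>The instances satisfy the promise, and their total cost\<close>

context reduction
begin

lemma graph_sparse:
  fixes cs :: real
  assumes "1 \<le> cs * K" "0 < cs"
  shows "db_of (graph t) \<in> sparse_graphs cs"
proof -
  have V: "length (word (run_A t)) < db"
    using len_less by (simp add: length_word_run)
  have "1 * (real len + 1) \<le> cs * K * (real len + 1)"
    using assms(1) by (rule mult_right_mono) simp
  then have "real len \<le> cs * K * (real len + 1)"
    by (rule order_trans[rotated]) simp
  also have "\<dots> = cs * real db"
    by (simp add: db_def algebra_simps)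
  finally show ?thesis
    unfolding sparse_graphs_def graph_def
    by (simp add: card_arcs_line[OF graph_letters V] nodes_line[OF graph_letters V] length_word_run)
qed

lemma found_pair:
  "found t \<longleftrightarrow> (0, len) \<in> rpq_result (query (run_B t)) (db_of (graph t))"
  "(0, len) \<in> rpq_result (query (run_B t)) (db_of (graph t)) \<or> rpq_result (query (run_B t)) (db_of (graph t)) = {}"
proof -
  have V: "length (word (run_A t)) < db"
    using len_less by (simp add: length_word_run)
  have d: "\<forall>a \<in> set (run_A t) \<union> set (run_B t). length a = d"
    using run_lengths by blast
  have yes: "(0, len) \<in> rpq_result (query (run_B t)) (db_of (graph t))" if "found t"
    using that rpq_result_query_yes[OF \<sigma> V d] unfolding found_def graph_def by (auto simp: length_word_run)
  have no: "rpq_result (query (run_B t)) (db_of (graph t)) = {}" if "\<not> found t"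
    using that rpq_result_query_no[OF \<sigma> V d] unfolding found_def graph_def by blast
  show "found t \<longleftrightarrow> (0, len) \<in> rpq_result (query (run_B t)) (db_of (graph t))"
    "(0, len) \<in> rpq_result (query (run_B t)) (db_of (graph t)) \<or> rpq_result (query (run_B t)) (db_of (graph t)) = {}"
    using yes no by auto
qed

lemma length_graph: "length (graph t) = db"
  using len_less by (simp add: graph_def length_line[OF graph_letters] length_word_run)

lemma db_size_graph: "db_size (db_of (graph t)) = db"
  using len_less by (simp add: graph_def db_size_line[OF graph_letters] length_word_run)

lemma rpq_input:
  assumes "db_of (graph t) \<in> \<G>"
  shows "(graph t, query (run_B t)) \<in> rpq_inputs \<sigma> \<G>"
proof -
  have "adj_lists_over \<sigma> (graph t)"
    unfolding graph_def using len_less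
    by (intro adj_lists_over_line[OF graph_letters]) (simp add: length_word_run)
  then show ?thesis
    using assms letters_query[OF \<sigma>] by (auto simp: rpq_inputs_def)
qed

text \<open>\<open>F\<close> bounds the sum of both sizes, and \<open>n\<close> is below that sum
  because one of the sets is used as a whole. So setup, writing and clearing of registers are all
  absorbed into the cost of the simulated runs.\<close>

lemma run_time_le:
  fixes C F :: real
  assumes CF: "real T \<le> C * F" and C: "0 \<le> C" and F: "real db + real query_len \<le> F" "0 < n"
  shows "real (45 + c + 4 * n + runs * (200 + 2 * (size_A * ((2 * d + 3) * (4 * \<sigma> + 25)))
      + (db - len) * \<sigma> * 12 + size_B * (7 * (12 * d + 4)) + N + 2 * T + 7))
    \<le> (306 + real c + real N + 20 * real \<sigma> + 2 * C) * (runs * F)"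
proof -
  let ?run = "200 + 2 * (size_A * ((2 * d + 3) * (4 * \<sigma> + 25))) + (db - len) * \<sigma> * 12
    + size_B * (7 * (12 * d + 4)) + N + 2 * T + 7"
  have runs1: "1 \<le> real runs" using runs by simp
  have len_db: "len \<le> db" using len_less by simp
  have nF: "real n \<le> F"
  proof -
    have "size_A * 1 \<le> len" "size_B * 1 \<le> (12 * d + 4) * size_B"
      unfolding len_def by (intro mult_le_mono2; simp) simp
    then have "size_A \<le> db" "size_B \<le> query_len"
      using len_db unfolding query_len_def by linarith+
    then have "n \<le> db + query_len" by (auto simp: size_A_def size_B_def split: if_splits)
    then have "real n \<le> real (db + query_len)" by (simp only: of_nat_le_iff)
    with F show ?thesis by simp
  qed
  then have F1: "1 \<le> F" using F(2) by linarith
  have "?run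
      \<le> 207 + N + (20 * \<sigma> + 50) * db + 7 * query_len + 2 * T"
  proof -
    have "size_A * ((2 * d + 3) * (4 * \<sigma> + 25)) = len * (4 * \<sigma> + 25)"
      by (simp add: len_def)
    also have "\<dots> \<le> db * (4 * \<sigma> + 25)"
      using len_db by (rule mult_le_mono1)
    finally have "2 * (size_A * ((2 * d + 3) * (4 * \<sigma> + 25))) \<le> 8 * (db * \<sigma>) + 50 * db"
      by (simp add: algebra_simps)
    moreover have "(db - len) * \<sigma> \<le> db * \<sigma>"
      by (intro mult_le_mono1) simp
    moreover have "size_B * (7 * (12 * d + 4)) \<le> 7 * query_len"
      by (simp add: query_len_def algebra_simps)
    moreover have "(20 * \<sigma> + 50) * db = 20 * (db * \<sigma>) + 50 * db"
      by (simp add: algebra_simps)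
    ultimately show ?thesis by linarith
  qed
  then have "real (?run)
      \<le> real (207 + N + (20 * \<sigma> + 50) * db + 7 * query_len + 2 * T)"
    by (simp only: of_nat_le_iff)
  also have "\<dots> = (207 + real N) * 1 + (20 * real \<sigma> + 50) * real db + 7 * real query_len + 2 * real T"
    by simp
  also have "\<dots> \<le> (207 + real N) * F + (20 * real \<sigma> + 50) * F + 2 * (C * F)"
  proof -
    have "(207 + real N) * 1 \<le> (207 + real N) * F"
      using F1 by (intro mult_left_mono) auto
    moreover have "(20 * real \<sigma> + 50) * (real db + real query_len) \<le> (20 * real \<sigma> + 50) * F"
      using F(1) by (intro mult_left_mono) auto
    moreover have "7 * real query_len \<le> (20 * real \<sigma> + 50) * real query_len"
      by (intro mult_right_mono) auto
    ultimately show ?thesis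
      using CF unfolding distrib_left by linarith
  qed
  also have "\<dots> = (257 + real N + 20 * real \<sigma> + 2 * C) * F"
    by (simp add: algebra_simps)
  finally have run: "real (?run)
      \<le> (257 + real N + 20 * real \<sigma> + 2 * C) * F" .
  have FR: "F \<le> runs * F" "1 \<le> runs * F"
    using runs1 F1 mult_mono[of 1 "real runs" 1 F] by auto
  have "real (45 + c + 4 * n) \<le> (45 + real c) * 1 + 4 * F"
    using nF by simp
  also have "\<dots> \<le> (45 + real c) * (runs * F) + 4 * (runs * F)"
    using FR by (intro add_mono mult_left_mono) auto
  finally have setup_le: "real (45 + c + 4 * n) \<le> (49 + real c) * (runs * F)"
    by (simp add: algebra_simps)
  have "real (45 + c + 4 * n + runs * (?run))
    = real (45 + c + 4 * n) + real runs * real (?run)"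
    by (simp only: of_nat_add of_nat_mult)
  also have "\<dots> \<le> (49 + real c) * (runs * F) + real runs * ((257 + real N + 20 * real \<sigma> + 2 * C) * F)"
    using setup_le run by (intro add_mono mult_left_mono) auto
  also have "\<dots> = (306 + real c + real N + 20 * real \<sigma> + 2 * C) * (runs * F)"
    by (simp add: algebra_simps)
  finally show ?thesis .
qed

end

theorem theorem5p5:
  fixes \<sigma> :: nat and \<epsilon> :: real
    and \<G> :: "(nat, nat) graph_db set"
    and f :: "real \<Rightarrow> real \<Rightarrow> real"
  assumes "\<sigma> \<ge> 2" and "\<epsilon> > 0"
    and "\<G> = UNIV \<or> (\<exists>c>0. \<G> = sparse_graphs c)"
    and "f = (\<lambda>D q. D powr (2 - \<epsilon>) + q ^ 2) \<or> f = (\<lambda>D q. D ^ 2 + q powr (2 - \<epsilon>))"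
    and "solvable_in_O (Check \<sigma> \<G>) (\<lambda>(L, q, u, v). f (db_size (db_of L)) (regex_size q))
       \<or> solvable_in_O (Boole \<sigma> \<G>) (\<lambda>(L, q). f (db_size (db_of L)) (regex_size q))
       \<or> solvable_in_O (Witness \<sigma> \<G>) (\<lambda>(L, q). f (db_size (db_of L)) (regex_size q))"
  shows "\<not> OV_hypothesis"
proof -
  have f_nonneg: "0 \<le> f x y" for x y
    using assms(4) by auto
  obtain pair P c C where C: "0 \<le> C" and decides: "decides_pairs \<sigma> \<G> f pair P c C"
    using solvable_decides_pairs[OF f_nonneg assms(5)] by blast
  \<comment> \<open>Only one sparse class is ever used; for the unrestricted problem any constant
    will do.\<close>
  obtain cs where cs: "0 < cs" "sparse_graphs cs \<subseteq> \<G>"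
    using assms(3) by (metis order_refl subset_UNIV zero_less_one)
  define K where "K = nat \<lceil>1 / cs\<rceil>"
  have "1 / cs \<le> K"
    by (simp add: K_def of_nat_ceiling)
  then have csK: "1 \<le> cs * K"
    using cs(1) by (simp add: field_simps)
  then have K: "1 \<le> K"
    by (cases K) auto
  \<comment> \<open>An exponent \<open>2 - \<epsilon>1\<close> of at least 1 is what allows linear
    costs to be absorbed.\<close>
  define \<epsilon>1 where "\<epsilon>1 = min \<epsilon> 1"
  have \<epsilon>1: "0 < \<epsilon>1" "\<epsilon>1 \<le> 1" "\<epsilon>1 \<le> \<epsilon>"
    using assms(2) by (auto simp: \<epsilon>1_def)
  define k where "k = nat \<lceil>2 / \<epsilon>1\<rceil>"
  have k_ge: "2 / \<epsilon>1 \<le> k"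
    by (simp add: k_def of_nat_ceiling)
  have "0 < 2 / \<epsilon>1" using \<epsilon>1 by simp
  with k_ge have k: "1 \<le> k" by (cases k) auto
  define \<delta> where "\<delta> = 1 / real k"
  have \<delta>: "0 < \<delta>" "2 * \<delta> \<le> \<epsilon>1"
    using k k_ge \<epsilon>1 by (auto simp: \<delta>_def field_simps)
  \<comment> \<open>The undivided set goes to the side whose exponent is below 2: into the graph for
    the first bound, into the query for the second.\<close>
  define large_A where "large_A \<longleftrightarrow> f = (\<lambda>D q. D powr (2 - \<epsilon>) + q ^ 2)"
  define Q where "Q = compile 0 (ov_program \<sigma> K c k large_A pair P)"
  define c' where "c' = word_factor_const \<sigma> K c k"
  define C' where "C' = (306 + real c + real (reg_bound P) + 20 * real \<sigma> + 2 * C) * (9 * (43 * real K) ^ 2)"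
  \<comment> \<open>The polynomial is \<open>(1 + d) ^ 2\<close>, from the square of the factor
    \<open>43 * K * (d + 1)\<close> that relates sizes to numbers of vectors.\<close>
  have "solves_within Q OV (\<lambda>x. C' * (\<lambda>(d, A, B). real (length A) powr (2 - \<delta>) * poly ([:1, 1:] ^ 2) (real d)) x)"
    unfolding solves_within_def
  proof (rule exI[of _ c'], intro ballI)
    fix x assume "x \<in> instances OV"
    then obtain d A B where x: "x = (d, A, B)" and inst: "A \<noteq> []" "length A = length B" "distinct A"
        "\<forall>a \<in> set A \<union> set B. length a = d"
      by (auto simp: OV_def)
    define n where "n = length A"
    interpret R: reduction \<sigma> K c k large_A A B n d
      by unfold_locales (use assms(1) K k inst in \<open>auto simp: n_def\<close>)
    \<comment> \<open>In dimension 0 there is only the empty vector, so distinctness forces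
      \<open>n \<le> 1\<close>.\<close>
    have nd: "n \<le> 2 + n * d"
    proof (cases d)
      case 0
      then have "set A \<subseteq> {[]}" using inst by auto
      then have "card (set A) \<le> 1" using card_mono[of "{[]}" "set A"] by simp
      then show ?thesis using inst by (simp add: n_def distinct_card)
    qed simp
    define w where "w = c' * ceillog2 (length R.inp + 2)"
    interpret W: reduction_run \<sigma> K c k large_A A B n d w
      by unfold_locales (use R.cap_word_size[OF nd] in \<open>simp_all add: w_def c'_def\<close>)
    have enc: "encoding OV x = R.inp"
      unfolding OV_def x R.inp_def by (simp add: n_def)
    define T where "T = nat \<lfloor>C * f R.db R.query_len\<rfloor>"
    have Cf: "0 \<le> C * f R.db R.query_len"
      using C f_nonneg by simp
    have T: "real T \<le> C * f R.db R.query_len"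
      using Cf by (simp add: T_def)
    have "wp w (ov_program \<sigma> K c k large_A pair P) (45 + c + 4 * n + R.runs * W.run_time P T)
      (\<lambda>r' m'. r' 0 = of_bool (\<exists>a \<in> set A. \<exists>b \<in> set B. orthogonal_vecs a b)) (\<lambda>_. 0)
      (\<lambda>i. if i < length R.inp then R.inp ! i else 0)"
    proof (rule W.wp_ov_program)
      fix t assume "t < R.runs"
      let ?v = "c * ceillog2 (length (R.code pair t) + 2)"
      have input: "(R.graph t, query (R.run_B t)) \<in> rpq_inputs \<sigma> \<G>"
        using R.rpq_input R.graph_sparse[OF csK cs(1)] cs(2) by blast
      have pair: "0 < length (R.graph t)" "R.len < length (R.graph t)"
        using R.len_less by (simp_all add: R.length_graph)
      obtain \<tau> out where "ram_computes ?v P (R.code pair t) \<tau> out"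
          "real \<tau> \<le> C * f R.db R.query_len" "out 0 = of_bool (R.found t)"
        using decides[unfolded decides_pairs_def Let_def, rule_format, OF input pair R.found_pair(2)]
        unfolding R.code_def[symmetric] R.db_size_graph R.regex_size_query R.found_pair(1)[symmetric]
        by blast
      moreover from this have "\<tau> \<le> T"
        by (simp add: T_def le_nat_floor)
      moreover have "2 ^ ?v \<le> R.region"
        by (rule R.run_word_size)
      moreover from this have "2 ^ ?v < (2 :: nat) ^ w"
        by (rule le_less_trans) (rule W.region_less, simp)
      then have "?v \<le> w" by simp
      ultimately show "\<exists>v \<tau> out. ram_computes v P (R.code pair t) \<tau> out \<and> \<tau> \<le> T \<and>
          out 0 = of_bool (R.found t) \<and> v \<le> w \<and> 2 ^ v \<le> R.region"
        by blast
    qed simp_all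
    from ram_computes_compile[OF this] obtain t out where
      t: "ram_computes w Q R.inp t out" "t \<le> 45 + c + 4 * n + R.runs * W.run_time P T"
        "out 0 = of_bool (\<exists>a \<in> set A. \<exists>b \<in> set B. orthogonal_vecs a b)"
      unfolding Q_def by blast
    \<comment> \<open>\<open>X\<close> is the size that enters with exponent below 2,
      \<open>Y\<close> the one that is squared.\<close>
    define X where "X = real (if large_A then R.db else R.query_len)"
    define Y where "Y = real (if large_A then R.query_len else R.db)"
    define F where "F = X powr (2 - \<epsilon>1) + Y ^ 2"
    have "1 \<le> R.db" "1 \<le> R.query_len"
      using R.len_less R.bounds by (auto simp: R.query_len_def)
    then have X1: "1 \<le> X" and Y1: "1 \<le> Y"
      by (auto simp: X_def Y_def)
    have "f R.db R.query_len \<le> F"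
    proof -
      have "X powr (2 - \<epsilon>) \<le> X powr (2 - \<epsilon>1)"
        using X1 \<epsilon>1 by (intro powr_mono) auto
      moreover have "f R.db R.query_len = X powr (2 - \<epsilon>) + Y ^ 2"
        using assms(4) by (cases large_A) (auto simp: X_def Y_def large_A_def)
      ultimately show ?thesis by (simp add: F_def)
    qed
    then have CF: "real T \<le> C * F"
      using T mult_left_mono[OF _ C] by fastforce
    have "real R.db + real R.query_len \<le> F"
    proof -
      have "X powr 1 \<le> X powr (2 - \<epsilon>1)"
        using X1 \<epsilon>1 by (intro powr_mono) auto
      moreover have "Y * 1 \<le> Y * Y"
        using Y1 by (intro mult_left_mono) auto
      moreover have "real R.db + real R.query_len = X + Y"
        by (simp add: X_def Y_def)
      ultimately show ?thesis
        using X1 by (simp add: F_def power2_eq_square)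
    qed
    from R.run_time_le[OF CF C this R.n, of "reg_bound P"]
    have time: "real t \<le> (306 + real c + real (reg_bound P) + 20 * real \<sigma> + 2 * C) * (R.runs * F)"
      using t(2) unfolding W.run_time_def by (meson of_nat_le_iff order_trans)
    have "real R.runs * (X powr (2 - \<epsilon>1) + Y ^ 2) \<le> 9 * real (43 * K * (d + 1)) ^ 2 * real n powr (2 - \<delta>)"
    proof (rule balanced_cost)
      show "real R.runs \<le> real n powr \<delta>" "real n powr \<delta> < 2 * real R.runs"
        using R.runs_root by (simp_all add: \<delta>_def)
      show "real R.runs * real R.part_size \<le> 2 * real n" by (rule R.part_size_le)
      show "X \<le> real (43 * K * (d + 1)) * real n" "Y \<le> real (43 * K * (d + 1)) * real R.part_size"
        using R.size_bounds unfolding X_def Y_def R.size_A_def R.size_B_def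
        by (auto simp: algebra_simps split: if_splits)
      have "1 * 1 \<le> (43 * K) * (d + 1)" using K by (intro mult_le_mono) auto
      then have "real 1 \<le> real (43 * K * (d + 1))"
        by (simp only: of_nat_le_iff mult_1)
      then show "1 \<le> real (43 * K * (d + 1))"
        by (simp only: of_nat_1)
    qed (use R.n R.runs \<epsilon>1 \<delta> X1 Y1 in auto)
    then have "(306 + real c + real (reg_bound P) + 20 * real \<sigma> + 2 * C) * (R.runs * F)
        \<le> (306 + real c + real (reg_bound P) + 20 * real \<sigma> + 2 * C) * (9 * real (43 * K * (d + 1)) ^ 2 * real n powr (2 - \<delta>))"
      unfolding F_def using C by (intro mult_left_mono) auto
    also have "\<dots> = C' * (real n powr (2 - \<delta>) * poly ([:1, 1:] ^ 2) (real d))"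
    proof -
      have "real (43 * K * (d + 1)) ^ 2 = (43 * real K) ^ 2 * poly ([:1, 1:] ^ 2) (real d)"
      proof -
        have "real (43 * K * (d + 1)) = 43 * real K * (1 + real d)"
          by (simp add: algebra_simps)
        moreover have "poly ([:1, 1:] ^ 2) (real d) = (1 + real d) ^ 2"
          by (simp add: poly_power)
        ultimately show ?thesis
          by (simp only: power_mult_distrib)
      qed
      then show ?thesis
        by (simp only: C'_def ac_simps)
    qed
    finally have "real t \<le> C' * (real n powr (2 - \<delta>) * poly ([:1, 1:] ^ 2) (real d))"
      using time by linarith
    then show "\<exists>t out. ram_computes (c' * ceillog2 (length (encoding OV x) + 2)) Q (encoding OV x) t out \<and>
        real t \<le> C' * (\<lambda>(d, A, B). real (length A) powr (2 - \<delta>) * poly ([:1, 1:] ^ 2) (real d)) x \<and>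
        correct_output OV x out"
      unfolding enc using t by (intro exI[of _ t] exI[of _ out]) (simp add: x n_def w_def OV_def)
  qed
  then have "\<exists>p :: real poly. solvable_in_O OV (\<lambda>(d, A, B). real (length A) powr (2 - \<delta>) * poly p (real d))"
    unfolding solvable_in_O_def by blast
  with \<delta>(1) show ?thesis
    unfolding OV_hypothesis_def by blast
qed

end
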